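(* Let $0<|q|<1$ and let $n=1,2,3,\dots$. Then $$\vartheta_3(0,-q)^{4n(n+1)}=1+\sum_{p=1}^{n}(-1)^{n-p}2^{2n^2+3n}\prod_{r=1}^{2n}(r!)^{-1}\sum_{\substack{y_1,\dots,y_p\ge1\\ m_1>m_2>\cdots>m_p\ge1}}(-1)^{m_1+\cdots+m_p}q^{m_1y_1+\cdots+m_py_p}$$ $$\cdot(m_1m_2\cdots m_p)^3\prod_{1\le r<s\le p}\left(m_r^2-m_s^2\right)^2\sum_{\substack{\emptyset\subset S,T\subseteq I_n\\ \|S\|=\|T\|=p}}(-1)^{\Sigma(S)+\Sigma(T)}\det\left(D_{n-p,S^c,T^c}\right)$$ $$\cdot(m_1m_2\cdots m_p)^{2\ell_1+2j_1-4}\,s_\lambda(m_1^2,\dots,m_p^2)\,s_\nu(m_1^2,\dots,m_p^2),$$ where the $y_i$ and $m_i$ are integers; $S=\{\ell_1<\cdots<\ell_p\}$, $S^c=I_n\setminus S=\{\ell_{p+1}<\cdots<\ell_n\}$, $T=\{j_1<\cdots<j_p\}$, $T^c=I_n\setminus T=\{j_{p+1}<\cdots<j_n\}$; $D_{n-p,S^c,T^c}$ is the $(n-p)\times(n-p)$ matrix $$D_{n-p,S^c,T^c}:=\left[a_{(\ell_{p+r}+j_{p+s}-1)}\right]_{1\le r,s\le n-p},\qquad a_i:=(-1)^{i}\frac{2^{2i+2}-1}{4(i+1)}|B_{2i+2}|\quad(i=1,2,3,\dots);$$ and $s_\lambda,s_\nu$ are the Schur functions for the partitions $\lambda=(\lambda_1,\dots,\lambda_p)$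 and $\nu=(\nu_1,\dots,\nu_p)$ given by $$\lambda_i:=\ell_{p-i+1}-\ell_1+i-p,\qquad \nu_i:=j_{p-i+1}-j_1+i-p,\qquad i=1,2,\dots,p.$$
   Context: $\vartheta_3(0,q):=\sum_{j=-\infty}^{\infty}q^{j^2}$, so $\vartheta_3(0,-q)=\sum_{j=-\infty}^{\infty}(-1)^{j}q^{j^2}$. $I_n:=\{1,\dots,n\}$, $\|S\|$ is the cardinality of $S$, $\Sigma(S):=\ell_1+\cdots+\ell_p$ and $\Sigma(T):=j_1+\cdots+j_p$. The determinant of the $0\times0$ matrix is $1$. For a partition $\lambda=(\lambda_1\ge\cdots\ge\lambda_p\ge0)$, the Schur function is $s_\lambda(x_1,\dots,x_p):=\dfrac{\det(x_i^{\lambda_j+p-j})_{1\le i,j\le p}}{\det(x_i^{p-j})_{1\le i,j\le p}}$. The Bernoulli numbers $B_n$ are defined by $\frac{t}{e^t-1}=\sum_{n=0}^{\infty}B_n\frac{t^n}{n!}$. *)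

theory Defs
  imports
    "HOL-Analysis.Infinite_Sum"
    "HOL-Computational_Algebra.Formal_Power_Series"
    "HOL-Library.FuncSet"
    "Jordan_Normal_Form.Determinant"
begin

definition theta3_0 :: "complex \<Rightarrow> complex" where
  "theta3_0 q = (\<Sum>\<^sub>\<infinity>j::int. q powi (j\<^sup>2))"

text \<open>\<open>B\<^sub>n\<close> is \<open>n!\<close> times the \<open>n\<close>-th coefficient of \<open>t / (e\<^sup>t - 1)\<close>. The quotient of power series
  is taken with the library's division, which cancels the common factor \<open>t\<close>.\<close>

definition bernoulli :: "nat \<Rightarrow> real" where
  "bernoulli n = fact n * fps_nth (fps_X / (fps_exp 1 - 1)) n"

lemma bernoulli_egf:
  "Abs_fps (\<lambda>n. bernoulli n / fact n) * (fps_exp 1 - 1) = fps_X"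
proof -
  let ?E = "fps_exp 1 - 1 :: real fps"
  have nz: "?E \<noteq> 0"
  proof
    assume "?E = 0"
    then have "fps_nth ?E 1 = 0" by simp
    then show False by simp
  qed
  have "fps_nth ?E 1 \<noteq> 0" by simp
  then have "subdegree ?E \<le> subdegree (fps_X :: real fps)"
    by (simp add: subdegree_leI)
  with nz have "?E dvd fps_X"
    by (simp add: fps_dvd_iff)
  moreover have "Abs_fps (\<lambda>n. bernoulli n / fact n) = fps_X / ?E"
    by (rule fps_ext) (simp add: bernoulli_def)
  ultimately show ?thesis by simp
qed

definition a_coeff :: "nat \<Rightarrow> real" where
  "a_coeff i = (-1) ^ i * (2 ^ (2 * i + 2) - 1) / (4 * (real i + 1)) * \<bar>bernoulli (2 * i + 2)\<bar>"

text \<open>\<open>elt S r\<close> is the \<open>r\<close>-th smallest element of the finite set \<open>S\<close>, counted from \<open>1\<close>;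
  thus \<open>\<ell>\<^sub>r = elt S r\<close> and \<open>\<ell>\<^sub>p\<^sub>+\<^sub>r = elt (S\<^sup>c) r\<close>.\<close>

definition elt :: "nat set \<Rightarrow> nat \<Rightarrow> nat" where
  "elt S r = sorted_list_of_set S ! (r - 1)"

text \<open>Matrix entries are numbered from \<open>0\<close>, so a matrix index \<open>r\<close> stands for row or column
  \<open>r + 1\<close> here and in the Schur functions.\<close>

definition D_mat :: "nat \<Rightarrow> nat set \<Rightarrow> nat set \<Rightarrow> real mat" where
  "D_mat k U V = mat k k (\<lambda>(r, s). a_coeff (elt U (r + 1) + elt V (s + 1) - 1))"

definition schur :: "nat \<Rightarrow> (nat \<Rightarrow> nat) \<Rightarrow> (nat \<Rightarrow> 'a::field) \<Rightarrow> 'a" where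
  "schur p lam x =
     Determinant.det (mat p p (\<lambda>(i, j). x (i + 1) ^ (lam (j + 1) + p - (j + 1)))) /
     Determinant.det (mat p p (\<lambda>(i, j). x (i + 1) ^ (p - (j + 1))))"

text \<open>\<open>\<lambda>\<^sub>i = \<ell>\<^sub>p\<^sub>-\<^sub>i\<^sub>+\<^sub>1 - \<ell>\<^sub>1 + i - p\<close>, with the negative terms collected. As
  \<open>\<ell>\<^sub>p\<^sub>-\<^sub>i\<^sub>+\<^sub>1 \<ge> \<ell>\<^sub>1 + p - i\<close>, the subtraction on \<open>nat\<close> does not truncate for \<open>1 \<le> i \<le> p = card S\<close>.\<close>

definition part :: "nat \<Rightarrow> nat set \<Rightarrow> nat \<Rightarrow> nat" where
  "part p S i = (elt S (p - i + 1) + i) - (elt S 1 + p)"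

definition index_set :: "nat \<Rightarrow> ((nat \<Rightarrow> nat) \<times> (nat \<Rightarrow> nat)) set" where
  "index_set p = {(y, m). y \<in> {1..p} \<rightarrow>\<^sub>E {1..} \<and> m \<in> {1..p} \<rightarrow>\<^sub>E {1..} \<and>
     (\<forall>r s. 1 \<le> r \<and> r < s \<and> s \<le> p \<longrightarrow> m s < m r)}"

definition minor_sum :: "nat \<Rightarrow> nat \<Rightarrow> (nat \<Rightarrow> nat) \<Rightarrow> real" where
  "minor_sum n p m =
     (\<Sum>(S, T) \<in> {(S, T). S \<subseteq> {1..n} \<and> T \<subseteq> {1..n} \<and> S \<noteq> {} \<and> T \<noteq> {} \<and> card S = p \<and> card T = p}.
        (-1) ^ (\<Sum>S + \<Sum>T) * Determinant.det (D_mat (n - p) ({1..n} - S) ({1..n} - T)) *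
        (\<Prod>r=1..p. real (m r)) ^ (2 * elt S 1 + 2 * elt T 1 - 4) *
        schur p (part p S) (\<lambda>r. (real (m r))\<^sup>2) * schur p (part p T) (\<lambda>r. (real (m r))\<^sup>2))"

definition series_term :: "nat \<Rightarrow> nat \<Rightarrow> complex \<Rightarrow> (nat \<Rightarrow> nat) \<Rightarrow> (nat \<Rightarrow> nat) \<Rightarrow> complex" where
  "series_term n p q y m =
     (-1) ^ (\<Sum>r=1..p. m r) * q ^ (\<Sum>r=1..p. m r * y r) *
     (\<Prod>r=1..p. of_nat (m r)) ^ 3 *
     (\<Prod>(r, s) \<in> {(r, s). 1 \<le> r \<and> r < s \<and> s \<le> p}. ((of_nat (m r))\<^sup>2 - (of_nat (m s))\<^sup>2)\<^sup>2) *
     of_real (minor_sum n p m)"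

end

theory Submission
  imports "HOL-Complex_Analysis.Complex_Analysis" Defs
begin

no_notation Infinite_Set_Sum.abs_summable_on (infix \<open>abs'_summable'_on\<close> 50)
notation Infinite_Sum.abs_summable_on (infixr \<open>abs'_summable'_on\<close> 46)

text \<open>For \<open>\<wp>(x) = \<Sum>\<^sub>m\<^sub>\<noteq>\<^sub>0 m x\<^sup>m / (1 - q\<^sup>m)\<close> and \<open>\<phi>(x) = \<Sum>\<^sub>m x\<^sup>m / (1 + q\<^sup>m)\<close>, partial fractions turn the
  convolutions of the coefficients into telescoping sums. This gives \<open>\<phi>\<^sup>2 = \<wp> + const\<close> and expresses \<open>\<wp>\<^sup>2\<close>
  linearly through \<open>\<wp>\<close>, \<open>(x d/dx)\<^sup>2 \<wp>\<close> and a constant. Put \<open>x = - exp z\<close>; then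
  \<open>f = \<phi>\<^sup>2\<close> vanishes to second order at \<open>z = 0\<close> and solves \<open>f'' = 6 f\<^sup>2 + A f + C\<close>. Its Taylor coefficients are
  the Lambert series minus the \<open>a\<^sub>i\<close>, and the differential equation alone evaluates their Hankel
  determinant as a constant times a power of \<open>\<phi>'(0)\<close>.

  The value \<open>\<phi>'(0) = - \<theta>\<^sup>4 / 4\<close> is the four squares theorem. As \<open>\<phi>(-q)\<close> for the nome \<open>q\<^sup>2\<close> is half the two squares
  series, it follows by squaring from the two squares theorem; the quotient of the two squares series
  by \<open>\<theta>\<^sup>2\<close> is invariant under \<open>q \<mapsto> q\<^sup>2\<close> and hence equal to its value \<open>1\<close> at \<open>0\<close>.

  The right-hand side of the theorem is the expansion of the Hankel determinant of a sum: Laplace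
  expansion of \<open>det (A + B)\<close> over pairs of minors, Cauchy-Binet for the minors of the Lambert series,
  and the bialternant formula for Schur functions. The terms with \<open>p = 0\<close> form the Hankel determinant
  for \<open>q = 0\<close>, which accounts for the summand \<open>1\<close>.\<close>

section \<open>Hankel determinants of solutions of a quadratic differential equation\<close>

text \<open>The bilateral series converge only for |q| < |x| < 1, whereas Taylor coefficients are
  wanted at x = -1, on the boundary of this annulus. The split 1/(1 - q^m) = 1 + q^m/(1 - q^m), and
  its analogue for 1 + q^m, isolates a geometric part with a closed form; the rest converges for |x|
  < 1/|q|. The identities proved in the annulus therefore extend to a disc around z = 0 by the
  identity theorem. The sign in x = - exp z keeps the pole x = 1 away from the centre and turns the
  geometric part of \<wp> into the derivative of 1/(1 + e^z), whose coefficient of z^(2i) is -2 a_i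
  / (2i)!. For q = 0 only f = (tanh(z/2) / 2)^2 remains, which solves an equation of the same form.
  One determinant theorem thus serves both cases, with the same product of factorials; only the
  coefficient of z^2 differs, \<theta>^8 / 16 against 1 / 16. It enters with exponent s = 1 + ... +
  n, so the quotient of the determinants is \<theta>^(8s) with 8s = 4n(n+1), and the power of 2 in
  the theorem is 2^n 16^s.\<close>

lemma second_deriv_power_of_quadratic_ode:
  fixes f :: "'a::field_char_0 fps"
  assumes f0: "fps_nth f 0 = 0" and f1: "fps_nth f 1 = 0"
    and ode: "fps_deriv (fps_deriv f) = 6 * f\<^sup>2 + fps_const A * f + fps_const C"
  shows "fps_deriv (fps_deriv (f ^ Suc k)) =
    of_nat (2 * Suc k * (2 * Suc k + 1)) * f ^ (k + 2) + of_nat (Suc k ^ 2) * fps_const A * f ^ Suc k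
      + fps_const C * of_nat (Suc k * (2 * k + 1)) * f ^ k"
proof -
  let ?f' = "fps_deriv f"
  \<comment> \<open>Multiplying the equation by 2 f' and integrating gives the energy identity f'^2
    = 4 f^3 + A f^2 + 2 C f; f(0) = f'(0) = 0 makes the constant of integration vanish.\<close>
  define g where "g = ?f'\<^sup>2 - (4 * f ^ 3 + fps_const A * f\<^sup>2 + 2 * fps_const C * f)"
  have "fps_deriv g = 2 * ?f' * (fps_deriv ?f' - (6 * f\<^sup>2 + fps_const A * f + fps_const C))"
    unfolding g_def by (simp add: fps_deriv_power power2_eq_square power3_eq_cube algebra_simps)
  then have "fps_deriv g = 0"
    using ode by simp
  moreover have "fps_nth g 0 = 0"
    using f0 f1 by (simp add: g_def power2_eq_square power3_eq_cube)
  ultimately have "g = 0"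
    by (simp add: fps_deriv_eq_0_iff)
  then have energy: "?f'\<^sup>2 = 4 * f ^ 3 + fps_const A * f\<^sup>2 + 2 * fps_const C * f"
    by (simp add: g_def)
  show ?thesis
  \<comment> \<open>(f^(k+1))'' contains k f'^2 f^(k-1), whose exponent needs k > 0; there the
    energy identity replaces f'^2.\<close>
  proof (cases k)
    case 0
    then show ?thesis using ode by (simp add: power2_eq_square)
  next
    case (Suc l)
    have "fps_deriv (f ^ Suc k) = of_nat (Suc k) * ?f' * f ^ k"
      by (simp only: fps_deriv_power fps_of_nat diff_Suc_1)
    then have "fps_deriv (fps_deriv (f ^ Suc k)) =
        of_nat (Suc k) * (fps_deriv ?f' * f ^ k + ?f' * (of_nat k * ?f' * f ^ l))"
      using Suc by (simp add: fps_deriv_power fps_of_nat algebra_simps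
        del: power_Suc of_nat_Suc flip: fps_const_mult)
    also have "\<dots> = of_nat (Suc k) * (fps_deriv ?f' * f ^ k + of_nat k * ?f'\<^sup>2 * f ^ l)"
      by (simp add: power2_eq_square algebra_simps)
    also have "\<dots> = of_nat (Suc k) * ((6 * f\<^sup>2 + fps_const A * f + fps_const C) * f ^ k
        + of_nat k * (4 * f ^ 3 + fps_const A * f\<^sup>2 + 2 * fps_const C * f) * f ^ l)"
      by (simp only: ode energy)
    finally show ?thesis
      using Suc by (simp add: algebra_simps power2_eq_square power3_eq_cube)
  qed
qed

text \<open>Two differentiations map f^(k+1) to a combination of f^(k+2), f^(k+1) and f^k, so every
  even derivative is a polynomial in f. The top coefficient is multiplied by (2j+2)(2j+3) at each
  stage, hence the factorial. The constant term stands apart because it disappears when coefficients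
  of positive order are read off.\<close>

lemma even_deriv_of_quadratic_ode:
  fixes f :: "'a::field_char_0 fps"
  assumes "fps_nth f 0 = 0" and "fps_nth f 1 = 0"
    and "fps_deriv (fps_deriv f) = 6 * f\<^sup>2 + fps_const A * f + fps_const C"
  shows "\<exists>u c. (fps_deriv ^^ (2 * j)) f = (\<Sum>k\<le>j. fps_const (u k) * f ^ Suc k) + fps_const c \<and>
    u j = fact (2 * j + 1)"
proof (induction j)
  case 0
  show ?case
    by (rule exI[of _ "\<lambda>_. 1"], rule exI[of _ 0]) simp
next
  case (Suc j)
  then obtain u c where D: "(fps_deriv ^^ (2 * j)) f = (\<Sum>k\<le>j. fps_const (u k) * f ^ Suc k) + fps_const c"
    and uj: "u j = fact (2 * j + 1)" by blast
  define p where "p k = u k * of_nat (2 * Suc k * (2 * Suc k + 1))" for k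
  define r where "r k = u k * of_nat (Suc k ^ 2) * A" for k
  define s where "s k = u k * C * of_nat (Suc k * (2 * k + 1))" for k
  have "(fps_deriv ^^ (2 * Suc j)) f = fps_deriv (fps_deriv ((fps_deriv ^^ (2 * j)) f))"
    by simp
  also have "\<dots> = (\<Sum>k\<le>j. fps_const (u k) * fps_deriv (fps_deriv (f ^ Suc k)))"
    unfolding D by (simp add: fps_deriv_sum del: power_Suc)
  also have "\<dots> = (\<Sum>k\<le>j. fps_const (p k) * f ^ Suc (Suc k) + fps_const (r k) * f ^ Suc k
      + fps_const (s k) * f ^ k)"
    unfolding second_deriv_power_of_quadratic_ode[OF assms]
    by (intro sum.cong refl)
      (simp add: p_def r_def s_def fps_of_nat[symmetric] algebra_simps
        flip: fps_const_mult fps_const_add)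
  also have "\<dots> = (\<Sum>k\<le>j. fps_const (p k) * f ^ Suc (Suc k)) + (\<Sum>k\<le>j. fps_const (r k) * f ^ Suc k)
      + (\<Sum>k\<le>j. fps_const (s k) * f ^ k)"
    by (simp add: sum.distrib)
  \<comment> \<open>The sums over f^(k+2), f^(k+1) and f^k are brought to one common range of powers
    f^(k+1); the single term without f becomes the new constant \<open>s 0\<close>.\<close>
  also have "(\<Sum>k\<le>j. fps_const (p k) * f ^ Suc (Suc k))
      = (\<Sum>k\<le>Suc j. fps_const (if k = 0 then 0 else p (k - 1)) * f ^ Suc k)"
    by (subst sum.atMost_Suc_shift) simp
  also have "(\<Sum>k\<le>j. fps_const (r k) * f ^ Suc k)
      = (\<Sum>k\<le>Suc j. fps_const (if k \<le> j then r k else 0) * f ^ Suc k)"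
    by simp
  also have "(\<Sum>k\<le>j. fps_const (s k) * f ^ k)
      = (\<Sum>k\<le>Suc j. fps_const (if k < j then s (Suc k) else 0) * f ^ Suc k) + fps_const (s 0)"
  proof -
    have "(\<Sum>k\<le>j. fps_const (s k) * f ^ k) = fps_const (s 0) + (\<Sum>k<j. fps_const (s (Suc k)) * f ^ Suc k)"
      by (simp only: lessThan_Suc_atMost[symmetric] sum.lessThan_Suc_shift) simp
    also have "(\<Sum>k<j. fps_const (s (Suc k)) * f ^ Suc k)
        = (\<Sum>k\<le>Suc j. fps_const (if k < j then s (Suc k) else 0) * f ^ Suc k)"
      by (rule sum.mono_neutral_cong_left) auto
    finally show ?thesis by (simp add: add.commute)
  qed
  finally have "(fps_deriv ^^ (2 * Suc j)) f = (\<Sum>k\<le>Suc j. fps_const ((if k = 0 then 0 else p (k - 1))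
      + (if k \<le> j then r k else 0) + (if k < j then s (Suc k) else 0)) * f ^ Suc k) + fps_const (s 0)"
    by (simp only: sum.distrib[symmetric] add.assoc[symmetric] distrib_right[symmetric] fps_const_add)
  moreover have "p j = fact (2 * Suc j + 1)"
    by (simp add: p_def uj algebra_simps)
  ultimately show ?case
    by (intro exI[of _ "\<lambda>k. (if k = 0 then 0 else p (k - 1))
      + (if k \<le> j then r k else 0) + (if k < j then s (Suc k) else 0)"] exI[of _ "s 0"]) simp
qed

lemma fps_nth_power_order_two:
  fixes f :: "'a::comm_ring_1 fps"
  assumes "fps_nth f 0 = 0" and "fps_nth f 1 = 0"
  shows "m < 2 * k \<Longrightarrow> fps_nth (f ^ k) m = 0" and "fps_nth (f ^ k) (2 * k) = fps_nth f 2 ^ k"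
proof -
  define g where "g = fps_shift 2 f"
  have f: "f = fps_X ^ 2 * g"
  proof (rule fps_ext)
    fix n
    show "fps_nth f n = fps_nth (fps_X ^ 2 * g) n"
    proof (cases "n < 2")
      case True
      then have "n = 0 \<or> n = 1" by auto
      then show ?thesis using assms by (auto simp: fps_X_power_mult_nth)
    next
      case False
      then have "n - 2 + 2 = n" by simp
      then show ?thesis using False by (simp add: g_def fps_X_power_mult_nth del: add_2_eq_Suc')
    qed
  qed
  have fk: "f ^ k = fps_X ^ (2 * k) * g ^ k" for k
    by (simp add: f power_mult_distrib power_mult)
  show "m < 2 * k \<Longrightarrow> fps_nth (f ^ k) m = 0"
    by (simp add: fk fps_X_power_mult_nth)
  have "fps_nth f 2 = fps_nth g 0"
    by (simp add: g_def numeral_2_eq_2)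
  then show "fps_nth (f ^ k) (2 * k) = fps_nth f 2 ^ k"
    by (simp add: fk fps_X_power_mult_nth fps_nth_power_0)
qed

text \<open>The Hankel matrix is the product of the lower triangular matrix of the coefficients of the powers
  of \<open>f\<close> and of the upper triangular matrix expressing \<open>f'', f'''', \<dots>\<close> through these powers.\<close>

theorem hankel_det_quadratic_ode:
  fixes f :: "'a::field_char_0 fps"
  assumes f0: "fps_nth f 0 = 0" and f1: "fps_nth f 1 = 0"
    and ode: "fps_deriv (fps_deriv f) = 6 * f\<^sup>2 + fps_const A * f + fps_const C"
  shows "det (mat n n (\<lambda>(i, j). fact (2 * (i + j + 1)) * fps_nth f (2 * (i + j + 1))))
    = (\<Prod>r=1..2*n. fact r) * fps_nth f 2 ^ (\<Sum>k<n. Suc k)"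
proof -
  obtain u c where D: "\<And>j. (fps_deriv ^^ (2 * j)) f = (\<Sum>k\<le>j. fps_const (u j k) * f ^ Suc k) + fps_const (c j)"
    and ud: "\<And>j. u j j = fact (2 * j + 1)"
    using even_deriv_of_quadratic_ode[OF assms] by metis
  define L where "L = mat n n (\<lambda>(i, k). fact (2 * Suc i) * fps_nth (f ^ Suc k) (2 * Suc i))"
  define U where "U = mat n n (\<lambda>(k, j). if k \<le> j then u j k else 0)"
  have entry: "fact (2 * (i + j + 1)) * fps_nth f (2 * (i + j + 1))
      = (\<Sum>k<n. fact (2 * Suc i) * fps_nth (f ^ Suc k) (2 * Suc i) * (if k \<le> j then u j k else 0))"
    if "j < n" for i j
  proof -
    \<comment> \<open>The order of differentiation is split as 2(i+1) + 2j: the inner 2j derivatives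
      are expanded in powers of f, the outer ones only read off a coefficient. Since 2(i+1) > 0, the
      constant \<open>c j\<close> does not contribute.\<close>
    have "fact (2 * (i + j + 1)) * fps_nth f (2 * (i + j + 1))
        = fps_nth ((fps_deriv ^^ (2 * Suc i + 2 * j)) f) 0"
      by (simp only: fps_0th_higher_deriv) (simp add: algebra_simps)
    also have "\<dots> = fps_nth ((fps_deriv ^^ (2 * Suc i)) ((fps_deriv ^^ (2 * j)) f)) 0"
      by (simp only: funpow_add comp_def)
    also have "\<dots> = fact (2 * Suc i) * fps_nth ((fps_deriv ^^ (2 * j)) f) (2 * Suc i)"
      by (simp only: fps_0th_higher_deriv)
    also have "\<dots> = fact (2 * Suc i) * (\<Sum>k\<le>j. u j k * fps_nth (f ^ Suc k) (2 * Suc i))"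
      unfolding D by (simp add: fps_sum_nth del: power_Suc fact_Suc)
    also have "\<dots> = (\<Sum>k\<le>j. fact (2 * Suc i) * fps_nth (f ^ Suc k) (2 * Suc i) * u j k)"
      by (simp add: sum_distrib_left mult_ac del: power_Suc fact_Suc)
    also have "\<dots> = (\<Sum>k<n. fact (2 * Suc i) * fps_nth (f ^ Suc k) (2 * Suc i) * (if k \<le> j then u j k else 0))"
      by (rule sum.mono_neutral_cong_left) (use that in auto)
    finally show ?thesis .
  qed
  have "mat n n (\<lambda>(i, j). fact (2 * (i + j + 1)) * fps_nth f (2 * (i + j + 1))) = L * U"
    by (rule eq_matI) (use entry in \<open>auto simp: L_def U_def scalar_prod_def atLeast0LessThan
      simp del: power_Suc fact_Suc intro!: sum.cong\<close>)
  then have "det (mat n n (\<lambda>(i, j). fact (2 * (i + j + 1)) * fps_nth f (2 * (i + j + 1))))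
      = det L * det U"
    by (simp add: det_mult[of _ n] L_def U_def)
  also have "det L = prod_list (diag_mat L)"
    by (rule det_lower_triangular[of n])
      (auto simp: L_def fps_nth_power_order_two[OF f0 f1] simp del: power_Suc fact_Suc)
  also have "\<dots> = (\<Prod>i<n. fact (2 * Suc i) * fps_nth f 2 ^ Suc i)"
    by (simp add: diag_mat_def L_def prod.list_conv_set_nth atLeast0LessThan
      fps_nth_power_order_two[OF f0 f1] del: power_Suc fact_Suc mult_Suc_right)
  also have "det U = prod_list (diag_mat U)"
    by (rule det_upper_triangular[of _ n]) (auto simp: U_def upper_triangular_def)
  also have "\<dots> = (\<Prod>i<n. fact (2 * i + 1))"
    by (simp add: diag_mat_def U_def prod.list_conv_set_nth atLeast0LessThan ud del: fact_Suc)
  also have "(\<Prod>i<n. fact (2 * Suc i) * fps_nth f 2 ^ Suc i) * (\<Prod>i<n. fact (2 * i + 1)) =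
      (\<Prod>i<n. fact (2 * i + 1) * fact (2 * i + 2)) * fps_nth f 2 ^ (\<Sum>k<n. Suc k)"
    by (simp add: prod.distrib power_sum mult_ac del: power_Suc fact_Suc)
  \<comment> \<open>The even factorials from the diagonal of \<open>L\<close> and the odd ones from
    that of \<open>U\<close> interleave.\<close>
  also have "(\<Prod>i<n. fact (2 * i + 1) * fact (2 * i + 2)) = (\<Prod>r=1..2*n. fact r :: 'a)"
    by (induction n) (simp_all add: mult_ac del: fact_Suc)
  finally show ?thesis .
qed

section \<open>Minors of a sum of matrices\<close>

lemma det_permute_rows_cols:
  fixes M :: "nat \<Rightarrow> nat \<Rightarrow> 'a::comm_ring_1"
  assumes p: "p permutes {0..<n}" and q: "q permutes {0..<n}"
  shows "det (mat n n (\<lambda>(i, j). M (p i) (q j)))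
    = signof p * signof q * det (mat n n (\<lambda>(i, j). M i j))"
proof -
  have lt: "p i < n" "q i < n" if "i < n" for i
    using permutes_in_image[OF p, of i] permutes_in_image[OF q, of i] that by auto
  let ?Q = "mat n n (\<lambda>(i, j). M i (q j))"
  have "mat n n (\<lambda>(i, j). M (p i) (q j)) = mat n n (\<lambda>(i, j). ?Q $$ (p i, j))"
    by (rule eq_matI) (auto simp: lt)
  then have "det (mat n n (\<lambda>(i, j). M (p i) (q j))) = signof p * det ?Q"
    using det_permute_rows[OF _ p, of ?Q] by simp
  also have "det ?Q = det (transpose_mat ?Q)"
    by (rule det_transpose[symmetric, of _ n]) simp
  also have "transpose_mat ?Q = mat n n (\<lambda>(i, j). transpose_mat (mat n n (\<lambda>(i, j). M i j)) $$ (q i, j))"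
    by (rule eq_matI) (auto simp: lt)
  also have "det \<dots> = signof q * det (transpose_mat (mat n n (\<lambda>(i, j). M i j)))"
    by (rule det_permute_rows[OF _ q]) simp
  also have "det (transpose_mat (mat n n (\<lambda>(i, j). M i j))) = det (mat n n (\<lambda>(i, j). M i j))"
    by (rule det_transpose[of _ n]) simp
  finally show ?thesis by (simp add: mult.assoc)
qed

lemma sorted_list_of_set_image_strict_mono_on:
  fixes f :: "'a::linorder \<Rightarrow> 'b::linorder"
  assumes "finite S" "strict_mono_on S f"
  shows "sorted_list_of_set (f ` S) = map f (sorted_list_of_set S)"
proof -
  have "sorted_wrt (<) (map f (sorted_list_of_set S))"
    unfolding sorted_wrt_map
    by (rule sorted_wrt_mono_rel[OF _ sorted_list_of_set.strict_sorted_key_list_of_set])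
       (use assms in \<open>auto dest: strict_mono_onD\<close>)
  then show ?thesis
    using assms(1) sorted_list_of_set.idem_if_sorted_distinct[of "map f (sorted_list_of_set S)"]
    by (auto simp: strict_sorted_iff)
qed

text \<open>\<open>shuffle_perm n S\<close> moves the rows with (one-based) index in \<open>S\<close> to the front, keeping the order; its
  sign is the sign of the minors in the Laplace expansion.\<close>

definition shuffle_list :: "nat \<Rightarrow> nat set \<Rightarrow> nat list" where
  "shuffle_list n S = sorted_list_of_set S @ sorted_list_of_set ({1..n} - S)"

definition shuffle_perm :: "nat \<Rightarrow> nat set \<Rightarrow> nat \<Rightarrow> nat" where
  "shuffle_perm n S i = (if i < n then shuffle_list n S ! i - 1 else i)"

lemma shuffle_list_props:
  assumes "S \<subseteq> {1..n}"
  shows "set (shuffle_list n S) = {1..n}" "distinct (shuffle_list n S)" "length (shuffle_list n S) = n"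
proof -
  have [simp]: "finite S" using assms finite_subset by blast
  show *: "set (shuffle_list n S) = {1..n}" "distinct (shuffle_list n S)"
    using assms by (auto simp: shuffle_list_def)
  show "length (shuffle_list n S) = n"
    using distinct_card[OF *(2)] *(1) by simp
qed

lemma shuffle_perm_permutes:
  assumes "S \<subseteq> {1..n}"
  shows "shuffle_perm n S permutes {0..<n}"
proof (rule bij_imp_permutes)
  note w = shuffle_list_props[OF assms]
  have "bij_betw ((!) (shuffle_list n S)) {0..<n} {1..n}"
    using w by (intro bij_betw_nth) auto
  moreover have "bij_betw (\<lambda>k. k - 1) {1..n} {0..<n}"
    by (rule bij_betw_byWitness[of _ Suc]) auto
  ultimately have "bij_betw ((\<lambda>k. k - 1) \<circ> (!) (shuffle_list n S)) {0..<n} {0..<n}"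
    by (rule bij_betw_trans)
  then show "bij_betw (shuffle_perm n S) {0..<n} {0..<n}"
    by (rule bij_betw_cong[THEN iffD1, rotated]) (auto simp: shuffle_perm_def)
qed (auto simp: shuffle_perm_def)

lemma Suc_shuffle_perm:
  assumes "S \<subseteq> {1..n}"
  shows "i < card S \<Longrightarrow> Suc (shuffle_perm n S i) = elt S (Suc i)"
    and "card S \<le> i \<Longrightarrow> i < n \<Longrightarrow> Suc (shuffle_perm n S i) = elt ({1..n} - S) (Suc (i - card S))"
proof -
  note w = shuffle_list_props[OF assms]
  have fin: "finite S" using assms finite_subset by blast
  have le: "card S \<le> n" using card_mono[OF _ assms] by simp
  have S: "Suc (shuffle_perm n S i) = shuffle_list n S ! i" if "i < n" for i
    using nth_mem[of i "shuffle_list n S"] w that by (auto simp: shuffle_perm_def)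
  show "Suc (shuffle_perm n S i) = elt S (Suc i)" if "i < card S"
    using S[of i] le that fin by (simp add: shuffle_list_def nth_append elt_def)
  show "Suc (shuffle_perm n S i) = elt ({1..n} - S) (Suc (i - card S))" if "card S \<le> i" "i < n"
    using S[of i] le that fin by (simp add: shuffle_list_def nth_append elt_def)
qed

lemma shuffle_perm_mem_iff:
  assumes "S \<subseteq> {1..n}" "i < n"
  shows "Suc (shuffle_perm n S i) \<in> S \<longleftrightarrow> i < card S"
proof -
  have fin: "finite S" using assms finite_subset by blast
  have len: "length (sorted_list_of_set ({1..n} - S)) = n - card S"
    using assms(1) fin by (simp add: card_Diff_subset)
  show ?thesis
  proof (cases "i < card S")
    case True
    then show ?thesis
      using Suc_shuffle_perm(1)[OF assms(1)] nth_mem[of i "sorted_list_of_set S"] fin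
      by (simp add: elt_def)
  next
    case False
    then have "i - card S < length (sorted_list_of_set ({1..n} - S))"
      using assms len by simp
    then show ?thesis
      using Suc_shuffle_perm(2)[OF assms(1), of i] False assms fin
        nth_mem[of "i - card S" "sorted_list_of_set ({1..n} - S)"]
      by (simp add: elt_def)
  qed
qed

text \<open>Base case for the sign of \<open>shuffle_perm\<close>: the sets in which no element can
  be moved down by one.\<close>

lemma downward_closed_eq_atLeastAtMost_card:
  assumes "finite S" "S \<subseteq> {1::nat..}" "\<And>s. s \<in> S \<Longrightarrow> s > 1 \<Longrightarrow> s - 1 \<in> S"
  shows "S = {1..card S}"
proof -
  have down: "s - k \<in> S" if "s \<in> S" "k < s" for s k
    using that(2)
  proof (induction k)
    case (Suc k)
    then show ?case using assms(3)[of "s - k"] by auto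
  qed (use that in auto)
  show ?thesis
  proof (cases "S = {}")
    case False
    define k where "k = Max S"
    have k: "k \<in> S" "\<And>x. x \<in> S \<Longrightarrow> x \<le> k"
      using Max_in[OF assms(1) False] assms(1) by (auto simp: k_def)
    have "S = {1..k}"
    proof
      show "S \<subseteq> {1..k}" using k(2) assms(2) by auto
      show "{1..k} \<subseteq> S"
      proof
        fix x assume "x \<in> {1..k}"
        then show "x \<in> S" using down[OF k(1), of "k - x"] by simp
      qed
    qed
    then show ?thesis by simp
  qed simp
qed

text \<open>Induction on the sum of S. If s > 1 lies in S but s - 1 does not, replacing s by s - 1
  lowers the sum by one and changes the permutation by an adjacent transposition. The process ends
  at {1..p}, whose permutation is the identity; this explains the offset in the exponent.\<close>

lemma sign_shuffle_perm:
  assumes "S \<subseteq> {1..n}"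
  shows "sign (shuffle_perm n S) = (-1) ^ (\<Sum>S + \<Sum>{1..card S})"
  using assms
proof (induction "\<Sum>S" arbitrary: S rule: less_induct)
  case less
  have fin: "finite S" using less.prems finite_subset by blast
  show ?case
  proof (cases "\<forall>s\<in>S. s > 1 \<longrightarrow> s - 1 \<in> S")
    case True
    then have S: "S = {1..card S}"
      using less.prems fin by (intro downward_closed_eq_atLeastAtMost_card) auto
    define p where "p = card S"
    have p: "p \<le> n" "S = {1..p}"
      using S card_mono[OF _ less.prems] by (auto simp: p_def)
    have "sorted_list_of_set {1..p} = [1..<Suc p]" "{1..n} - {1..p} = {Suc p..<Suc n}"
      by (auto simp flip: atLeastLessThanSuc_atLeastAtMost)
    moreover have "sorted_list_of_set {Suc p..<Suc n} = [Suc p..<Suc n]"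
      by simp
    ultimately have "shuffle_list n S = [1..<Suc p] @ [Suc p..<Suc n]"
      unfolding shuffle_list_def p(2) by simp
    also have "\<dots> = [1..<Suc n]"
      using p(1) upt_add_eq_append[of 1 "Suc p" "n - p"] by (simp del: upt_Suc)
    finally have "shuffle_perm n S = id"
      by (auto simp: shuffle_perm_def fun_eq_iff simp del: upt_Suc)
    then show ?thesis
      unfolding p(2) by simp
  next
    case False
    then obtain s where s: "s \<in> S" "s > 1" "s - 1 \<notin> S" by blast
    obtain t where t: "s = Suc (Suc t)" using s(2) by (metis One_nat_def Suc_lessD gr0_implies_Suc Suc_less_eq)
    define \<tau> where "\<tau> = Transposition.transpose (Suc t) s"
    define S' where "S' = insert (Suc t) (S - {s})"
    have sn: "s \<le> n" using s less.prems by auto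
    have S'n: "S' \<subseteq> {1..n}" using less.prems sn t by (auto simp: S'_def)
    have notin: "Suc t \<notin> S" using s t by simp
    have sum: "\<Sum>S = Suc (\<Sum>S')"
      using fin s notin by (simp add: S'_def t sum.remove[of S "Suc (Suc t)" "\<lambda>x. x"])
    have card: "card S = card S'"
      using fin s notin card_Suc_Diff1[OF fin s(1)] by (simp add: S'_def del: card_Diff_insert)
    have \<tau>S: "\<tau> ` S' = S"
      using s notin by (auto simp: \<tau>_def S'_def Transposition.transpose_def image_iff)
    have \<tau>C: "\<tau> ` ({1..n} - S') = {1..n} - S"
    proof -
      have "\<tau> ` {1..n} = {1..n}"
        using sn t unfolding \<tau>_def by (intro permutes_image permutes_swap_id) auto
      moreover have "\<tau> ` ({1..n} - S') = \<tau> ` {1..n} - \<tau> ` S'"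
        by (rule image_set_diff) (simp add: \<tau>_def)
      ultimately show ?thesis by (simp only: \<tau>S)
    qed
    \<comment> \<open>\<open>\<tau>\<close> only exchanges two neighbours, and neither S' nor its
      complement contains both of them, so both sorted lists are mapped to sorted lists.\<close>
    have m1: "strict_mono_on S' \<tau>"
      using t by (auto simp: strict_mono_on_def \<tau>_def S'_def Transposition.transpose_def)
    have m2: "strict_mono_on ({1..n} - S') \<tau>"
      using t by (auto simp: strict_mono_on_def \<tau>_def S'_def Transposition.transpose_def)
    have "finite S'" using fin by (simp add: S'_def)
    then have "sorted_list_of_set S = map \<tau> (sorted_list_of_set S')"
      using sorted_list_of_set_image_strict_mono_on[OF _ m1] by (simp only: \<tau>S)
    moreover have "sorted_list_of_set ({1..n} - S) = map \<tau> (sorted_list_of_set ({1..n} - S'))"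
      using sorted_list_of_set_image_strict_mono_on[OF _ m2] by (simp only: \<tau>C finite_Diff finite_atLeastAtMost)
    ultimately have "shuffle_list n S = map \<tau> (shuffle_list n S')"
      by (simp only: shuffle_list_def map_append)
    \<comment> \<open>The list is one-based and the permutation zero-based, so the exchange of t + 1
      and t + 2 becomes that of t and t + 1.\<close>
    then have "shuffle_perm n S i = (Transposition.transpose t (Suc t) \<circ> shuffle_perm n S') i" for i
    proof (cases "i < n")
      case True
      then have "shuffle_list n S' ! i \<noteq> 0"
        using shuffle_list_props[OF S'n] nth_mem[of i "shuffle_list n S'"] by auto
      then show ?thesis
        using True \<open>shuffle_list n S = _\<close> shuffle_list_props(3)[OF S'n]
        by (auto simp: shuffle_perm_def \<tau>_def t Transposition.transpose_def)
    next
      case False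
      then show ?thesis using sn t by (auto simp: shuffle_perm_def Transposition.transpose_def)
    qed
    then have "shuffle_perm n S = Transposition.transpose t (Suc t) \<circ> shuffle_perm n S'" by blast
    moreover have "permutation (shuffle_perm n S')"
      using shuffle_perm_permutes[OF S'n] permutes_imp_permutation by blast
    ultimately have "sign (shuffle_perm n S) = - sign (shuffle_perm n S')"
      by (simp add: sign_compose permutation_swap_id sign_swap_id)
    then show ?thesis
      using less.hyps[OF _ S'n] sum card by simp
  qed
qed

text \<open>After shuffling rows and columns this is block diagonal, with the submatrix of A on S, T
  and that of B on the complements. Keeping it as an n x n matrix lets one permutation expansion
  treat all pairs S, T alike.\<close>

definition block_select :: "nat \<Rightarrow> (nat \<Rightarrow> nat \<Rightarrow> 'a) \<Rightarrow> (nat \<Rightarrow> nat \<Rightarrow> 'a) \<Rightarrow> nat set \<Rightarrow> nat set \<Rightarrow> 'a::zero mat" where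
  "block_select n A B S T = mat n n (\<lambda>(i, j).
     if Suc i \<in> S then (if Suc j \<in> T then A (Suc i) (Suc j) else 0)
     else (if Suc j \<in> T then 0 else B (Suc i) (Suc j)))"

lemma block_select_prod_eq_0:
  fixes A B :: "nat \<Rightarrow> nat \<Rightarrow> 'a::comm_ring_1"
  assumes "\<pi> permutes {0..<n}" "i < n" "(Suc i \<in> S) \<noteq> (Suc (\<pi> i) \<in> T)"
  shows "(\<Prod>i=0..<n. block_select n A B S T $$ (i, \<pi> i)) = 0"
proof (rule prod_zero)
  have "\<pi> i < n" using permutes_in_image[OF assms(1), of i] assms(2) by simp
  then show "\<exists>i\<in>{0..<n}. block_select n A B S T $$ (i, \<pi> i) = 0"
    using assms by (intro bexI[of _ i]) (auto simp: block_select_def)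
qed simp

text \<open>For a fixed permutation the product of the sums A + B is expanded over the set S of rows
  that take A. The sum over T adds nothing new: only T equal to the image of S under the permutation
  gives a nonzero product.\<close>

lemma det_add_eq_sum_block_select:
  fixes A B :: "nat \<Rightarrow> nat \<Rightarrow> 'a::comm_ring_1"
  shows "det (mat n n (\<lambda>(i, j). A (Suc i) (Suc j) + B (Suc i) (Suc j)))
    = (\<Sum>S\<in>Pow {1..n}. \<Sum>T\<in>Pow {1..n}. det (block_select n A B S T))"
proof -
  have key: "(\<Prod>i=0..<n. A (Suc i) (Suc (\<pi> i)) + B (Suc i) (Suc (\<pi> i)))
      = (\<Sum>S\<in>Pow {1..n}. \<Sum>T\<in>Pow {1..n}. \<Prod>i=0..<n. block_select n A B S T $$ (i, \<pi> i))"
    if \<pi>: "\<pi> permutes {0..<n}" for \<pi>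
  proof -
    have lt: "\<pi> i < n" if "i < n" for i
      using permutes_in_image[OF \<pi>, of i] that by simp
    have "(\<Prod>i=0..<n. A (Suc i) (Suc (\<pi> i)) + B (Suc i) (Suc (\<pi> i)))
        = (\<Prod>k\<in>{1..n}. A k (Suc (\<pi> (k - 1))) + B k (Suc (\<pi> (k - 1))))"
      by (rule prod.reindex_bij_witness[of _ "\<lambda>k. k - 1" Suc]) auto
    also have "\<dots> = (\<Sum>S\<in>Pow {1..n}. (\<Prod>k\<in>S. A k (Suc (\<pi> (k - 1)))) *
        (\<Prod>k\<in>{1..n} - S. B k (Suc (\<pi> (k - 1)))))"
      by (rule prod_add) simp
    also have "\<dots> = (\<Sum>S\<in>Pow {1..n}. \<Sum>T\<in>Pow {1..n}. \<Prod>i=0..<n. block_select n A B S T $$ (i, \<pi> i))"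
    proof (rule sum.cong[OF refl])
      fix S assume "S \<in> Pow {1..n}"
      then have S: "S \<subseteq> {1..n}" by simp
      define T where "T = (\<lambda>k. Suc (\<pi> (k - 1))) ` S"
      have T: "T \<subseteq> {1..n}"
      proof -
        have "Suc (\<pi> (k - 1)) \<le> n" if "k \<in> S" for k
          using lt[of "k - 1"] subsetD[OF S that] by (cases k) auto
        then show ?thesis by (auto simp: T_def)
      qed
      have iff: "Suc (\<pi> i) \<in> T \<longleftrightarrow> Suc i \<in> S" if "i < n" for i
      proof
        assume "Suc (\<pi> i) \<in> T"
        then obtain k where k: "k \<in> S" "\<pi> i = \<pi> (k - 1)" by (auto simp: T_def)
        then have "i = k - 1" using permutes_inj[OF \<pi>] by (auto dest: injD)
        then show "Suc i \<in> S" using k S by (cases k) auto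
      qed (auto simp: T_def intro!: image_eqI[of _ _ "Suc i"])
      have "(\<Sum>T\<in>Pow {1..n}. \<Prod>i=0..<n. block_select n A B S T $$ (i, \<pi> i))
          = (\<Sum>T'\<in>{T}. \<Prod>i=0..<n. block_select n A B S T' $$ (i, \<pi> i))"
      proof (rule sum.mono_neutral_right, safe)
        fix T' x assume T': "T' \<subseteq> {1..n}" "(\<Prod>i=0..<n. block_select n A B S T' $$ (i, \<pi> i)) \<noteq> 0"
        have same: "(Suc (\<pi> i) \<in> T') = (Suc i \<in> S)" if "i < n" for i
          using block_select_prod_eq_0[OF \<pi> that] T'(2) by blast
        have "x \<in> T' \<longleftrightarrow> x \<in> T" if x: "x \<in> {1..n}" for x
        proof -
          obtain i where "i < n" "x = Suc (\<pi> i)"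
          proof
            show "Hilbert_Choice.inv \<pi> (x - 1) < n"
              using permutes_in_image[OF permutes_inv[OF \<pi>], of "x - 1"] x by (cases x) auto
            show "x = Suc (\<pi> (Hilbert_Choice.inv \<pi> (x - 1)))"
              using permutes_inverses(1)[OF \<pi>] x by simp
          qed
          then show ?thesis using same iff by simp
        qed
        then show "x \<in> T' \<Longrightarrow> x \<in> T" "x \<in> T \<Longrightarrow> x \<in> T'" using T T'(1) by blast+
      qed (use T in auto)
      also have "\<dots> = (\<Prod>i=0..<n. if Suc i \<in> S then A (Suc i) (Suc (\<pi> i)) else B (Suc i) (Suc (\<pi> i)))"
        using lt iff by (auto simp: block_select_def intro!: prod.cong)
      also have "\<dots> = (\<Prod>k\<in>{1..n}. if k \<in> S then A k (Suc (\<pi> (k - 1))) else B k (Suc (\<pi> (k - 1))))"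
        by (rule prod.reindex_bij_witness[of _ "\<lambda>k. k - 1" Suc]) auto
      also have "\<dots> = (\<Prod>k\<in>S. A k (Suc (\<pi> (k - 1)))) * (\<Prod>k\<in>{1..n} - S. B k (Suc (\<pi> (k - 1))))"
        using S by (subst prod.If_cases) (auto simp: Int_absorb1 Diff_eq)
      finally show "(\<Prod>k\<in>S. A k (Suc (\<pi> (k - 1)))) * (\<Prod>k\<in>{1..n} - S. B k (Suc (\<pi> (k - 1))))
          = (\<Sum>T\<in>Pow {1..n}. \<Prod>i=0..<n. block_select n A B S T $$ (i, \<pi> i))" ..
    qed
    finally show ?thesis .
  qed
  have "det (mat n n (\<lambda>(i, j). A (Suc i) (Suc j) + B (Suc i) (Suc j)))
      = (\<Sum>\<pi> | \<pi> permutes {0..<n}. signof \<pi> *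
          (\<Prod>i=0..<n. A (Suc i) (Suc (\<pi> i)) + B (Suc i) (Suc (\<pi> i))))"
    by (subst det_def'[of _ n]) (auto intro!: sum.cong prod.cong dest: permutes_in_image)
  also have "\<dots> = (\<Sum>\<pi> | \<pi> permutes {0..<n}. \<Sum>S\<in>Pow {1..n}. \<Sum>T\<in>Pow {1..n}.
      signof \<pi> * (\<Prod>i=0..<n. block_select n A B S T $$ (i, \<pi> i)))"
    by (simp add: key sum_distrib_left)
  also have "\<dots> = (\<Sum>S\<in>Pow {1..n}. \<Sum>T\<in>Pow {1..n}. \<Sum>\<pi> | \<pi> permutes {0..<n}.
      signof \<pi> * (\<Prod>i=0..<n. block_select n A B S T $$ (i, \<pi> i)))"
    by (subst sum.swap, intro sum.cong refl, subst sum.swap) simp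
  also have "\<dots> = (\<Sum>S\<in>Pow {1..n}. \<Sum>T\<in>Pow {1..n}. det (block_select n A B S T))"
    by (intro sum.cong refl det_def'[symmetric]) (simp add: block_select_def)
  finally show ?thesis .
qed

text \<open>A permutation with a nonzero product would restrict to a bijection between S and
  T.\<close>

lemma det_block_select_card_neq:
  fixes A B :: "nat \<Rightarrow> nat \<Rightarrow> 'a::comm_ring_1"
  assumes S: "S \<subseteq> {1..n}" and T: "T \<subseteq> {1..n}" and ne: "card S \<noteq> card T"
  shows "det (block_select n A B S T) = 0"
proof -
  have "(\<Prod>i=0..<n. block_select n A B S T $$ (i, \<pi> i)) = 0" if \<pi>: "\<pi> permutes {0..<n}" for \<pi>
  proof (rule ccontr)
    assume "\<not> ?thesis"
    then have same: "(Suc (\<pi> i) \<in> T) = (Suc i \<in> S)" if "i < n" for i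
      using block_select_prod_eq_0[OF \<pi> that] by blast
    have "bij_betw (\<lambda>k. Suc (\<pi> (k - 1))) S T"
    proof (rule bij_betw_byWitness[of _ "\<lambda>k. Suc (Hilbert_Choice.inv \<pi> (k - 1))"])
      have lt: "Hilbert_Choice.inv \<pi> (k - 1) < n" if "k \<in> T" for k
        using permutes_in_image[OF permutes_inv[OF \<pi>], of "k - 1"] that T by force
      show "\<forall>a\<in>S. Suc (Hilbert_Choice.inv \<pi> (Suc (\<pi> (a - 1)) - 1)) = a"
        using S by (auto simp: permutes_inverses[OF \<pi>] subset_iff)
      show "\<forall>a'\<in>T. Suc (\<pi> (Suc (Hilbert_Choice.inv \<pi> (a' - 1)) - 1)) = a'"
        using T by (auto simp: permutes_inverses[OF \<pi>] subset_iff)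
      show "(\<lambda>k. Suc (\<pi> (k - 1))) ` S \<subseteq> T"
        using S same by (auto simp: subset_iff)
      show "(\<lambda>k. Suc (Hilbert_Choice.inv \<pi> (k - 1))) ` T \<subseteq> S"
      proof
        fix x assume "x \<in> (\<lambda>k. Suc (Hilbert_Choice.inv \<pi> (k - 1))) ` T"
        then obtain k where k: "k \<in> T" "x = Suc (Hilbert_Choice.inv \<pi> (k - 1))" by auto
        moreover have "Suc (k - 1) = k" using k(1) T by (cases k) auto
        ultimately show "x \<in> S"
          using same[OF lt[OF k(1)]] by (simp add: permutes_inverses[OF \<pi>])
      qed
    qed
    then show False using ne bij_betw_same_card by blast
  qed
  then show ?thesis
    by (subst det_def'[of _ n]) (auto simp: block_select_def intro!: sum.neutral)
qed

lemma det_block_select: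
  fixes A B :: "nat \<Rightarrow> nat \<Rightarrow> 'a::idom"
  assumes S: "S \<subseteq> {1..n}" and T: "T \<subseteq> {1..n}" and card: "card S = p" "card T = p"
  shows "det (block_select n A B S T) = (-1) ^ (\<Sum>S + \<Sum>T)
    * det (mat p p (\<lambda>(r, s). A (elt S (Suc r)) (elt T (Suc s))))
    * det (mat (n - p) (n - p) (\<lambda>(r, s). B (elt ({1..n} - S) (Suc r)) (elt ({1..n} - T) (Suc s))))"
    (is "_ = _ * det ?A * det ?B")
proof -
  have pn: "p \<le> n" using card_mono[OF _ S] card by simp
  define M where "M i j = (if Suc i \<in> S then (if Suc j \<in> T then A (Suc i) (Suc j) else 0)
     else (if Suc j \<in> T then 0 else B (Suc i) (Suc j)))" for i j
  let ?\<sigma> = "shuffle_perm n S" and ?\<tau> = "shuffle_perm n T"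
  have "mat n n (\<lambda>(i, j). M (?\<sigma> i) (?\<tau> j)) = four_block_mat ?A (0\<^sub>m p (n - p)) (0\<^sub>m (n - p) p) ?B"
    using pn shuffle_perm_mem_iff[OF S] shuffle_perm_mem_iff[OF T]
      Suc_shuffle_perm[OF S] Suc_shuffle_perm[OF T] card
    by (intro eq_matI) (auto simp: M_def)
  then have "det ?A * det ?B = det (mat n n (\<lambda>(i, j). M (?\<sigma> i) (?\<tau> j)))"
    by (simp add: det_four_block_mat_upper_right_zero[OF _ refl])
  also have "\<dots> = signof ?\<sigma> * signof ?\<tau> * det (block_select n A B S T)"
    unfolding block_select_def M_def[symmetric]
    by (rule det_permute_rows_cols) (use shuffle_perm_permutes S T in auto)
  \<comment> \<open>The offset 1 + ... + p occurs once for S and once for T and cancels modulo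
    2.\<close>
  also have "signof ?\<sigma> * signof ?\<tau> = ((-1) ^ (\<Sum>S + \<Sum>T) :: 'a)"
  proof -
    have "sign ?\<sigma> * sign ?\<tau> = (-1) ^ (\<Sum>S + \<Sum>T) * ((-1) ^ \<Sum>{1..p})\<^sup>2"
      by (simp only: sign_shuffle_perm S T card power_add power2_eq_square mult_ac)
    then have "sign ?\<sigma> * sign ?\<tau> = (-1) ^ (\<Sum>S + \<Sum>T)"
      by (simp add: power_mult[symmetric])
    from arg_cong[OF this, of of_int] show ?thesis by simp
  qed
  finally show ?thesis
    by (simp add: mult.assoc flip: power_add)
qed

text \<open>Only pairs of equal cardinality survive, so the expansion is graded by that cardinality
  p, with p = 0 contributing det B alone.\<close>

theorem det_add_laplace:
  fixes A B :: "nat \<Rightarrow> nat \<Rightarrow> 'a::idom"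
  shows "det (mat n n (\<lambda>(i, j). A (Suc i) (Suc j) + B (Suc i) (Suc j)))
    = (\<Sum>p\<le>n. \<Sum>(S, T) \<in> {(S, T). S \<subseteq> {1..n} \<and> T \<subseteq> {1..n} \<and> card S = p \<and> card T = p}.
        (-1) ^ (\<Sum>S + \<Sum>T)
        * det (mat p p (\<lambda>(r, s). A (elt S (Suc r)) (elt T (Suc s))))
        * det (mat (n - p) (n - p) (\<lambda>(r, s). B (elt ({1..n} - S) (Suc r)) (elt ({1..n} - T) (Suc s)))))"
proof -
  define P where "P p = {(S, T). S \<subseteq> {1..n} \<and> T \<subseteq> {1..n} \<and> card S = p \<and> card T = p}" for p
  have le: "card S \<le> n" if "S \<subseteq> {1..n}" for S
    using card_mono[OF _ that] by simp
  have fin: "finite (P p)" for p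
    by (rule finite_subset[of _ "Pow {1..n} \<times> Pow {1..n}"]) (auto simp: P_def)
  have "det (mat n n (\<lambda>(i, j). A (Suc i) (Suc j) + B (Suc i) (Suc j)))
      = (\<Sum>(S, T)\<in>Pow {1..n} \<times> Pow {1..n}. det (block_select n A B S T))"
    by (simp only: det_add_eq_sum_block_select sum.cartesian_product)
  also have "\<dots> = (\<Sum>(S, T)\<in>(\<Union>p\<le>n. P p). det (block_select n A B S T))"
    by (rule sum.mono_neutral_right)
       (use le in \<open>auto simp: P_def intro!: det_block_select_card_neq\<close>)
  also have "\<dots> = (\<Sum>p\<le>n. \<Sum>(S, T)\<in>P p. det (block_select n A B S T))"
    by (rule sum.UNION_disjoint) (use fin in \<open>auto simp: P_def\<close>)
  also have "\<dots> = (\<Sum>p\<le>n. \<Sum>(S, T)\<in>P p. (-1) ^ (\<Sum>S + \<Sum>T)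
        * det (mat p p (\<lambda>(r, s). A (elt S (Suc r)) (elt T (Suc s))))
        * det (mat (n - p) (n - p) (\<lambda>(r, s). B (elt ({1..n} - S) (Suc r)) (elt ({1..n} - T) (Suc s)))))"
    by (intro sum.cong refl) (auto simp: P_def det_block_select)
  finally show ?thesis unfolding P_def .
qed

section \<open>Schur functions and alternants\<close>

text \<open>Schur functions are defined with decreasing exponents, the minors below have increasing
  ones. Reversing columns costs a sign that depends on p only and cancels in the quotient;
  \<open>e * e = 1\<close> is all that is needed of it.\<close>

lemma det_reverse_cols:
  "\<exists>e :: 'a::comm_ring_1. e * e = 1 \<and> (\<forall>M. det (mat p p (\<lambda>(i, j). M i (p - Suc j)))
    = e * det (mat p p (\<lambda>(i, j). M i j)))"
proof -
  define q where "q j = (if j < p then p - Suc j else j)" for j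
  have q: "q permutes {0..<p}"
    by (rule bij_imp_permutes, rule bij_betw_byWitness[of _ q]) (auto simp: q_def)
  have "det (mat p p (\<lambda>(i, j). M i (p - Suc j))) = signof q * det (mat p p (\<lambda>(i, j). M i j))"
    for M :: "nat \<Rightarrow> nat \<Rightarrow> 'a"
  proof -
    have "mat p p (\<lambda>(i, j). M i (p - Suc j)) = mat p p (\<lambda>(i, j). M (id i) (q j))"
      by (rule eq_matI) (auto simp: q_def)
    then show ?thesis
      using det_permute_rows_cols[OF permutes_id q, of M] by simp
  qed
  moreover have "(of_int (sign q) * of_int (sign q) :: 'a) = 1"
    by (simp flip: of_int_mult)
  ultimately show ?thesis by blast
qed

text \<open>Passing from monomials to the Newton polynomials (X - x_0) ... (X - x_(j-1)) is a
  unitriangular change of basis, and their values at the nodes form a lower triangular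
  matrix.\<close>

lemma det_vandermonde:
  fixes x :: "nat \<Rightarrow> 'a::comm_ring_1"
  shows "det (mat p p (\<lambda>(i, j). x i ^ j)) = (\<Prod>i<p. \<Prod>j<i. x i - x j)"
proof -
  define e where "e j = (\<Prod>s<j. [:- x s, 1:])" for j
  have deg: "degree (e j) \<le> j" for j
  proof (induction j)
    case (Suc j)
    have "degree (e (Suc j)) \<le> degree (e j) + degree [:- x j, 1:]"
      unfolding e_def by (simp only: prod.lessThan_Suc degree_mult_le)
    then show ?case using Suc by simp
  qed (simp add: e_def)
  have lc: "poly.coeff (e j) j = 1" for j
  proof (induction j)
    case (Suc j)
    have "e (Suc j) = pCons 0 (e j) - Polynomial.smult (x j) (e j)"
      by (simp add: e_def algebra_simps)
    then show ?case using Suc deg[of j] by (simp add: coeff_eq_0)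
  qed (simp add: e_def)
  define W where "W = mat p p (\<lambda>(i, j). x i ^ j)"
  define U where "U = mat p p (\<lambda>(k, j). poly.coeff (e j) k)"
  define N where "N = mat p p (\<lambda>(i, j). poly (e j) (x i))"
  have "N = W * U"
  proof (rule eq_matI)
    fix i j assume "i < dim_row (W * U)" "j < dim_col (W * U)"
    then have ij: "i < p" "j < p" by (auto simp: W_def U_def)
    have "poly (e j) (x i) = (\<Sum>k\<le>degree (e j). poly.coeff (e j) k * x i ^ k)"
      by (rule poly_altdef)
    also have "\<dots> = (\<Sum>k<p. x i ^ k * poly.coeff (e j) k)"
      using ij deg[of j] by (intro sum.mono_neutral_cong_left) (auto simp: coeff_eq_0 mult.commute)
    finally show "N $$ (i, j) = (W * U) $$ (i, j)"
      using ij by (simp add: N_def W_def U_def scalar_prod_def atLeast0LessThan)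
  qed (auto simp: N_def W_def U_def)
  then have "det N = det W * det U"
    by (simp add: det_mult[of _ p] W_def U_def)
  moreover have "det U = prod_list (diag_mat U)"
    by (rule det_upper_triangular[of _ p])
       (auto simp: U_def upper_triangular_def intro!: coeff_eq_0 le_less_trans[OF deg])
  then have "det U = 1"
    by (simp add: diag_mat_def U_def lc prod.list_conv_set_nth)
  moreover have "det N = prod_list (diag_mat N)"
    by (rule det_lower_triangular[of p]) (auto simp: N_def e_def poly_prod intro!: prod_zero)
  then have "det N = (\<Prod>i<p. \<Prod>j<i. x i - x j)"
    by (simp add: diag_mat_def N_def prod.list_conv_set_nth atLeast0LessThan e_def poly_prod)
  ultimately show ?thesis by (simp add: W_def)
qed

lemma elt_ge:
  assumes "finite S" "r < card S"
  shows "elt S 1 + r \<le> elt S (Suc r)"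
  using assms(2)
proof (induction r)
  case (Suc r)
  have "sorted_list_of_set S ! r < sorted_list_of_set S ! Suc r"
    using Suc.prems assms(1)
    by (intro sorted_wrt_nth_less[OF sorted_list_of_set.strict_sorted_key_list_of_set]) auto
  then show ?case using Suc by (simp add: elt_def)
qed (simp add: elt_def)

text \<open>The exponent \<lambda>_j + p - j in the bialternant is just l_(p-j+1) - l_1, so up to
  reversal of columns the numerator has exponents l_j - l_1. Distinct values of x make the
  denominator nonzero.\<close>

lemma schur_part_mult_vandermonde:
  fixes x :: "nat \<Rightarrow> 'a::field"
  assumes S: "finite S" "card S = p" and x: "inj_on x {1..p}"
  shows "schur p (part p S) x * det (mat p p (\<lambda>(i, j). x (Suc i) ^ j))
    = det (mat p p (\<lambda>(i, j). x (Suc i) ^ (elt S (Suc j) - elt S 1)))"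
proof -
  let ?W = "det (mat p p (\<lambda>(i, j). x (Suc i) ^ j))"
  have nz: "?W \<noteq> 0"
    by (auto simp: det_vandermonde dest!: inj_onD[OF x])
  obtain e :: 'a where e: "e * e = 1" and rev:
    "\<And>M :: nat \<Rightarrow> nat \<Rightarrow> 'a. det (mat p p (\<lambda>(i, j). M i (p - Suc j)))
      = e * det (mat p p (\<lambda>(i, j). M i j))"
    using det_reverse_cols[of p] by blast
  have "part p S (Suc j) + p - Suc j = elt S (Suc (p - Suc j)) - elt S 1" if "j < p" for j
    using elt_ge[OF S(1), of "p - Suc j"] that S(2) by (simp add: part_def)
  then have "mat p p (\<lambda>(i, j). x (i + 1) ^ (part p S (j + 1) + p - (j + 1)))
      = mat p p (\<lambda>(i, j). x (Suc i) ^ (elt S (Suc (p - Suc j)) - elt S 1))"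
    by (intro eq_matI) auto
  then have "det (mat p p (\<lambda>(i, j). x (i + 1) ^ (part p S (j + 1) + p - (j + 1))))
      = e * det (mat p p (\<lambda>(i, j). x (Suc i) ^ (elt S (Suc j) - elt S 1)))"
    using rev[of "\<lambda>i j. x (Suc i) ^ (elt S (Suc j) - elt S 1)"] by simp
  moreover have "det (mat p p (\<lambda>(i, j). x (i + 1) ^ (p - (j + 1)))) = e * ?W"
    using rev[of "\<lambda>i j. x (Suc i) ^ j"] by simp
  moreover have "e \<noteq> 0" using e by auto
  ultimately show ?thesis
    using nz by (simp add: schur_def)
qed

lemma det_mat_eq_sum:
  fixes N :: "nat \<Rightarrow> nat \<Rightarrow> 'a::comm_ring_1"
  shows "det (mat p p (\<lambda>(i, j). N i j))
      = (\<Sum>\<pi> | \<pi> permutes {0..<p}. signof \<pi> * (\<Prod>i=0..<p. N i (\<pi> i)))"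
  by (subst det_def'[of _ p]) (auto intro!: sum.cong prod.cong dest: permutes_in_image)

lemma det_row_scale:
  fixes M :: "nat \<Rightarrow> nat \<Rightarrow> 'a::comm_ring_1"
  shows "det (mat p p (\<lambda>(i, j). c i * M i j)) = (\<Prod>i<p. c i) * det (mat p p (\<lambda>(i, j). M i j))"
  unfolding det_mat_eq_sum prod.distrib sum_distrib_left
  by (simp only: atLeast0LessThan mult.left_commute)

text \<open>A generalized Vandermonde determinant, the form in which Cauchy-Binet produces the
  minors; the exponents are reduced by 1 because S consists of one-based indices.\<close>

definition alternant :: "nat \<Rightarrow> nat set \<Rightarrow> (nat \<Rightarrow> 'a::comm_ring_1) \<Rightarrow> 'a" where
  "alternant p S x = det (mat p p (\<lambda>(i, j). x (Suc i) ^ (elt S (Suc j) - 1)))"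

text \<open>Row r of the alternant contains the factor x_r^(l_1 - 1). Extracting it, with x_r =
  m_r^2, is the origin of the monomial (m_1 ... m_p)^(2 l_1 + 2 j_1 - 4) in the theorem.\<close>

lemma schur_mult_vandermonde_eq_alternant:
  fixes x :: "nat \<Rightarrow> 'a::field"
  assumes S: "finite S" "card S = p" "S \<subseteq> {1..}" and x: "inj_on x {1..p}" and p: "p \<ge> 1"
  shows "(\<Prod>r=1..p. x r) ^ (elt S 1 - 1) * schur p (part p S) x
      * det (mat p p (\<lambda>(i, j). x (Suc i) ^ j)) = alternant p S x"
proof -
  have "elt S 1 \<in> S"
    using nth_mem[of 0 "sorted_list_of_set S"] S(1,2) p by (simp add: elt_def)
  then have ge1: "elt S 1 \<ge> 1" using S(3) by auto
  have split: "x (Suc i) ^ (elt S (Suc j) - 1) = x (Suc i) ^ (elt S 1 - 1) * x (Suc i) ^ (elt S (Suc j) - elt S 1)"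
    if "j < p" for i j
    using elt_ge[OF S(1), of j] that S(2) ge1 by (simp flip: power_add)
  have "mat p p (\<lambda>(i, j). x (Suc i) ^ (elt S (Suc j) - 1))
     = mat p p (\<lambda>(i, j). x (Suc i) ^ (elt S 1 - 1) * x (Suc i) ^ (elt S (Suc j) - elt S 1))"
    by (rule eq_matI) (use split in \<open>simp_all only: index_mat dim_row_mat dim_col_mat prod.case\<close>)
  then have "alternant p S x = (\<Prod>i<p. x (Suc i) ^ (elt S 1 - 1))
      * det (mat p p (\<lambda>(i, j). x (Suc i) ^ (elt S (Suc j) - elt S 1)))"
    by (simp only: alternant_def det_row_scale)
  also have "(\<Prod>i<p. x (Suc i) ^ (elt S 1 - 1)) = (\<Prod>r=1..p. x r) ^ (elt S 1 - 1)"
    by (simp add: prod_power_distrib[symmetric] prod.atLeast1_atMost_eq)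
  finally show ?thesis
    by (simp add: schur_part_mult_vandermonde[OF S(1,2) x] mult.assoc)
qed

lemma vandermonde_square:
  fixes x :: "nat \<Rightarrow> 'a::comm_ring_1"
  shows "(\<Prod>(r, s) \<in> {(r, s). 1 \<le> r \<and> r < s \<and> s \<le> p}. (x r - x s)\<^sup>2)
    = (det (mat p p (\<lambda>(i, j). x (Suc i) ^ j)))\<^sup>2"
proof -
  have "(\<Prod>(r, s) \<in> {(r, s). 1 \<le> r \<and> r < s \<and> s \<le> p}. (x r - x s)\<^sup>2)
      = (\<Prod>(i, j) \<in> Sigma {..<p} (\<lambda>i. {..<i}). (x (Suc i) - x (Suc j))\<^sup>2)"
    by (rule prod.reindex_bij_witness[of _ "\<lambda>(i, j). (Suc j, Suc i)" "\<lambda>(r, s). (s - 1, r - 1)"])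
       (auto simp: power2_commute)
  also have "\<dots> = (\<Prod>i<p. \<Prod>j<i. (x (Suc i) - x (Suc j))\<^sup>2)"
    by (rule prod.Sigma[symmetric]) auto
  finally show ?thesis
    by (simp add: det_vandermonde prod_power_distrib)
qed

section \<open>The Cauchy-Binet formula for infinite sums\<close>

lemma has_sum_finite_sum:
  fixes f :: "'i \<Rightarrow> 'a \<Rightarrow> 'b::topological_comm_monoid_add"
  assumes "finite I" and "\<And>i. i \<in> I \<Longrightarrow> (f i has_sum s i) A"
  shows "((\<lambda>x. \<Sum>i\<in>I. f i x) has_sum (\<Sum>i\<in>I. s i)) A"
  using assms by (induction I rule: finite_induct) (auto intro: has_sum_add)

lemma summable_on_finite_sum:
  fixes f :: "'i \<Rightarrow> 'a \<Rightarrow> 'b::topological_comm_monoid_add"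
  assumes "finite I" and "\<And>i. i \<in> I \<Longrightarrow> f i summable_on A"
  shows "(\<lambda>x. \<Sum>i\<in>I. f i x) summable_on A"
  using assms by (induction I rule: finite_induct) (auto intro: summable_on_add)

lemma infsum_finite_sum:
  fixes f :: "'i \<Rightarrow> 'a \<Rightarrow> 'b::{topological_comm_monoid_add, t2_space}"
  assumes "finite I" and "\<And>i. i \<in> I \<Longrightarrow> f i summable_on A"
  shows "(\<Sum>\<^sub>\<infinity>x\<in>A. \<Sum>i\<in>I. f i x) = (\<Sum>i\<in>I. infsum (f i) A)"
  using assms by (intro infsumI has_sum_finite_sum) auto

text \<open>Splitting off one coordinate reduces the claim to a product of two absolutely summable
  families.\<close>

lemma abs_summable_prod_PiE:
  fixes f :: "'a \<Rightarrow> 'b \<Rightarrow> complex"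
  assumes "finite A" and "\<And>x. x \<in> A \<Longrightarrow> f x abs_summable_on B x"
  shows "(\<lambda>g. \<Prod>x\<in>A. f x (g x)) abs_summable_on PiE A B"
  using assms
proof (induction A rule: finite_induct)
  case (insert a A)
  have "(\<lambda>(y, g). f a y * (\<Prod>x\<in>A. f x (g x))) abs_summable_on B a \<times> PiE A B"
    using insert by (intro Infinite_Sum.abs_summable_on_Sigma_iff[THEN iffD2])
      (auto simp: norm_mult infsum_cmult_right' abs_mult infsum_nonneg intro!: summable_on_cmult_right summable_on_cmult_left)
  also have "?this \<longleftrightarrow> (\<lambda>g. \<Prod>x\<in>insert a A. f x (g x)) abs_summable_on PiE (insert a A) B"
    by (rule summable_on_reindex_bij_witness[of _ "\<lambda>g. (g a, g(a := undefined))" "\<lambda>(y, g). g(a := y)"])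
       (use insert.hyps in \<open>auto simp: PiE_def extensional_def fun_eq_iff norm_mult Pi_def
          intro!: arg_cong2[of _ _ _ _ "(*)"] arg_cong[of _ _ norm] prod.cong\<close>)
  finally show ?case .
qed auto

section \<open>Sorting tuples by a weight\<close>

definition tuples :: "nat \<Rightarrow> 'a set \<Rightarrow> (nat \<Rightarrow> 'a) set" where
  "tuples p Z = PiE {0..<p} (\<lambda>_. Z)"

text \<open>Only the weight v is ordered. In the application Z consists of the pairs (y, m) and v is
  m, so that y stays unconstrained.\<close>

definition decreasing_tuples :: "nat \<Rightarrow> 'a set \<Rightarrow> ('a \<Rightarrow> nat) \<Rightarrow> (nat \<Rightarrow> 'a) set" where
  "decreasing_tuples p Z v = {\<alpha> \<in> tuples p Z. \<forall>i<p. \<forall>j<i. v (\<alpha> i) < v (\<alpha> j)}"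

text \<open>The sorting permutation: entry i goes to the number of entries larger than it. Being the
  identity from p on makes it a permutation in the sense of \<open>permutes\<close>.\<close>

definition rank_perm :: "nat \<Rightarrow> (nat \<Rightarrow> nat) \<Rightarrow> nat \<Rightarrow> nat" where
  "rank_perm p u i = (if i < p then card {j. j < p \<and> u i < u j} else i)"

lemma rank_perm_less_iff:
  assumes "i < p" "j < p"
  shows "rank_perm p u i < rank_perm p u j \<longleftrightarrow> u j < u i"
proof -
  have mono: "rank_perm p u i < rank_perm p u j" if "u j < u i" "i < p" "j < p" for i j
  proof -
    have "{k. k < p \<and> u i < u k} \<subset> {k. k < p \<and> u j < u k}"
      using that by auto
    then show ?thesis
      using that by (auto simp: rank_perm_def intro!: psubset_card_mono)
  qed
  have eq: "rank_perm p u i = rank_perm p u j" if "u i = u j"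
    using assms that by (simp add: rank_perm_def)
  show ?thesis
    using mono[OF _ assms] mono[OF _ assms(2,1)] eq by (metis less_asym less_irrefl linorder_neqE_nat)
qed

lemma rank_perm_permutes:
  assumes "inj_on u {0..<p}"
  shows "rank_perm p u permutes {0..<p}"
proof (rule bij_imp_permutes)
  have lt: "rank_perm p u i < p" if "i < p" for i
  proof -
    have "{j. j < p \<and> u i < u j} \<subseteq> {0..<p} - {i}" by auto
    then have "card {j. j < p \<and> u i < u j} \<le> card ({0..<p} - {i})"
      by (intro card_mono) auto
    then show ?thesis using that by (simp add: rank_perm_def)
  qed
  have "inj_on (rank_perm p u) {0..<p}"
  proof (rule inj_onI)
    fix i j assume ij: "i \<in> {0..<p}" "j \<in> {0..<p}" "rank_perm p u i = rank_perm p u j"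
    then have "u i = u j"
      using rank_perm_less_iff[of i p j u] rank_perm_less_iff[of j p i u] by simp
    then show "i = j" using assms ij by (auto dest: inj_onD)
  qed
  moreover have "rank_perm p u ` {0..<p} \<subseteq> {0..<p}"
    using lt by auto
  ultimately show "bij_betw (rank_perm p u) {0..<p} {0..<p}"
    using endo_inj_surj[of "{0..<p}" "rank_perm p u"] by (simp add: bij_betw_def)
qed (auto simp: rank_perm_def)

text \<open>For decreasing u, the entries of \<open>u \<circ> \<tau>\<close> that exceed the one at
  i are those at j with \<tau> j < \<tau> i, and there are exactly \<tau> i of these.\<close>

lemma rank_perm_decreasing_comp:
  assumes \<tau>: "\<tau> permutes {0..<p}" and u: "\<And>i j. i < p \<Longrightarrow> j < i \<Longrightarrow> u i < (u j :: nat)"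
  shows "rank_perm p (u \<circ> \<tau>) = \<tau>"
proof
  fix i
  have lt: "\<tau> i < p \<longleftrightarrow> i < p" for i
    using permutes_in_image[OF \<tau>, of i] by simp
  have iff: "u i < u j \<longleftrightarrow> j < i" if "i < p" "j < p" for i j
    using u[of i j] u[of j i] that by (metis less_asym less_irrefl linorder_neqE_nat)
  show "rank_perm p (u \<circ> \<tau>) i = \<tau> i"
  proof (cases "i < p")
    case True
    have "bij_betw \<tau> {j. j < p \<and> \<tau> j < \<tau> i} {..<\<tau> i}"
    proof (rule bij_betw_byWitness[of _ "Hilbert_Choice.inv \<tau>"])
      show "Hilbert_Choice.inv \<tau> ` {..<\<tau> i} \<subseteq> {j. j < p \<and> \<tau> j < \<tau> i}"
      proof safe
        fix k assume "k < \<tau> i"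
        then show "Hilbert_Choice.inv \<tau> k < p" "\<tau> (Hilbert_Choice.inv \<tau> k) < \<tau> i"
          using lt[of "Hilbert_Choice.inv \<tau> k"] lt[of i] True by (auto simp: permutes_inverses[OF \<tau>])
      qed
    qed (auto simp: permutes_inverses[OF \<tau>])
    then have "card {j. j < p \<and> \<tau> j < \<tau> i} = \<tau> i"
      by (simp add: bij_betw_same_card)
    moreover have "{j. j < p \<and> \<tau> j < \<tau> i} = {j. j < p \<and> u (\<tau> i) < u (\<tau> j)}"
      using iff lt True by auto
    ultimately show ?thesis using True by (simp add: rank_perm_def)
  next
    case False
    then show ?thesis using permutes_not_in[OF \<tau>, of i] by (simp add: rank_perm_def)
  qed
qed

definition permute_tuple :: "nat \<Rightarrow> (nat \<Rightarrow> nat) \<Rightarrow> (nat \<Rightarrow> 'a) \<Rightarrow> nat \<Rightarrow> 'a" where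
  "permute_tuple p \<tau> \<alpha> i = (if i < p then \<alpha> (\<tau> i) else undefined)"

text \<open>A tuple with distinct weights arises from exactly one decreasing tuple and one
  permutation; the inverse map sorts it by \<open>rank_perm\<close>.\<close>

lemma bij_betw_permute_tuple:
  "bij_betw (\<lambda>(\<tau>, \<alpha>). permute_tuple p \<tau> \<alpha>) ({\<tau>. \<tau> permutes {0..<p}} \<times> decreasing_tuples p Z v)
    {\<alpha> \<in> tuples p Z. inj_on (v \<circ> \<alpha>) {0..<p}}"
proof (rule bij_betw_byWitness[of _ "\<lambda>\<beta>. (rank_perm p (v \<circ> \<beta>), permute_tuple p (Hilbert_Choice.inv (rank_perm p (v \<circ> \<beta>))) \<beta>)"], safe)
  fix \<tau> \<alpha> assume \<tau>: "\<tau> permutes {0..<p}" and \<alpha>: "\<alpha> \<in> decreasing_tuples p Z v"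
  have lt: "\<tau> i < p \<longleftrightarrow> i < p" for i
    using permutes_in_image[OF \<tau>, of i] by simp
  have lt': "Hilbert_Choice.inv \<tau> i < p \<longleftrightarrow> i < p" for i
    using permutes_in_image[OF permutes_inv[OF \<tau>], of i] by simp
  have dec: "v (\<alpha> i) < v (\<alpha> j)" if "i < p" "j < i" for i j
    using \<alpha> that by (auto simp: decreasing_tuples_def)
  have ne: "v (\<alpha> i) \<noteq> v (\<alpha> j)" if "i < p" "j < p" "i \<noteq> j" for i j
    using dec[of i j] dec[of j i] that by (metis less_irrefl linorder_neqE_nat)
  show "permute_tuple p \<tau> \<alpha> \<in> tuples p Z"
    using \<alpha> lt by (auto simp: decreasing_tuples_def tuples_def permute_tuple_def)
  show "inj_on (v \<circ> permute_tuple p \<tau> \<alpha>) {0..<p}"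
  proof (rule inj_onI)
    fix x y assume "x \<in> {0..<p}" "y \<in> {0..<p}"
      "(v \<circ> permute_tuple p \<tau> \<alpha>) x = (v \<circ> permute_tuple p \<tau> \<alpha>) y"
    then show "x = y"
      using ne[of "\<tau> x" "\<tau> y"] lt inj_eq[OF permutes_inj[OF \<tau>], of x y]
      by (auto simp: permute_tuple_def)
  qed
  have "rank_perm p (v \<circ> permute_tuple p \<tau> \<alpha>) = rank_perm p ((v \<circ> \<alpha>) \<circ> \<tau>)"
    by (auto simp: rank_perm_def permute_tuple_def fun_eq_iff intro!: arg_cong[of _ _ card])
  also have "\<dots> = \<tau>"
    by (rule rank_perm_decreasing_comp[OF \<tau>]) (use dec in auto)
  finally show 1: "rank_perm p (v \<circ> permute_tuple p \<tau> \<alpha>) = \<tau>" .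
  show "permute_tuple p (Hilbert_Choice.inv (rank_perm p (v \<circ> permute_tuple p \<tau> \<alpha>))) (permute_tuple p \<tau> \<alpha>) = \<alpha>"
  proof
    fix i
    show "permute_tuple p (Hilbert_Choice.inv (rank_perm p (v \<circ> permute_tuple p \<tau> \<alpha>))) (permute_tuple p \<tau> \<alpha>) i = \<alpha> i"
      unfolding 1 using \<alpha> lt' by (auto simp: permute_tuple_def permutes_inverses[OF \<tau>] decreasing_tuples_def
          tuples_def PiE_def extensional_def)
  qed
next
  fix \<beta> assume \<beta>: "\<beta> \<in> tuples p Z" "inj_on (v \<circ> \<beta>) {0..<p}"
  define \<tau> where "\<tau> = rank_perm p (v \<circ> \<beta>)"
  have \<tau>: "\<tau> permutes {0..<p}" unfolding \<tau>_def by (rule rank_perm_permutes[OF \<beta>(2)])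
  have lt: "\<tau> i < p \<longleftrightarrow> i < p" for i
    using permutes_in_image[OF \<tau>, of i] by simp
  have lt': "Hilbert_Choice.inv \<tau> i < p \<longleftrightarrow> i < p" for i
    using permutes_in_image[OF permutes_inv[OF \<tau>], of i] by simp
  show "rank_perm p (v \<circ> \<beta>) permutes {0..<p}" using \<tau> by (simp add: \<tau>_def)
  show "permute_tuple p (rank_perm p (v \<circ> \<beta>)) (permute_tuple p (Hilbert_Choice.inv (rank_perm p (v \<circ> \<beta>))) \<beta>) = \<beta>"
    unfolding \<tau>_def[symmetric]
    using \<beta> lt by (auto simp: permute_tuple_def permutes_inverses[OF \<tau>] fun_eq_iff
        tuples_def PiE_def extensional_def)
  have "v (\<beta> (Hilbert_Choice.inv \<tau> i)) < v (\<beta> (Hilbert_Choice.inv \<tau> j))" if "i < p" "j < i" for i j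
    using rank_perm_less_iff[of "Hilbert_Choice.inv \<tau> j" p "Hilbert_Choice.inv \<tau> i" "v \<circ> \<beta>"] that lt'
    by (auto simp: permutes_inverses[OF \<tau>] simp flip: \<tau>_def)
  then show "permute_tuple p (Hilbert_Choice.inv (rank_perm p (v \<circ> \<beta>))) \<beta> \<in> decreasing_tuples p Z v"
    unfolding \<tau>_def[symmetric]
    using \<beta> lt' by (auto simp: decreasing_tuples_def permute_tuple_def tuples_def)
qed

text \<open>The determinant of sums is first a sum over all tuples; tuples with a repeated weight
  cancel, and the remaining ones are grouped into permutations of a decreasing tuple. Absolute
  convergence justifies the regrouping.\<close>

theorem cauchy_binet_infsum:
  fixes w :: "'a \<Rightarrow> complex" and a b :: "nat \<Rightarrow> nat \<Rightarrow> complex" and v :: "'a \<Rightarrow> nat"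
  assumes summ: "\<And>i j. i < p \<Longrightarrow> j < p \<Longrightarrow> (\<lambda>z. w z * a i (v z) * b j (v z)) abs_summable_on Z"
  defines "F \<equiv> \<lambda>\<alpha>. (\<Prod>i=0..<p. w (\<alpha> i)) * det (mat p p (\<lambda>(i, j). a j (v (\<alpha> i))))
      * det (mat p p (\<lambda>(i, j). b j (v (\<alpha> i))))"
  shows "F abs_summable_on decreasing_tuples p Z v"
    and "infsum F (decreasing_tuples p Z v) = det (mat p p (\<lambda>(i, j). \<Sum>\<^sub>\<infinity>z\<in>Z. w z * a i (v z) * b j (v z)))"
proof -
  let ?P = "{\<pi>. \<pi> permutes {0..<p}}"
  let ?h = "\<lambda>i j z. w z * a i (v z) * b j (v z)"
  \<comment> \<open>In \<open>F\<close>, one determinant is replaced by its diagonal product; the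
    other terms of its Leibniz expansion return as values of \<open>G\<close> at permuted
    tuples.\<close>
  define G where "G \<alpha> = (\<Prod>i=0..<p. w (\<alpha> i)) * (\<Prod>i=0..<p. a i (v (\<alpha> i)))
      * det (mat p p (\<lambda>(i, j). b j (v (\<alpha> i))))" for \<alpha>
  have G: "G \<alpha> = (\<Sum>\<pi>\<in>?P. signof \<pi> * (\<Prod>i=0..<p. ?h i (\<pi> i) (\<alpha> i)))" for \<alpha>
    unfolding G_def det_mat_eq_sum sum_distrib_left
    by (simp add: prod.distrib mult_ac)
  have Fsum: "F \<alpha> = (\<Sum>\<tau>\<in>?P. G (permute_tuple p \<tau> \<alpha>))" for \<alpha>
  proof -
    have lt: "\<tau> i < p" if "\<tau> \<in> ?P" "i < p" for \<tau> i
      using permutes_in_image[of \<tau> "{0..<p}" i] that by simp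
    have "G (permute_tuple p \<tau> \<alpha>) = (\<Prod>i=0..<p. w (\<alpha> i)) * (signof \<tau> * (\<Prod>i=0..<p. a i (v (\<alpha> (\<tau> i)))))
        * det (mat p p (\<lambda>(i, j). b j (v (\<alpha> i))))" if \<tau>: "\<tau> \<in> ?P" for \<tau>
    proof -
      have "(\<Prod>i=0..<p. w (permute_tuple p \<tau> \<alpha> i)) = (\<Prod>i=0..<p. w (\<alpha> (\<tau> i)))"
        by (simp add: permute_tuple_def)
      also have "\<dots> = (\<Prod>i=0..<p. w (\<alpha> i))"
        using prod.permute[of \<tau> "{0..<p}" "\<lambda>i. w (\<alpha> i)"] \<tau> by (simp add: comp_def)
      finally have 1: "(\<Prod>i=0..<p. w (permute_tuple p \<tau> \<alpha> i)) = (\<Prod>i=0..<p. w (\<alpha> i))" .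
      have "mat p p (\<lambda>(i, j). b j (v (permute_tuple p \<tau> \<alpha> i))) = mat p p (\<lambda>(i, j). b (id j) (v (\<alpha> (\<tau> i))))"
        by (rule eq_matI) (auto simp: permute_tuple_def)
      then have 2: "det (mat p p (\<lambda>(i, j). b j (v (permute_tuple p \<tau> \<alpha> i))))
          = signof \<tau> * det (mat p p (\<lambda>(i, j). b j (v (\<alpha> i))))"
        using det_permute_rows_cols[of \<tau> p id "\<lambda>i j. b j (v (\<alpha> i))"] \<tau> by simp
      have 3: "(\<Prod>i=0..<p. a i (v (permute_tuple p \<tau> \<alpha> i))) = (\<Prod>i=0..<p. a i (v (\<alpha> (\<tau> i))))"
        by (simp add: permute_tuple_def)
      show ?thesis unfolding G_def 1 2 3 by (simp add: mult_ac)
    qed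
    moreover have "det (mat p p (\<lambda>(i, j). a j (v (\<alpha> i))))
        = (\<Sum>\<tau>\<in>?P. signof \<tau> * (\<Prod>i=0..<p. a i (v (\<alpha> (\<tau> i)))))"
    proof -
      have "det (mat p p (\<lambda>(i, j). a j (v (\<alpha> i))))
          = det (transpose_mat (mat p p (\<lambda>(i, j). a i (v (\<alpha> j)))))"
        by (rule arg_cong[of _ _ det], rule eq_matI) auto
      also have "\<dots> = det (mat p p (\<lambda>(i, j). a i (v (\<alpha> j))))"
        by (rule det_transpose[of _ p]) simp
      finally show ?thesis by (simp only: det_mat_eq_sum)
    qed
    ultimately show ?thesis
      unfolding F_def by (simp add: sum_distrib_left sum_distrib_right mult_ac)
  qed
  have abs1: "(\<lambda>\<alpha>. \<Prod>i=0..<p. ?h i (\<pi> i) (\<alpha> i)) abs_summable_on tuples p Z" if "\<pi> \<in> ?P" for \<pi>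
  proof -
    have "\<pi> i < p" if "i < p" for i
      using permutes_in_image[of \<pi> "{0..<p}" i] that \<open>\<pi> \<in> ?P\<close> by simp
    then show ?thesis
      unfolding tuples_def by (intro abs_summable_prod_PiE summ) auto
  qed
  have Gabs: "G abs_summable_on tuples p Z"
  proof (rule Infinite_Sum.abs_summable_on_comparison_test')
    show "(\<lambda>\<alpha>. \<Sum>\<pi>\<in>?P. norm (\<Prod>i=0..<p. ?h i (\<pi> i) (\<alpha> i))) summable_on tuples p Z"
      using abs1 by (intro summable_on_finite_sum) (auto intro: finite_permutations)
    show "norm (G \<alpha>) \<le> (\<Sum>\<pi>\<in>?P. norm (\<Prod>i=0..<p. ?h i (\<pi> i) (\<alpha> i)))" for \<alpha>
      unfolding G by (rule order_trans[OF norm_sum]) (auto simp: norm_mult sign_def intro!: sum_mono)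
  qed
  let ?inj = "{\<alpha> \<in> tuples p Z. inj_on (v \<circ> \<alpha>) {0..<p}}"
  \<comment> \<open>Equal weights give equal rows in the matrix of b, since its entries depend on
    the tuple only through v.\<close>
  have G0: "G \<alpha> = 0" if \<alpha>: "\<alpha> \<in> tuples p Z - ?inj" for \<alpha>
  proof -
    obtain i j where "i < p" "j < p" "i \<noteq> j" "v (\<alpha> i) = v (\<alpha> j)"
      using \<alpha> by (auto simp: inj_on_def)
    then have "det (mat p p (\<lambda>(i, j). b j (v (\<alpha> i)))) = 0"
      by (intro det_identical_rows[of _ p i j]) (auto intro!: eq_vecI)
    then show ?thesis by (simp add: G_def)
  qed
  have "infsum G (tuples p Z) = (\<Sum>\<^sub>\<infinity>\<alpha>\<in>tuples p Z. \<Sum>\<pi>\<in>?P. signof \<pi> * (\<Prod>i=0..<p. ?h i (\<pi> i) (\<alpha> i)))"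
    by (rule infsum_cong) (rule G)
  also have "\<dots> = (\<Sum>\<pi>\<in>?P. \<Sum>\<^sub>\<infinity>\<alpha>\<in>tuples p Z. signof \<pi> * (\<Prod>i=0..<p. ?h i (\<pi> i) (\<alpha> i)))"
    by (intro infsum_finite_sum summable_on_cmult_right abs_summable_summable[OF abs1]) (auto intro: finite_permutations)
  also have "\<dots> = (\<Sum>\<pi>\<in>?P. signof \<pi> * (\<Prod>i=0..<p. \<Sum>\<^sub>\<infinity>z\<in>Z. ?h i (\<pi> i) z))"
  proof (rule sum.cong[OF refl])
    fix \<pi> assume \<pi>: "\<pi> \<in> ?P"
    have "\<pi> i < p" if "i < p" for i
      using permutes_in_image[of \<pi> "{0..<p}" i] that \<pi> by simp
    then have "(\<Sum>\<^sub>\<infinity>\<alpha>\<in>tuples p Z. \<Prod>i=0..<p. ?h i (\<pi> i) (\<alpha> i)) = (\<Prod>i=0..<p. \<Sum>\<^sub>\<infinity>z\<in>Z. ?h i (\<pi> i) z)"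
      unfolding tuples_def by (intro infsum_prod_PiE_abs summ) auto
    then show "(\<Sum>\<^sub>\<infinity>\<alpha>\<in>tuples p Z. signof \<pi> * (\<Prod>i=0..<p. ?h i (\<pi> i) (\<alpha> i)))
        = signof \<pi> * (\<Prod>i=0..<p. \<Sum>\<^sub>\<infinity>z\<in>Z. ?h i (\<pi> i) z)"
      by (simp add: infsum_cmult_right')
  qed
  finally have G_det: "infsum G (tuples p Z) = det (mat p p (\<lambda>(i, j). \<Sum>\<^sub>\<infinity>z\<in>Z. ?h i j z))"
    by (simp only: det_mat_eq_sum)
  have "G abs_summable_on ?inj"
    using Gabs by (rule summable_on_subset_banach) auto
  then have Gabs': "(\<lambda>(\<tau>, \<alpha>). G (permute_tuple p \<tau> \<alpha>)) abs_summable_on ?P \<times> decreasing_tuples p Z v"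
    using summable_on_reindex_bij_betw[OF bij_betw_permute_tuple[of p Z v], of "\<lambda>\<alpha>. norm (G \<alpha>)"]
    by (simp add: case_prod_unfold)
  have each: "(\<lambda>\<alpha>. G (permute_tuple p \<tau> \<alpha>)) abs_summable_on decreasing_tuples p Z v" if "\<tau> \<in> ?P" for \<tau>
    using Gabs' that by (auto simp: Infinite_Sum.abs_summable_on_Sigma_iff)
  show "F abs_summable_on decreasing_tuples p Z v"
  proof (rule Infinite_Sum.abs_summable_on_comparison_test')
    show "(\<lambda>\<alpha>. \<Sum>\<tau>\<in>?P. norm (G (permute_tuple p \<tau> \<alpha>))) summable_on decreasing_tuples p Z v"
      using each by (intro summable_on_finite_sum) (auto intro: finite_permutations)
    show "norm (F \<alpha>) \<le> (\<Sum>\<tau>\<in>?P. norm (G (permute_tuple p \<tau> \<alpha>)))" for \<alpha>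
      unfolding Fsum by (rule norm_sum)
  qed
  have "infsum F (decreasing_tuples p Z v) = (\<Sum>\<tau>\<in>?P. \<Sum>\<^sub>\<infinity>\<alpha>\<in>decreasing_tuples p Z v. G (permute_tuple p \<tau> \<alpha>))"
    unfolding Fsum[abs_def] by (intro infsum_finite_sum abs_summable_summable[OF each]) (auto intro: finite_permutations)
  also have "\<dots> = (\<Sum>\<^sub>\<infinity>(\<tau>, \<alpha>)\<in>?P \<times> decreasing_tuples p Z v. G (permute_tuple p \<tau> \<alpha>))"
    using infsum_Sigma'_banach[OF abs_summable_summable[OF Gabs']] by (simp add: finite_permutations)
  also have "\<dots> = infsum G ?inj"
    using infsum_reindex_bij_betw[OF bij_betw_permute_tuple[of p Z v], of G]
    by (simp add: case_prod_unfold)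
  also have "\<dots> = infsum G (tuples p Z)"
    using G0 by (intro infsum_cong_neutral) auto
  finally show "infsum F (decreasing_tuples p Z v) = det (mat p p (\<lambda>(i, j). \<Sum>\<^sub>\<infinity>z\<in>Z. ?h i j z))"
    using G_det by simp
qed

section \<open>Minors of the matrix of Lambert series\<close>

definition minor_indices :: "nat \<Rightarrow> nat \<Rightarrow> (nat set \<times> nat set) set" where
  "minor_indices n p = {(S, T). S \<subseteq> {1..n} \<and> T \<subseteq> {1..n} \<and> card S = p \<and> card T = p}"

lemma finite_minor_indices: "finite (minor_indices n p)"
  by (rule finite_subset[of _ "Pow {1..n} \<times> Pow {1..n}"]) (auto simp: minor_indices_def)

text \<open>The squared Vandermonde product in m_r^2 supplies one denominator to each of the two
  Schur functions, so only alternants remain and all divisions disappear.\<close>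

lemma vandermonde_square_mult_minor_sum:
  assumes p: "1 \<le> p" and m: "inj_on m {1..p}"
  shows "(\<Prod>(r, s) \<in> {(r, s). 1 \<le> r \<and> r < s \<and> s \<le> p}. ((real (m r))\<^sup>2 - (real (m s))\<^sup>2)\<^sup>2) * minor_sum n p m
    = (\<Sum>(S, T)\<in>minor_indices n p. (-1) ^ (\<Sum>S + \<Sum>T) * det (D_mat (n - p) ({1..n} - S) ({1..n} - T))
        * alternant p S (\<lambda>r. (real (m r))\<^sup>2) * alternant p T (\<lambda>r. (real (m r))\<^sup>2))"
proof -
  define x where "x r = (real (m r))\<^sup>2" for r
  have x: "inj_on x {1..p}"
  proof (rule inj_onI)
    fix r s assume rs: "r \<in> {1..p}" "s \<in> {1..p}" "x r = x s"
    then have "real (m r) = real (m s)"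
      using power2_eq_iff_nonneg[of "real (m r)" "real (m s)"] by (simp add: x_def)
    then show "r = s" using inj_onD[OF m, of r s] rs by simp
  qed
  define W where "W = det (mat p p (\<lambda>(i, j). x (Suc i) ^ j))"
  have idx: "{(S, T). S \<subseteq> {1..n} \<and> T \<subseteq> {1..n} \<and> S \<noteq> {} \<and> T \<noteq> {} \<and> card S = p \<and> card T = p} = minor_indices n p"
  proof -
    have "S \<noteq> {}" if "card S = p" for S :: "nat set"
      using that p by auto
    then show ?thesis unfolding minor_indices_def by blast
  qed
  have alt: "(\<Prod>r=1..p. x r) ^ (elt S 1 - 1) * schur p (part p S) x * W = alternant p S x"
    and ge: "elt S 1 \<ge> 1" if "S \<subseteq> {1..n}" "card S = p" for S
  proof -
    have fin: "finite S" using that(1) finite_subset by blast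
    show "(\<Prod>r=1..p. x r) ^ (elt S 1 - 1) * schur p (part p S) x * W = alternant p S x"
      unfolding W_def using that by (intro schur_mult_vandermonde_eq_alternant x p fin) auto
    have "elt S 1 \<in> S"
      using nth_mem[of 0 "sorted_list_of_set S"] fin that(2) p by (simp add: elt_def)
    then show "elt S 1 \<ge> 1" using that(1) by auto
  qed
  have "W\<^sup>2 * minor_sum n p m = (\<Sum>(S, T)\<in>minor_indices n p. W\<^sup>2 * ((-1) ^ (\<Sum>S + \<Sum>T)
      * det (D_mat (n - p) ({1..n} - S) ({1..n} - T))
      * (\<Prod>r=1..p. real (m r)) ^ (2 * elt S 1 + 2 * elt T 1 - 4) * schur p (part p S) x * schur p (part p T) x))"
    unfolding minor_sum_def idx x_def by (simp add: sum_distrib_left case_prod_unfold)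
  also have "\<dots> = (\<Sum>(S, T)\<in>minor_indices n p. (-1) ^ (\<Sum>S + \<Sum>T)
      * det (D_mat (n - p) ({1..n} - S) ({1..n} - T)) * alternant p S x * alternant p T x)"
  proof (intro sum.cong refl, safe)
    fix S T assume "(S, T) \<in> minor_indices n p"
    then have S: "S \<subseteq> {1..n}" "card S = p" and T: "T \<subseteq> {1..n}" "card T = p"
      by (auto simp: minor_indices_def)
    \<comment> \<open>The subtraction on \<open>nat\<close> does not truncate because S and T
      contain no element below 1.\<close>
    have "2 * elt S 1 + 2 * elt T 1 - 4 = 2 * (elt S 1 - 1) + 2 * (elt T 1 - 1)"
      using ge[OF S] ge[OF T] by simp
    then have "(\<Prod>r=1..p. real (m r)) ^ (2 * elt S 1 + 2 * elt T 1 - 4)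
        = (\<Prod>r=1..p. x r) ^ (elt S 1 - 1) * (\<Prod>r=1..p. x r) ^ (elt T 1 - 1)"
      by (simp only: power_add power_mult prod_power_distrib x_def)
    then show "W\<^sup>2 * ((-1) ^ (\<Sum>S + \<Sum>T) * det (D_mat (n - p) ({1..n} - S) ({1..n} - T))
        * (\<Prod>r=1..p. real (m r)) ^ (2 * elt S 1 + 2 * elt T 1 - 4) * schur p (part p S) x * schur p (part p T) x)
      = (-1) ^ (\<Sum>S + \<Sum>T) * det (D_mat (n - p) ({1..n} - S) ({1..n} - T)) * alternant p S x * alternant p T x"
      by (simp only: alt[OF S, symmetric] alt[OF T, symmetric] power2_eq_square mult_ac)
  qed
  finally show ?thesis
    unfolding x_def[symmetric] by (simp only: vandermonde_square W_def)
qed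

definition lambert_term :: "complex \<Rightarrow> nat \<Rightarrow> nat \<times> nat \<Rightarrow> complex" where
  "lambert_term q k = (\<lambda>(y, m). (-1) ^ m * q ^ (m * y) * of_nat m ^ (2 * k + 1))"

text \<open>Summing the geometric series over y gives the Lambert series of (-1)^m m^(2k+1) q^m / (1
  - q^m). It is kept as a double sum because y and m are summation variables of the theorem.\<close>

definition lambert_sum :: "complex \<Rightarrow> nat \<Rightarrow> complex" where
  "lambert_sum q k = infsum (lambert_term q k) ({1..} \<times> {1..})"

lemma of_real_alternant: "of_real (alternant p S x) = alternant p S (\<lambda>r. of_real (x r) :: complex)"
proof -
  have "of_real (alternant p S x) = det (map_mat of_real (mat p p (\<lambda>(i, j). x (Suc i) ^ (elt S (Suc j) - 1))))"
    by (simp add: alternant_def of_real_hom.hom_det)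
  also have "map_mat of_real (mat p p (\<lambda>(i, j). x (Suc i) ^ (elt S (Suc j) - 1)))
      = mat p p (\<lambda>(i, j). of_real (x (Suc i)) ^ (elt S (Suc j) - 1) :: complex)"
    by (rule eq_matI) auto
  finally show ?thesis by (simp add: alternant_def)
qed

lemma series_term_eq_sum_alternants:
  assumes p: "1 \<le> p" and ym: "(y, m) \<in> index_set p"
  shows "series_term n p q y m = (\<Sum>(S, T)\<in>minor_indices n p. (-1) ^ (\<Sum>S + \<Sum>T)
    * of_real (det (D_mat (n - p) ({1..n} - S) ({1..n} - T)))
    * ((\<Prod>i=0..<p. (-1) ^ m (Suc i) * q ^ (m (Suc i) * y (Suc i)) * of_nat (m (Suc i)) ^ 3)
      * alternant p S (\<lambda>r. (of_nat (m r))\<^sup>2) * alternant p T (\<lambda>r. (of_nat (m r))\<^sup>2)))"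
proof -
  have "m r \<noteq> m s" if "r \<in> {1..p}" "s \<in> {1..p}" "r \<noteq> s" for r s
  proof (cases "r < s")
    case True
    then have "m s < m r" using that ym by (auto simp: index_set_def)
    then show ?thesis by simp
  next
    case False
    then have "m r < m s" using that ym by (auto simp: index_set_def)
    then show ?thesis by simp
  qed
  then have inj: "inj_on m {1..p}" unfolding inj_on_def by blast
  define U where "U = (\<Prod>i=0..<p. (-1) ^ m (Suc i) * q ^ (m (Suc i) * y (Suc i)) * of_nat (m (Suc i)) ^ 3)"
  have U: "(-1) ^ (\<Sum>r=1..p. m r) * q ^ (\<Sum>r=1..p. m r * y r) * (\<Prod>r=1..p. of_nat (m r)) ^ 3 = U"
    by (simp add: U_def prod.distrib power_sum prod_power_distrib prod.atLeast1_atMost_eq sum.atLeast1_atMost_eq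
      atLeast0LessThan)
  have "series_term n p q y m = U * of_real ((\<Prod>(r, s) \<in> {(r, s). 1 \<le> r \<and> r < s \<and> s \<le> p}.
      ((real (m r))\<^sup>2 - (real (m s))\<^sup>2)\<^sup>2) * minor_sum n p m)"
    unfolding series_term_def U by (simp add: case_prod_unfold)
  also have "\<dots> = U * (\<Sum>(S, T)\<in>minor_indices n p. (-1) ^ (\<Sum>S + \<Sum>T)
      * of_real (det (D_mat (n - p) ({1..n} - S) ({1..n} - T)))
      * alternant p S (\<lambda>r. (of_nat (m r))\<^sup>2) * alternant p T (\<lambda>r. (of_nat (m r))\<^sup>2))"
    unfolding vandermonde_square_mult_minor_sum[OF p inj]
    by (simp add: case_prod_unfold of_real_alternant)
  finally show ?thesis
    unfolding U_def[symmetric] by (simp add: sum_distrib_left case_prod_unfold mult_ac)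
qed

text \<open>A pair of one-based tuples becomes a zero-based tuple of pairs.\<close>

lemma bij_betw_index_set:
  "bij_betw (\<lambda>(y, m) i. if i < p then (y (Suc i), m (Suc i)) else undefined) (index_set p)
    (decreasing_tuples p ({1..} \<times> {1..}) snd)"
proof (rule bij_betw_byWitness[of _ "\<lambda>\<alpha>. (\<lambda>r. if 1 \<le> r \<and> r \<le> p then fst (\<alpha> (r - 1)) else undefined,
    \<lambda>r. if 1 \<le> r \<and> r \<le> p then snd (\<alpha> (r - 1)) else undefined)"])
  show "\<forall>a\<in>index_set p. (\<lambda>\<alpha>. (\<lambda>r. if 1 \<le> r \<and> r \<le> p then fst (\<alpha> (r - 1)) else undefined,
    \<lambda>r. if 1 \<le> r \<and> r \<le> p then snd (\<alpha> (r - 1)) else undefined))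
    ((\<lambda>(y, m) i. if i < p then (y (Suc i), m (Suc i)) else undefined) a) = a"
    by (auto simp: index_set_def fun_eq_iff PiE_def extensional_def)
  show "\<forall>a'\<in>decreasing_tuples p ({1..} \<times> {1..}) snd.
    (\<lambda>(y, m) i. if i < p then (y (Suc i), m (Suc i)) else undefined)
      ((\<lambda>\<alpha>. (\<lambda>r. if 1 \<le> r \<and> r \<le> p then fst (\<alpha> (r - 1)) else undefined,
    \<lambda>r. if 1 \<le> r \<and> r \<le> p then snd (\<alpha> (r - 1)) else undefined)) a') = a'"
    by (auto simp: decreasing_tuples_def tuples_def fun_eq_iff PiE_def extensional_def)
  show "(\<lambda>(y, m) i. if i < p then (y (Suc i), m (Suc i)) else undefined) ` index_set p
    \<subseteq> decreasing_tuples p ({1..} \<times> {1..}) snd"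
    by (auto simp: index_set_def decreasing_tuples_def tuples_def Pi_iff PiE_def extensional_def)
  show "(\<lambda>\<alpha>. (\<lambda>r. if 1 \<le> r \<and> r \<le> p then fst (\<alpha> (r - 1)) else undefined,
    \<lambda>r. if 1 \<le> r \<and> r \<le> p then snd (\<alpha> (r - 1)) else undefined)) `
      decreasing_tuples p ({1..} \<times> {1..}) snd \<subseteq> index_set p"
  proof (rule image_subsetI)
    fix \<alpha> assume \<alpha>: "\<alpha> \<in> decreasing_tuples p ({1::nat..} \<times> {1::nat..}) snd"
    have mem: "\<alpha> i \<in> {1..} \<times> {1..}" if "i < p" for i
    proof -
      have "\<alpha> \<in> {0..<p} \<rightarrow>\<^sub>E {1..} \<times> {1..}"
        using \<alpha> by (simp add: decreasing_tuples_def tuples_def)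
      from PiE_mem[OF this, of i] show ?thesis using that by simp
    qed
    have dec: "snd (\<alpha> i) < snd (\<alpha> j)" if "i < p" "j < i" for i j
      using \<alpha> that by (auto simp: decreasing_tuples_def)
    have mem': "1 \<le> fst (\<alpha> (r - 1))" "1 \<le> snd (\<alpha> (r - 1))" if "1 \<le> r" "r \<le> p" for r
      using mem[of "r - 1"] that by (auto simp: mem_Times_iff)
    have dec': "snd (\<alpha> (s - 1)) < snd (\<alpha> (r - 1))" if "1 \<le> r" "r < s" "s \<le> p" for r s
      using dec[of "s - 1" "r - 1"] that by auto
    show "(\<lambda>r. if 1 \<le> r \<and> r \<le> p then fst (\<alpha> (r - 1)) else undefined,
      \<lambda>r. if 1 \<le> r \<and> r \<le> p then snd (\<alpha> (r - 1)) else undefined) \<in> index_set p"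
      unfolding index_set_def using mem' dec' by (simp add: PiE_iff extensional_def)
  qed
qed

text \<open>Cauchy-Binet with weight (-1)^m q^(my) m^3 and the even powers m^(2(l-1)) and m^(2(j-1))
  picked out by S and T.\<close>

lemma lambert_cauchy_binet:
  fixes n :: nat
  assumes summ: "\<And>k. lambert_term q k abs_summable_on {1..} \<times> {1..}"
    and ST: "(S, T) \<in> minor_indices n p"
  defines "F \<equiv> \<lambda>(y, m). (\<Prod>i=0..<p. (-1) ^ m (Suc i) * q ^ (m (Suc i) * y (Suc i)) * of_nat (m (Suc i)) ^ 3)
      * alternant p S (\<lambda>r. (of_nat (m r))\<^sup>2) * alternant p T (\<lambda>r. (of_nat (m r))\<^sup>2)"
  shows "F abs_summable_on index_set p"
    and "infsum F (index_set p) = det (mat p p (\<lambda>(i, j). lambert_sum q (elt S (Suc i) + elt T (Suc j) - 1)))"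
proof -
  have S: "S \<subseteq> {1..n}" "card S = p" and T: "T \<subseteq> {1..n}" "card T = p"
    using ST by (auto simp: minor_indices_def)
  have ge: "elt S (Suc i) \<ge> 1" if "i < card S" "S \<subseteq> {1..n}" for S i
  proof -
    have "finite S" using that(2) finite_subset by blast
    then have "elt S (Suc i) \<in> S"
      using nth_mem[of i "sorted_list_of_set S"] that(1) by (simp add: elt_def)
    then show ?thesis using that(2) by auto
  qed
  define w where "w z = (-1) ^ snd z * q ^ (snd z * fst z) * of_nat (snd z) ^ 3" for z :: "nat \<times> nat"
  define a where "a i m = (of_nat m :: complex)\<^sup>2 ^ (elt S (Suc i) - 1)" for i m :: nat
  define b where "b i m = (of_nat m :: complex)\<^sup>2 ^ (elt T (Suc i) - 1)" for i m :: nat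
  have entry: "w z * a i (snd z) * b j (snd z) = lambert_term q (elt S (Suc i) + elt T (Suc j) - 1) z"
    if "i < p" "j < p" for i j z
  proof -
    \<comment> \<open>The exponent 3 of the weight makes the total power of m the odd number
      required by \<open>lambert_term\<close> with index l + j - 1.\<close>
    have "3 + 2 * (elt S (Suc i) - 1) + 2 * (elt T (Suc j) - 1) = 2 * (elt S (Suc i) + elt T (Suc j) - 1) + 1"
      using ge[of i S] ge[of j T] S T that by simp
    then show ?thesis
      by (simp only: w_def a_def b_def lambert_term_def case_prod_unfold mult.assoc flip: power_mult power_add)
  qed
  let ?F = "\<lambda>\<alpha>. (\<Prod>i=0..<p. w (\<alpha> i)) * det (mat p p (\<lambda>(i, j). a j (snd (\<alpha> i))))
      * det (mat p p (\<lambda>(i, j). b j (snd (\<alpha> i))))"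
  let ?\<phi> = "\<lambda>(y, m) i. if i < p then (y (Suc i), m (Suc i)) else undefined"
  have sw: "(\<lambda>z. w z * a i (snd z) * b j (snd z)) abs_summable_on {1..} \<times> {1..}" if "i < p" "j < p" for i j
    using summ by (simp only: entry[OF that])
  note CB = cauchy_binet_infsum[of p w a snd b, OF sw]
  have F: "F ym = ?F (?\<phi> ym)" for ym
  proof (cases ym)
    case (Pair y m)
    have "(\<Prod>i=0..<p. w (?\<phi> (y, m) i)) = (\<Prod>i=0..<p. (-1) ^ m (Suc i) * q ^ (m (Suc i) * y (Suc i)) * of_nat (m (Suc i)) ^ 3)"
      by (simp add: w_def)
    moreover have "mat p p (\<lambda>(i, j). a j (snd (?\<phi> (y, m) i))) = mat p p (\<lambda>(i, j). (of_nat (m (Suc i)))\<^sup>2 ^ (elt S (Suc j) - 1))"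
      "mat p p (\<lambda>(i, j). b j (snd (?\<phi> (y, m) i))) = mat p p (\<lambda>(i, j). (of_nat (m (Suc i)))\<^sup>2 ^ (elt T (Suc j) - 1))"
      by (auto simp: a_def b_def intro!: eq_matI)
    ultimately show ?thesis
      unfolding Pair F_def alternant_def by (simp only: prod.case)
  qed
  show "F abs_summable_on index_set p"
    unfolding F using CB(1) summable_on_reindex_bij_betw[OF bij_betw_index_set[of p], of "\<lambda>\<alpha>. norm (?F \<alpha>)"]
    by simp
  have "infsum F (index_set p) = infsum ?F (decreasing_tuples p ({1..} \<times> {1..}) snd)"
    unfolding F using infsum_reindex_bij_betw[OF bij_betw_index_set[of p], of ?F] by simp
  also have "\<dots> = det (mat p p (\<lambda>(i, j). \<Sum>\<^sub>\<infinity>z\<in>{1..} \<times> {1..}. w z * a i (snd z) * b j (snd z)))"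
    by (rule CB(2))
  also have "mat p p (\<lambda>(i, j). \<Sum>\<^sub>\<infinity>z\<in>{1..} \<times> {1..}. w z * a i (snd z) * b j (snd z))
      = mat p p (\<lambda>(i, j). lambert_sum q (elt S (Suc i) + elt T (Suc j) - 1))"
    by (rule eq_matI) (auto simp: entry lambert_sum_def)
  finally show "infsum F (index_set p) = det (mat p p (\<lambda>(i, j). lambert_sum q (elt S (Suc i) + elt T (Suc j) - 1)))" .
qed

lemma series_term_summation:
  assumes summ: "\<And>k. lambert_term q k abs_summable_on {1..} \<times> {1..}" and p: "1 \<le> p"
  shows "(\<lambda>(y, m). series_term n p q y m) abs_summable_on index_set p"
    and "(\<Sum>\<^sub>\<infinity>(y, m)\<in>index_set p. series_term n p q y m) =
      (\<Sum>(S, T)\<in>minor_indices n p. (-1) ^ (\<Sum>S + \<Sum>T)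
        * of_real (det (D_mat (n - p) ({1..n} - S) ({1..n} - T)))
        * det (mat p p (\<lambda>(i, j). lambert_sum q (elt S (Suc i) + elt T (Suc j) - 1))))"
proof -
  define F where "F S T = (\<lambda>(y, m). (\<Prod>i=0..<p. (-1) ^ m (Suc i) * q ^ (m (Suc i) * y (Suc i)) * of_nat (m (Suc i)) ^ 3)
      * alternant p S (\<lambda>r. (of_nat (m r))\<^sup>2) * alternant p T (\<lambda>r. (of_nat (m r))\<^sup>2) :: complex)" for S T
  define c where "c S T = (-1) ^ (\<Sum>S + \<Sum>T) * (of_real (det (D_mat (n - p) ({1..n} - S) ({1..n} - T))) :: complex)" for S T
  have eq: "(case ym of (y, m) \<Rightarrow> series_term n p q y m) = (\<Sum>ST\<in>minor_indices n p. c (fst ST) (snd ST) * F (fst ST) (snd ST) ym)"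
    if "ym \<in> index_set p" for ym
    using series_term_eq_sum_alternants[OF p, of "fst ym" "snd ym" n q] that
    by (simp add: case_prod_unfold F_def c_def)
  have abs: "F (fst ST) (snd ST) abs_summable_on index_set p"
    and det: "infsum (F (fst ST) (snd ST)) (index_set p) =
      det (mat p p (\<lambda>(i, j). lambert_sum q (elt (fst ST) (Suc i) + elt (snd ST) (Suc j) - 1)))"
    if "ST \<in> minor_indices n p" for ST
    unfolding F_def by (rule lambert_cauchy_binet[OF summ, of _ _ n], use that in simp)+
  have "(\<lambda>ym. \<Sum>ST\<in>minor_indices n p. norm (c (fst ST) (snd ST)) * norm (F (fst ST) (snd ST) ym)) summable_on index_set p"
    using abs by (intro summable_on_finite_sum finite_minor_indices summable_on_cmult_right)
  then show "(\<lambda>(y, m). series_term n p q y m) abs_summable_on index_set p"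
    by (rule Infinite_Sum.abs_summable_on_comparison_test')
       (auto simp: eq[of "(_, _)", simplified] simp flip: norm_mult intro!: norm_sum)
  have "(\<Sum>\<^sub>\<infinity>(y, m)\<in>index_set p. series_term n p q y m)
      = (\<Sum>\<^sub>\<infinity>ym\<in>index_set p. \<Sum>ST\<in>minor_indices n p. c (fst ST) (snd ST) * F (fst ST) (snd ST) ym)"
    by (rule infsum_cong) (rule eq)
  also have "\<dots> = (\<Sum>ST\<in>minor_indices n p. \<Sum>\<^sub>\<infinity>ym\<in>index_set p. c (fst ST) (snd ST) * F (fst ST) (snd ST) ym)"
    by (intro infsum_finite_sum finite_minor_indices summable_on_cmult_right abs_summable_summable[OF abs])
  also have "\<dots> = (\<Sum>ST\<in>minor_indices n p. c (fst ST) (snd ST) *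
      det (mat p p (\<lambda>(i, j). lambert_sum q (elt (fst ST) (Suc i) + elt (snd ST) (Suc j) - 1))))"
    by (intro sum.cong refl) (simp only: infsum_cmult_right' det)
  finally show "(\<Sum>\<^sub>\<infinity>(y, m)\<in>index_set p. series_term n p q y m) =
      (\<Sum>(S, T)\<in>minor_indices n p. (-1) ^ (\<Sum>S + \<Sum>T)
        * of_real (det (D_mat (n - p) ({1..n} - S) ({1..n} - T)))
        * det (mat p p (\<lambda>(i, j). lambert_sum q (elt S (Suc i) + elt T (Suc j) - 1))))"
    by (simp add: c_def case_prod_unfold)
qed

text \<open>The matrix of the a_i enters the Laplace expansion with a minus sign, whence (-1)^(n-p).
  The term p = 0 is treated separately, the passage through Schur functions being made for p >=
  1.\<close>

theorem det_lambert_minus_tangent: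
  assumes summ: "\<And>k. lambert_term q k abs_summable_on {1..} \<times> {1..}"
  shows "det (mat n n (\<lambda>(i, j). lambert_sum q (i + j + 1) - of_real (a_coeff (i + j + 1))))
    = (-1) ^ n * of_real (det (mat n n (\<lambda>(i, j). a_coeff (i + j + 1))))
      + (\<Sum>p=1..n. (-1) ^ (n - p) * (\<Sum>\<^sub>\<infinity>(y, m)\<in>index_set p. series_term n p q y m))"
proof -
  define t where "t p = (\<Sum>(S, T)\<in>minor_indices n p. (-1) ^ (\<Sum>S + \<Sum>T)
        * det (mat p p (\<lambda>(i, j). lambert_sum q (elt S (Suc i) + elt T (Suc j) - 1)))
        * det (mat (n - p) (n - p) (\<lambda>(i, j). - of_real (a_coeff (elt ({1..n} - S) (Suc i) + elt ({1..n} - T) (Suc j) - 1)))))" for p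
  have neg: "det (mat k k (\<lambda>(i, j). - of_real (a_coeff (elt U (Suc i) + elt V (Suc j) - 1))))
      = (-1) ^ k * (of_real (det (D_mat k U V)) :: complex)" for k U V
  proof -
    have "(of_real (det (D_mat k U V)) :: complex) = det (map_mat of_real (D_mat k U V))"
      by (simp add: of_real_hom.hom_det)
    also have "map_mat of_real (D_mat k U V) = mat k k (\<lambda>(i, j). of_real (a_coeff (elt U (Suc i) + elt V (Suc j) - 1)) :: complex)"
      by (rule eq_matI) (auto simp: D_mat_def)
    finally show ?thesis
      using det_row_scale[of k "\<lambda>_. -1 :: complex" "\<lambda>i j. of_real (a_coeff (elt U (Suc i) + elt V (Suc j) - 1))"]
      by simp
  qed
  have "det (mat n n (\<lambda>(i, j). lambert_sum q (i + j + 1) - of_real (a_coeff (i + j + 1))))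
      = (\<Sum>p\<le>n. t p)"
    using det_add_laplace[of n "\<lambda>i j. lambert_sum q (i + j - 1)" "\<lambda>i j. - of_real (a_coeff (i + j - 1))"]
    unfolding t_def minor_indices_def by simp
  also have "{..n} = insert 0 {1..n}" by auto
  also have "(\<Sum>p\<in>insert 0 {1..n}. t p) = t 0 + (\<Sum>p=1..n. t p)"
    by simp
  also have "t 0 = (-1) ^ n * of_real (det (mat n n (\<lambda>(i, j). a_coeff (i + j + 1))))"
  proof -
    have "finite S" if "S \<subseteq> {1..n}" for S using that finite_subset by blast
    then have "minor_indices n 0 = {({}, {})}"
      by (auto simp: minor_indices_def)
    moreover have "D_mat n {1..n} {1..n} = mat n n (\<lambda>(i, j). a_coeff (i + j + 1))"
    proof -
      have "sorted_list_of_set {1..n} = [1..<Suc n]"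
        by (simp flip: atLeastLessThanSuc_atLeastAtMost)
      then have "elt {1..n} (Suc i) = Suc i" if "i < n" for i
        using that by (simp add: elt_def del: upt_Suc)
      then show ?thesis by (intro eq_matI) (auto simp: D_mat_def)
    qed
    ultimately show ?thesis
      unfolding t_def neg by simp
  qed
  also have "(\<Sum>p=1..n. t p) = (\<Sum>p=1..n. (-1) ^ (n - p) * (\<Sum>\<^sub>\<infinity>(y, m)\<in>index_set p. series_term n p q y m))"
  proof (rule sum.cong[OF refl])
    fix p assume "p \<in> {1..n}"
    then have "1 \<le> p" by simp
    show "t p = (-1) ^ (n - p) * (\<Sum>\<^sub>\<infinity>(y, m)\<in>index_set p. series_term n p q y m)"
      unfolding t_def neg series_term_summation(2)[OF summ \<open>1 \<le> p\<close>]
      by (simp add: sum_distrib_left case_prod_unfold mult_ac)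
  qed
  finally show ?thesis .
qed

section \<open>Bernoulli numbers\<close>

definition fermi_fps :: "real fps" where
  "fermi_fps = inverse (1 + fps_exp 1)"

lemma fermi_fps_mult: "fermi_fps * (1 + fps_exp 1) = 1"
  unfolding fermi_fps_def by (rule inverse_mult_eq_1) simp

text \<open>With b = t / (e^t - 1) and b2 = b(2t), this is the identity t / (e^t - 1) - 2t / (e^(2t)
  - 1) = t / (e^t + 1).\<close>

lemma fermi_fps_nth: "fps_nth fermi_fps k = bernoulli (k + 1) * (1 - 2 ^ (k + 1)) / fact (k + 1)"
proof -
  define b where "b = Abs_fps (\<lambda>n. bernoulli n / fact n)"
  define b2 where "b2 = fps_compose b (fps_const 2 * fps_X)"
  define E where "E = fps_exp (1::real)"
  have 1: "b * (E - 1) = fps_X"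
    unfolding b_def E_def by (rule bernoulli_egf)
  have "fps_compose (b * (E - 1)) (fps_const 2 * fps_X) = b2 * (fps_compose E (fps_const 2 * fps_X) - 1)"
    by (simp add: b2_def fps_compose_mult_distrib fps_compose_sub_distrib)
  moreover have "fps_compose E (fps_const 2 * fps_X) = E ^ 2"
    unfolding E_def by (simp add: fps_exp_power_mult)
  ultimately have 2: "b2 * (E ^ 2 - 1) = 2 * fps_X"
    unfolding 1 by (simp add: numeral_fps_const)
  have "(b - b2) * (E + 1) * (E - 1) = (b * (E - 1)) * (E + 1) - b2 * (E ^ 2 - 1)"
    by (simp add: algebra_simps power2_eq_square)
  also have "\<dots> = fps_X * (E - 1)"
    unfolding 1 2 by (simp add: algebra_simps)
  finally have "(b - b2) * (E + 1) * (E - 1) = fps_X * (E - 1)" .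
  moreover have "fps_nth (E - 1) 1 \<noteq> 0" by (simp add: E_def)
  then have "E - 1 \<noteq> 0" by force
  ultimately have "(b - b2) * (E + 1) = fps_X"
    by simp
  then have "(b - b2) * (fermi_fps * (1 + fps_exp 1)) = fps_X * fermi_fps"
    by (metis E_def add.commute mult.assoc mult.commute)
  then have "fps_nth (b - b2) (Suc k) = fps_nth (fps_X * fermi_fps) (Suc k)"
    unfolding fermi_fps_mult by simp
  moreover have "fps_nth b2 n = 2 ^ n * (bernoulli n / fact n)" for n
    by (simp add: b2_def fps_compose_linear b_def)
  ultimately have "fps_nth fermi_fps k = bernoulli (Suc k) / fact (Suc k) - 2 ^ Suc k * (bernoulli (Suc k) / fact (Suc k))"
    by (simp add: b_def del: fact_Suc power_Suc)
  then show ?thesis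
    by (simp add: algebra_simps diff_divide_distrib del: fact_Suc power_Suc)
qed

text \<open>The series of - tanh(t/2) / 2. Subtracting 1/2 makes it odd and removes the linear term
  from its Riccati equation.\<close>

definition half_tanh_fps :: "real fps" where
  "half_tanh_fps = fermi_fps - fps_const (1/2)"

lemma fps_deriv_half_tanh: "fps_deriv half_tanh_fps = half_tanh_fps\<^sup>2 - fps_const (1/4)"
proof -
  let ?H = "fermi_fps" and ?E = "fps_exp 1 :: real fps"
  have "fps_deriv (?H * (1 + ?E)) = 0"
    unfolding fermi_fps_mult by simp
  then have "fps_deriv ?H * (1 + ?E) = - (?H * ?E)"
    by (simp add: algebra_simps eq_neg_iff_add_eq_0)
  moreover have "fps_deriv ?H = (fps_deriv ?H * (1 + ?E)) * ?H"
    using fermi_fps_mult by (simp only: mult.assoc mult.commute[of "1 + ?E"] mult_1_right)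
  ultimately have "fps_deriv ?H = - (?H * ?E) * ?H" by simp
  also have "\<dots> = - ?H * (?H * (1 + ?E)) + ?H * ?H"
    by (simp add: algebra_simps)
  finally have "fps_deriv ?H = ?H\<^sup>2 - ?H"
    by (simp add: fermi_fps_mult power2_eq_square)
  moreover have "half_tanh_fps\<^sup>2 = ?H\<^sup>2 - ?H + fps_const (1/4)"
  proof -
    have "half_tanh_fps\<^sup>2 = ?H\<^sup>2 - (fps_const (1/2) + fps_const (1/2)) * ?H + fps_const (1/2) * fps_const (1/2)"
      unfolding half_tanh_fps_def by (simp only: power2_eq_square algebra_simps)
    then show ?thesis by (simp del: fps_const_add add: fps_const_add)
  qed
  ultimately show ?thesis by (simp add: half_tanh_fps_def)
qed

lemma half_tanh_nth_Suc:
  "real (Suc k) * fps_nth half_tanh_fps (Suc k)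
    = (\<Sum>i=0..k. fps_nth half_tanh_fps i * fps_nth half_tanh_fps (k - i)) - (if k = 0 then 1/4 else 0)"
  using arg_cong[OF fps_deriv_half_tanh, of "\<lambda>f. fps_nth f k"]
  by (simp add: power2_eq_square fps_mult_nth)

lemma half_tanh_nth_0: "fps_nth half_tanh_fps 0 = 0"
  by (simp add: half_tanh_fps_def fermi_fps_def)

text \<open>The absolute value in \<open>a_coeff\<close> calls for the sign of B_(2i+2). The
  recursion from the Riccati equation supplies it: for even k each product has a factor of even
  index, which vanishes; for odd k all nonzero products have the same sign. The value -1/4 at k = 1
  starts the alternation.\<close>

lemma half_tanh_nth_sign:
  "(even k \<longrightarrow> fps_nth half_tanh_fps k = 0) \<and> (odd k \<longrightarrow> 0 \<le> (-1) ^ ((k + 1) div 2) * fps_nth half_tanh_fps k)"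
proof (induction k rule: less_induct)
  case (less k)
  let ?h = "fps_nth half_tanh_fps"
  show ?case
  proof (cases k)
    case 0
    then show ?thesis by (simp add: half_tanh_nth_0)
  next
    case (Suc l)
    show ?thesis
    proof (cases "even k")
      case True
      have "?h i * ?h (l - i) = 0" if "i \<le> l" for i
      proof -
        have "even i \<or> even (l - i)" using True Suc that by auto
        moreover have "i < k" "l - i < k" using that Suc by auto
        ultimately show ?thesis using less.IH[of i] less.IH[of "l - i"] by auto
      qed
      then have "(\<Sum>i=0..l. ?h i * ?h (l - i)) = 0"
        by (intro sum.neutral) auto
      moreover have "l \<noteq> 0" using True Suc by (cases l) auto
      ultimately have "real k * ?h k = 0"
        unfolding Suc half_tanh_nth_Suc by simp
      then show ?thesis using True Suc by simp
    next
      case False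
      then obtain j where l: "l = 2 * j" using Suc by (auto elim: evenE)
      \<comment> \<open>For i = 2a + 1 the complementary index is 2(j - a - 1) + 1, and the two sign
        exponents a + 1 and j - a add up to j + 1 whatever a is.\<close>
      have "0 \<le> (-1) ^ (j + 1) * (?h i * ?h (l - i))" if "i \<le> l" for i
      proof (cases "even i")
        case True
        then show ?thesis using less.IH[of i] that Suc by simp
      next
        case False
        then obtain a where a: "i = 2 * a + 1" by (auto elim: oddE)
        then have li: "l - i = 2 * (j - a - 1) + 1" "j = a + 1 + (j - a - 1)" using that l by auto
        have "i < k" "l - i < k" "odd i" "odd (l - i)" using that Suc a li by auto
        then have "0 \<le> (-1) ^ ((i + 1) div 2) * ?h i" "0 \<le> (-1) ^ ((l - i + 1) div 2) * ?h (l - i)"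
          using less.IH[of i] less.IH[of "l - i"] by blast+
        moreover have "(i + 1) div 2 = a + 1" "(l - i + 1) div 2 = j - a - 1 + 1"
          unfolding li(1) unfolding a by simp_all
        ultimately have "0 \<le> ((-1) ^ (a + 1) * ?h i) * ((-1) ^ (j - a - 1 + 1) * ?h (l - i))"
          by (metis mult_nonneg_nonneg)
        also have "\<dots> = (-1) ^ ((a + 1) + (j - a - 1 + 1)) * (?h i * ?h (l - i))"
          by (simp add: power_add mult_ac)
        also have "(a + 1) + (j - a - 1 + 1) = j + 1"
          using li(2) by simp
        finally show ?thesis .
      qed
      then have "0 \<le> (\<Sum>i=0..l. (-1) ^ (j + 1) * (?h i * ?h (l - i)))"
        by (intro sum_nonneg) auto
      then have "0 \<le> (-1) ^ (j + 1) * (\<Sum>i=0..l. ?h i * ?h (l - i))"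
        by (simp only: sum_distrib_left)
      moreover have "real k * ?h k = (\<Sum>i=0..l. ?h i * ?h (l - i)) - (if l = 0 then 1/4 else 0)"
        by (simp only: Suc half_tanh_nth_Suc)
      ultimately have "0 \<le> (-1) ^ (j + 1) * (real k * ?h k)"
        using l half_tanh_nth_0 by (cases "l = 0") simp_all
      then have "0 \<le> real k * ((-1) ^ (j + 1) * ?h k)" by (simp add: mult_ac)
      moreover have "0 < real k" using Suc by simp
      ultimately have "0 \<le> (-1) ^ (j + 1) * ?h k"
        using mult_pos_neg[of "real k" "(-1) ^ (j + 1) * ?h k"] by (meson leD leI)
      moreover have "(k + 1) div 2 = j + 1" using Suc l by simp
      ultimately show ?thesis using False by metis
    qed
  qed
qed

text \<open>The sign (-1)^i cancels the absolute value of B_(2i+2), so the a_i become Taylor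
  coefficients of a function with a differential equation.\<close>

lemma a_coeff_eq_half_tanh:
  "a_coeff i = - fact (2 * i) * fps_nth (fps_deriv half_tanh_fps) (2 * i) / 2"
proof -
  let ?B = "bernoulli (2 * i + 2)"
  have h: "fps_nth half_tanh_fps (2 * i + 1) = ?B * (1 - 2 ^ (2 * i + 2)) / fact (2 * i + 2)"
    by (simp add: half_tanh_fps_def fermi_fps_nth)
  have lt: "(1::real) < 2 ^ (2 * i + 2)" by (rule one_less_power) auto
  have "0 \<le> (-1) ^ (i + 1) * fps_nth half_tanh_fps (2 * i + 1)"
    using half_tanh_nth_sign[of "2 * i + 1"] by simp
  then have nonneg: "0 \<le> ((-1) ^ i * ?B) * ((2 ^ (2 * i + 2) - 1) / fact (2 * i + 2))"
    unfolding h by (simp add: algebra_simps diff_divide_distrib)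
  have "0 < (2 ^ (2 * i + 2) - 1) / (fact (2 * i + 2) :: real)"
    using lt by (intro divide_pos_pos) auto
  with nonneg have "0 \<le> (-1) ^ i * ?B"
    using mult_neg_pos[of "(-1) ^ i * ?B"] by (meson leD leI)
  moreover have "\<bar>?B\<bar> = \<bar>(-1) ^ i * ?B\<bar>" by (simp add: abs_mult)
  ultimately have abs: "\<bar>?B\<bar> = (-1) ^ i * ?B" by simp
  have "a_coeff i = (2 ^ (2 * i + 2) - 1) / (4 * (real i + 1)) * ?B"
    unfolding a_coeff_def abs by (simp add: power_mult_distrib[symmetric] flip: mult.assoc)
  also have "\<dots> = - fact (2 * i) * ((2 * real i + 1) *
      (?B * (1 - 2 ^ (2 * i + 2)) / ((2 * real i + 2) * (2 * real i + 1) * fact (2 * i)))) / 2"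
  proof -
    have "(P - 1) / (4 * (x + 1)) * B = - F * ((2 * x + 1) * (B * (1 - P) / ((2 * x + 2) * (2 * x + 1) * F))) / 2"
      if "F > 0" "x \<ge> 0" for P B F x :: real
    proof -
      have "2 * x + 1 > 0" "x + 1 > 0" using that by auto
      then have "F * ((2 * x + 1) * (B * (1 - P) / ((2 * x + 2) * (2 * x + 1) * F))) = B * (1 - P) / (2 * (x + 1))"
        using that by (simp add: divide_simps)
      then have "- F * ((2 * x + 1) * (B * (1 - P) / ((2 * x + 2) * (2 * x + 1) * F))) / 2 = - (B * (1 - P) / (2 * (x + 1))) / 2"
        by (simp only: mult_minus_left)
      also have "\<dots> = (P - 1) / (4 * (x + 1)) * B"
        using \<open>x + 1 > 0\<close> by (simp add: field_simps)
      finally show ?thesis by simp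
    qed
    from this[of "fact (2 * i)" "real i" "2 ^ (2 * i + 2)" ?B, OF fact_gt_zero of_nat_0_le_iff] show ?thesis .
  qed
  also have "(2 * real i + 2) * (2 * real i + 1) * fact (2 * i) = (fact (2 * i + 2) :: real)"
    by (simp add: algebra_simps)
  also have "(2 * real i + 1) * (?B * (1 - 2 ^ (2 * i + 2)) / fact (2 * i + 2))
      = fps_nth (fps_deriv half_tanh_fps) (2 * i)"
    by (simp only: fps_deriv_nth h of_nat_add of_nat_mult of_nat_1 of_nat_numeral)
  finally show ?thesis .
qed

text \<open>The case q = 0: f = K^2 with K' = K^2 - 1/4 satisfies f'' = 6 f^2 - 2 f + 1/8, and f_2
  is the square of K'(0) = -1/4.\<close>

lemma det_a_coeff:
  "(-2) ^ n * det (mat n n (\<lambda>(i, j). a_coeff (i + j + 1)))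
    = (\<Prod>r=1..2*n. fact r) * (1 / 16) ^ (\<Sum>k<n. Suc k)"
proof -
  let ?K = half_tanh_fps
  define f where "f = ?K\<^sup>2"
  have K1: "fps_nth ?K 1 = - 1 / 4"
    using half_tanh_nth_Suc[of 0] by (simp add: half_tanh_nth_0)
  have dK: "fps_deriv ?K = f - fps_const (1/4)" by (simp add: f_def fps_deriv_half_tanh)
  have df: "fps_deriv f = 2 * ?K * (f - fps_const (1/4))"
    unfolding f_def power2_eq_square by (simp add: dK f_def power2_eq_square algebra_simps)
  have "fps_deriv (fps_deriv f) = 2 * (f - fps_const (1/4)) * (f - fps_const (1/4)) + 4 * (?K * ?K) * (f - fps_const (1/4))"
    unfolding df by (simp add: df dK algebra_simps)
  also have "?K * ?K = f" by (simp add: f_def power2_eq_square)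
  also have "2 * (f - fps_const (1/4)) * (f - fps_const (1/4)) + 4 * f * (f - fps_const (1/4))
      = 6 * f\<^sup>2 + fps_const (-2) * f + fps_const (1/8)"
  proof -
    have "fps_const (1/8) = 2 * (fps_const (1/4) * fps_const (1/4) :: real fps)"
      by (simp add: numeral_fps_const)
    moreover have "fps_const (-2) = - 8 * (fps_const (1/4) :: real fps)"
      by (simp add: numeral_fps_const)
    ultimately show ?thesis by (simp only:) (simp add: algebra_simps power2_eq_square)
  qed
  finally have ode: "fps_deriv (fps_deriv f) = 6 * f\<^sup>2 + fps_const (-2) * f + fps_const (1/8)" .
  have f0: "fps_nth f 0 = 0" "fps_nth f 1 = 0" "fps_nth f 2 = 1 / 16"
    by (simp_all add: f_def power2_eq_square fps_mult_nth half_tanh_nth_0 numeral_2_eq_2 K1[simplified])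
  \<comment> \<open>K' and f differ by the constant 1/4 only, so their coefficients agree for k >=
    1, and the Hankel matrix starts at k = 1.\<close>
  have "fact (2 * k) * fps_nth f (2 * k) = -2 * a_coeff k" if "k \<ge> 1" for k
    using that a_coeff_eq_half_tanh[of k] unfolding dK by simp
  then have "fact (2 * (i + j + 1)) * fps_nth f (2 * (i + j + 1)) = -2 * a_coeff (i + j + 1)" for i j
    by (meson le_add2)
  then have "mat n n (\<lambda>(i, j). fact (2 * (i + j + 1)) * fps_nth f (2 * (i + j + 1))) = mat n n (\<lambda>(i, j). -2 * a_coeff (i + j + 1))"
    by (simp only:)
  moreover have "mat n n (\<lambda>(i, j). -2 * a_coeff (i + j + 1)) = -2 \<cdot>\<^sub>m mat n n (\<lambda>(i, j). a_coeff (i + j + 1))"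
    by (intro eq_matI) auto
  ultimately show ?thesis
    using hankel_det_quadratic_ode[OF f0(1,2) ode, of n] f0(3) by simp
qed

section \<open>Convolutions of Lambert coefficients\<close>

lemma fps_conv_radius_XD_funpow:
  fixes F :: "'a::{banach, real_normed_field} fps"
  shows "fps_conv_radius F \<le> fps_conv_radius ((fps_XD ^^ k) F)"
proof -
  have step: "fps_conv_radius G \<le> fps_conv_radius (fps_XD G)" for G :: "'a fps"
  proof -
    have "fps_conv_radius G \<le> fps_conv_radius (fps_deriv G)"
      by (rule fps_conv_radius_deriv)
    also have "\<dots> \<le> fps_conv_radius (fps_X * fps_deriv G)"
      using fps_conv_radius_mult[of fps_X "fps_deriv G"] by simp
    finally show ?thesis by (simp add: fps_XD_def)
  qed
  show ?thesis
    by (induction k) (auto intro: order_trans[OF _ step])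
qed

lemma summable_power_times_geometric:
  fixes r :: real
  assumes "0 \<le> r" "r < 1"
  shows "summable (\<lambda>n. real n ^ k * r ^ n)"
proof -
  let ?G = "Abs_fps (\<lambda>_. 1 :: real)"
  have "1 \<le> fps_conv_radius ?G"
    unfolding fps_conv_radius_def
    by (rule conv_radius_geI_ex') (auto simp: one_ereal_def)
  then have "1 \<le> fps_conv_radius ((fps_XD ^^ k) ?G)"
    using fps_conv_radius_XD_funpow order_trans by blast
  moreover have "ereal (norm r) < 1"
    using assms by (simp add: one_ereal_def)
  ultimately have "ereal (norm r) < fps_conv_radius ((fps_XD ^^ k) ?G)"
    by order
  then show ?thesis
    using summable_fps[of r "(fps_XD ^^ k) ?G"] by (simp add: fps_mult_fps_XD_shift)
qed

lemma abs_summable_on_nat_iff: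
  fixes f :: "nat \<Rightarrow> complex"
  shows "f abs_summable_on UNIV \<longleftrightarrow> summable (\<lambda>n. norm (f n))"
  using norm_summable_imp_summable_on[of "\<lambda>n. norm (f n)"] summable_on_imp_summable[of "\<lambda>n. norm (f n)"] by auto

lemma abs_summable_on_int_iff:
  fixes f :: "int \<Rightarrow> complex"
  shows "f abs_summable_on UNIV \<longleftrightarrow> summable (\<lambda>n. norm (f (int n))) \<and> summable (\<lambda>n. norm (f (- int n)))"
proof -
  have 1: "f abs_summable_on {0..} \<longleftrightarrow> (\<lambda>n. f (int n)) abs_summable_on UNIV"
    by (rule summable_on_reindex_bij_witness[of _ int nat]) auto
  have 2: "f abs_summable_on {..0} \<longleftrightarrow> (\<lambda>n. f (- int n)) abs_summable_on UNIV"
    by (rule summable_on_reindex_bij_witness[of _ "\<lambda>n. - int n" "\<lambda>a. nat (- a)"]) auto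
  have "f abs_summable_on UNIV \<longleftrightarrow> f abs_summable_on {0..} \<and> f abs_summable_on {..0}"
  proof safe
    assume "f abs_summable_on {0..}" and h: "f abs_summable_on {..0}"
    moreover have "f abs_summable_on {..<0}"
      using h by (rule summable_on_subset_banach) auto
    ultimately have "f abs_summable_on ({0..} \<union> {..<0})"
      by (intro summable_on_Un_disjoint) auto
    also have "{0..} \<union> {..<0} = (UNIV :: int set)" by auto
    finally show "f abs_summable_on UNIV" .
  qed (auto intro: summable_on_subset_banach)
  then show ?thesis unfolding 1 2 abs_summable_on_nat_iff .
qed

text \<open>Both halves are written over all naturals with value 0 at n = 0, ready to be compared
  with power series without constant term.\<close>

lemma infsum_int_split:
  fixes f :: "int \<Rightarrow> complex"
  assumes "f abs_summable_on UNIV"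
  shows "infsum f UNIV = f 0 + (\<Sum>n. if n = 0 then 0 else f (int n)) + (\<Sum>n. if n = 0 then 0 else f (- int n))"
proof -
  have sub: "f summable_on A" for A
    using abs_summable_summable[OF assms] by (rule summable_on_subset_banach) auto
  have suminf: "(\<Sum>n. if n = 0 then 0 else g n) = infsum g {1..}"
    if "(\<lambda>n. norm (g n)) summable_on UNIV" for g :: "nat \<Rightarrow> complex"
  proof -
    have "(\<lambda>n. if n = 0 then 0 else g n) abs_summable_on UNIV"
      using that by (rule Infinite_Sum.abs_summable_on_comparison_test) auto
    then have "(\<lambda>n. if n = 0 then 0 else g n) sums infsum (\<lambda>n. if n = 0 then 0 else g n) UNIV"
      by (intro has_sum_imp_sums has_sum_infsum) (rule abs_summable_summable)
    then have "(\<Sum>n. if n = 0 then 0 else g n) = infsum (\<lambda>n. if n = 0 then 0 else g n) UNIV"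
      by (rule sums_unique[symmetric])
    also have "\<dots> = infsum g {1..}"
      by (rule infsum_cong_neutral) auto
    finally show ?thesis .
  qed
  have "(UNIV :: int set) = insert 0 ({1..} \<union> {..-1})" by auto
  then have "infsum f UNIV = infsum f (insert 0 ({1..} \<union> {..-1}))"
    by (rule arg_cong)
  also have "\<dots> = f 0 + infsum f ({1..} \<union> {..-1})"
    by (rule infsum_insert) (use sub in auto)
  also have "infsum f ({1..} \<union> {..-1}) = infsum f {1..} + infsum f {..-1}"
    by (rule infsum_Un_disjoint) (use sub in auto)
  also have "infsum f {1..} = (\<Sum>\<^sub>\<infinity>n\<in>{1..}. f (int n))"
    by (rule infsum_reindex_bij_witness[of _ int nat]) auto
  also have "infsum f {..-1} = (\<Sum>\<^sub>\<infinity>n\<in>{1..}. f (- int n))"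
    by (rule infsum_reindex_bij_witness[of _ "\<lambda>n. - int n" "\<lambda>a. nat (- a)"]) auto
  finally show ?thesis
    using assms suminf[of "\<lambda>n. f (int n)"] suminf[of "\<lambda>n. f (- int n)"]
    by (simp add: abs_summable_on_int_iff abs_summable_on_nat_iff)
qed

lemma abs_summable_int_geometric_bound:
  fixes f :: "int \<Rightarrow> complex"
  assumes r: "0 \<le> r" "r < 1" and bound: "\<And>n. n > 0 \<Longrightarrow> norm (f (int n)) \<le> C * (real n ^ k * r ^ n)"
    "\<And>n. n > 0 \<Longrightarrow> norm (f (- int n)) \<le> C * (real n ^ k * r ^ n)"
  shows "f abs_summable_on UNIV"
proof -
  have s: "summable (\<lambda>n. C * (real n ^ k * r ^ n))"
    by (rule summable_mult) (rule summable_power_times_geometric[OF r])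
  show ?thesis
    unfolding abs_summable_on_int_iff
  proof
    show "summable (\<lambda>n. norm (f (int n)))"
      by (rule summable_comparison_test'[OF s, of 1]) (use bound in auto)
    show "summable (\<lambda>n. norm (f (- int n)))"
      by (rule summable_comparison_test'[OF s, of 1]) (use bound in auto)
  qed
qed

lemma abs_summable_Times:
  fixes u v :: "int \<Rightarrow> complex"
  assumes "u abs_summable_on UNIV" "v abs_summable_on UNIV"
  shows "(\<lambda>(a, b). u a * v b) abs_summable_on UNIV"
proof -
  have "(\<lambda>(a, b). u a * v b) abs_summable_on UNIV \<times> UNIV"
    using assms by (intro Infinite_Sum.abs_summable_on_Sigma_iff[THEN iffD2])
      (auto simp: norm_mult infsum_cmult_right' abs_mult infsum_nonneg intro!: summable_on_cmult_right summable_on_cmult_left)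
  then show ?thesis by simp
qed

text \<open>The Cauchy product, by Fubini after substituting (a + b, a) for (a, b).\<close>

lemma infsum_int_product:
  fixes u v :: "int \<Rightarrow> complex"
  assumes "u abs_summable_on UNIV" "v abs_summable_on UNIV"
  shows "((\<lambda>m. \<Sum>\<^sub>\<infinity>a. u a * v (m - a)) has_sum infsum u UNIV * infsum v UNIV) UNIV"
proof -
  let ?f = "\<lambda>(a, b). u a * v b"
  have sm: "?f summable_on UNIV \<times> UNIV"
    using abs_summable_summable[OF abs_summable_Times[OF assms]] by simp
  have "infsum ?f (UNIV \<times> UNIV) = (\<Sum>\<^sub>\<infinity>a. \<Sum>\<^sub>\<infinity>b. u a * v b)"
    using infsum_Sigma'_banach[OF sm] by simp
  also have "\<dots> = infsum u UNIV * infsum v UNIV"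
    by (simp add: infsum_cmult_left' infsum_cmult_right')
  finally have "(?f has_sum infsum u UNIV * infsum v UNIV) (UNIV \<times> UNIV)"
    using has_sum_infsum[OF sm] by simp
  also have "?this \<longleftrightarrow> ((\<lambda>(m, a). u a * v (m - a)) has_sum infsum u UNIV * infsum v UNIV) (UNIV \<times> UNIV)"
    by (rule has_sum_reindex_bij_witness[of _ "\<lambda>(m, a). (a, m - a)" "\<lambda>(a, b). (a + b, a)"]) auto
  finally have hs: "((\<lambda>(m, a). u a * v (m - a)) has_sum infsum u UNIV * infsum v UNIV) (UNIV \<times> UNIV)" .
  have "(\<lambda>a. u a * v (m - a)) summable_on UNIV" for m
    using summable_on_SigmaD1[OF has_sum_imp_summable[OF hs], of m] by simp
  then show ?thesis
    using has_sum_SigmaD[OF hs, of "\<lambda>m. \<Sum>\<^sub>\<infinity>a. u a * v (m - a)"] by simp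
qed

definition pos_ind :: "int \<Rightarrow> complex" where
  "pos_ind a = (if a > 0 then 1 else 0)"

text \<open>The difference of the two step functions is the indicator of 0 < a <= m, and for
  negative m minus the indicator of m < a <= 0. The recursion for T, used in both directions, yields
  polynomial sums with the right sign for every integer m. These steps are the limits of the
  coefficients 1/(1 + q^a) and 1/(1 - q^a) at both ends.\<close>

lemma has_sum_pos_ind_diff:
  fixes w T :: "int \<Rightarrow> complex"
  assumes T0: "T 0 = 0" and T: "\<And>m. T (m + 1) = T m + w (m + 1)"
  shows "((\<lambda>a. w a * (pos_ind a - pos_ind (a - m))) has_sum T m) UNIV"
proof (induction m rule: int_induct[where k = 0])
  case base
  show ?case by (simp add: T0)
next
  case (step1 i)
  have "((\<lambda>a. if a = i + 1 then w a else 0) has_sum w (i + 1)) {i + 1}"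
    by (rule has_sum_finiteI) auto
  then have "((\<lambda>a. if a = i + 1 then w a else 0) has_sum w (i + 1)) UNIV"
    by (rule has_sum_cong_neutral[THEN iffD1, rotated -1]) auto
  from has_sum_add[OF step1(2) this] show ?case
    unfolding T by (rule has_sum_cong[THEN iffD1, rotated]) (auto simp: pos_ind_def algebra_simps)
next
  case (step2 i)
  have "((\<lambda>a. if a = i then - w a else 0) has_sum - w i) {i}"
    by (rule has_sum_finiteI) auto
  then have "((\<lambda>a. if a = i then - w a else 0) has_sum - w i) UNIV"
    by (rule has_sum_cong_neutral[THEN iffD1, rotated -1]) auto
  from has_sum_add[OF step2(2) this] T[of "i - 1"] show ?case
    by (auto elim!: has_sum_cong[THEN iffD1, rotated] simp: pos_ind_def algebra_simps)
qed

lemma has_sum_diff: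
  fixes f g :: "'a \<Rightarrow> complex"
  assumes "(f has_sum s) A" "(g has_sum t) A"
  shows "((\<lambda>x. f x - g x) has_sum (s - t)) A"
  using has_sum_add[OF assms(1) has_sum_uminusI[OF assms(2)]] by simp

lemma has_sum_shift_int:
  fixes f :: "int \<Rightarrow> complex"
  shows "((\<lambda>a. f (a - m)) has_sum s) UNIV \<longleftrightarrow> (f has_sum s) UNIV"
  by (rule has_sum_reindex_bij_witness[of _ "\<lambda>a. a + m" "\<lambda>a. a - m"]) auto

text \<open>A locale, because the results are also applied to -q and to q^2.\<close>

locale nome =
  fixes q :: complex
  assumes q0: "q \<noteq> 0" and q1: "norm q < 1"
begin

lemma norm_one_plus_power: "n > 0 \<Longrightarrow> 1 - norm q \<le> norm (1 + q ^ n)"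
  and norm_one_minus_power: "n > 0 \<Longrightarrow> 1 - norm q \<le> norm (1 - q ^ n)"
proof -
  assume "n > 0"
  then have "norm (q ^ n) \<le> norm q"
    using q1 by (cases n) (auto simp: norm_power norm_mult power_le_one mult_left_le)
  then show "1 - norm q \<le> norm (1 + q ^ n)" "1 - norm q \<le> norm (1 - q ^ n)"
    using norm_triangle_ineq2[of 1 "- (q ^ n)"] norm_triangle_ineq2[of 1 "q ^ n"] by auto
qed

lemma power_ne: "n > 0 \<Longrightarrow> 1 + q ^ n \<noteq> 0" "n > 0 \<Longrightarrow> 1 - q ^ n \<noteq> 0"
  using norm_one_plus_power[of n] norm_one_minus_power[of n] q1 by auto

lemma powi_ne: "1 + q powi a \<noteq> 0" "a \<noteq> 0 \<Longrightarrow> 1 - q powi a \<noteq> 0"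
proof -
  have pos: "1 + q powi a \<noteq> 0 \<and> 1 - q powi a \<noteq> 0" if "a > 0" for a
    using power_ne[of "nat a"] that by (simp add: power_int_def)
  have neg: "1 + q powi a \<noteq> 0 \<and> 1 - q powi a \<noteq> 0" if "a < 0" for a
    using pos[of "- a"] that q0 by (auto simp: power_int_minus field_simps)
  show "1 + q powi a \<noteq> 0" "a \<noteq> 0 \<Longrightarrow> 1 - q powi a \<noteq> 0"
    using pos[of a] neg[of a] by (cases a "0 :: int" rule: linorder_cases; simp)+
qed

text \<open>The inverse at \<open>0\<close> makes \<open>gm 0 = 0\<close>, so that the excluded index \<open>m = 0\<close> needs no special treatment.\<close>

definition gp :: "int \<Rightarrow> complex" where "gp a = inverse (1 + q powi a)"
definition gm :: "int \<Rightarrow> complex" where "gm a = inverse (1 - q powi a)"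

lemma gp_nat: "gp (int n) = inverse (1 + q ^ n)" "gp (- int n) = q ^ n * inverse (1 + q ^ n)"
proof -
  show "gp (int n) = inverse (1 + q ^ n)" by (simp add: gp_def)
  have "1 + inverse (q ^ n) = (1 + q ^ n) * inverse (q ^ n)" using q0 by (simp add: field_simps)
  then show "gp (- int n) = q ^ n * inverse (1 + q ^ n)"
    by (simp add: gp_def power_int_minus)
qed

lemma gm_nat: "gm (int n) = inverse (1 - q ^ n)" "gm (- int n) = - (q ^ n * inverse (1 - q ^ n))"
proof -
  show "gm (int n) = inverse (1 - q ^ n)" by (simp add: gm_def)
  have "1 - inverse (q ^ n) = - ((1 - q ^ n) * inverse (q ^ n))" using q0 by (simp add: field_simps)
  then have "inverse (1 - inverse (q ^ n)) = - (inverse (1 - q ^ n) * q ^ n)"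
    by (simp only: inverse_minus_eq inverse_mult_distrib inverse_inverse_eq)
  then show "gm (- int n) = - (q ^ n * inverse (1 - q ^ n))"
    by (simp add: gm_def power_int_minus mult.commute)
qed

text \<open>With X = q^a and Y = q^(m-a), this is a partial fraction decomposition whose denominator
  1 - XY = 1 - q^m does not depend on a.\<close>

lemma gp_mult: "m \<noteq> 0 \<Longrightarrow> gp a * gp (m - a) = gm m * (gp a - gp (a - m))"
proof -
  assume m: "m \<noteq> 0"
  define X where "X = q powi a"
  define Y where "Y = q powi (m - a)"
  have XY: "q powi m = X * Y" "q powi (a - m) = inverse Y" "Y \<noteq> 0"
    using q0 power_int_minus[of q "m - a"] by (auto simp: X_def Y_def simp flip: power_int_add)
  have ne: "1 + X \<noteq> 0" "1 + Y \<noteq> 0" "1 - X * Y \<noteq> 0"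
    using powi_ne(1)[of a] powi_ne(1)[of "m - a"] powi_ne(2)[OF m] by (auto simp: X_def Y_def XY(1)[unfolded X_def Y_def])
  have "inverse (1 + inverse Y) = Y * inverse (1 + Y)"
    using XY(3) ne(2) by (simp add: field_simps)
  then have "gp a - gp (a - m) = inverse (1 + X) - Y * inverse (1 + Y)"
    by (simp only: gp_def XY(2) X_def)
  also have "\<dots> = (1 - X * Y) * (inverse (1 + X) * inverse (1 + Y))"
    using ne(1,2) by (simp add: divide_simps) (simp add: algebra_simps)
  finally have "gp a - gp (a - m) = (1 - X * Y) * (inverse (1 + X) * inverse (1 + Y))" .
  then show ?thesis
    using ne(3) unfolding gm_def XY(1) by (simp add: gp_def X_def Y_def)
qed

lemma gm_mult: "m \<noteq> 0 \<Longrightarrow> a \<noteq> 0 \<Longrightarrow> a \<noteq> m \<Longrightarrow> gm a * gm (m - a) = gm m * (gm a - gm (a - m))"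
proof -
  assume m: "m \<noteq> 0" "a \<noteq> 0" "a \<noteq> m"
  define X where "X = q powi a"
  define Y where "Y = q powi (m - a)"
  have XY: "q powi m = X * Y" "q powi (a - m) = inverse Y" "Y \<noteq> 0"
    using q0 power_int_minus[of q "m - a"] by (auto simp: X_def Y_def simp flip: power_int_add)
  have ne: "1 - X \<noteq> 0" "1 - Y \<noteq> 0" "1 - X * Y \<noteq> 0"
    using powi_ne(2)[of a] powi_ne(2)[of "m - a"] powi_ne(2)[OF m(1)] m by (auto simp: X_def Y_def XY(1)[unfolded X_def Y_def])
  have "inverse (1 - inverse Y) = - Y * inverse (1 - Y)"
    using XY(3) ne(2) by (simp add: field_simps)
  then have "gm a - gm (a - m) = inverse (1 - X) + Y * inverse (1 - Y)"
    by (simp add: gm_def XY(2) X_def)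
  also have "\<dots> = (1 - X * Y) * (inverse (1 - X) * inverse (1 - Y))"
    using ne(1,2) by (simp add: divide_simps) (simp add: algebra_simps)
  finally have "gm a - gm (a - m) = (1 - X * Y) * (inverse (1 - X) * inverse (1 - Y))" .
  then show ?thesis
    using ne(3) by (simp add: gm_def XY(1) X_def Y_def)
qed

lemma norm_gp_diff: "n > 0 \<Longrightarrow> norm (gp (int n) - 1) \<le> inverse (1 - norm q) * norm q ^ n"
    "n > 0 \<Longrightarrow> norm (gp (- int n)) \<le> inverse (1 - norm q) * norm q ^ n"
    "n > 0 \<Longrightarrow> norm (gp (int n)) \<le> inverse (1 - norm q)"
proof -
  assume n: "n > 0"
  have le: "norm (inverse (1 + q ^ n)) \<le> inverse (1 - norm q)"
    using norm_one_plus_power[OF n] q1 by (simp add: norm_inverse le_imp_inverse_le)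
  have "gp (int n) - 1 = - (q ^ n * inverse (1 + q ^ n))"
    using power_ne(1)[OF n] by (simp add: gp_nat field_simps)
  then show "norm (gp (int n) - 1) \<le> inverse (1 - norm q) * norm q ^ n"
    using mult_left_mono[OF le, of "norm q ^ n"] by (simp add: norm_mult norm_power mult.commute)
  show "norm (gp (- int n)) \<le> inverse (1 - norm q) * norm q ^ n"
    using mult_left_mono[OF le, of "norm q ^ n"] by (simp add: gp_nat norm_mult norm_power mult.commute)
  show "norm (gp (int n)) \<le> inverse (1 - norm q)"
    using le by (simp add: gp_nat)
qed

lemma norm_gm_diff: "n > 0 \<Longrightarrow> norm (gm (int n) - 1) \<le> inverse (1 - norm q) * norm q ^ n"
    "n > 0 \<Longrightarrow> norm (gm (- int n)) \<le> inverse (1 - norm q) * norm q ^ n"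
    "n > 0 \<Longrightarrow> norm (gm (int n)) \<le> inverse (1 - norm q)"
proof -
  assume n: "n > 0"
  have le: "norm (inverse (1 - q ^ n)) \<le> inverse (1 - norm q)"
    using norm_one_minus_power[OF n] q1 by (simp add: norm_inverse le_imp_inverse_le)
  have "gm (int n) - 1 = q ^ n * inverse (1 - q ^ n)"
    using power_ne(2)[OF n] by (simp add: gm_nat field_simps)
  then show "norm (gm (int n) - 1) \<le> inverse (1 - norm q) * norm q ^ n"
    using mult_left_mono[OF le, of "norm q ^ n"] by (simp add: norm_mult norm_power mult.commute)
  show "norm (gm (- int n)) \<le> inverse (1 - norm q) * norm q ^ n"
    using mult_left_mono[OF le, of "norm q ^ n"] by (simp add: gm_nat norm_mult norm_power mult.commute)
  show "norm (gm (int n)) \<le> inverse (1 - norm q)"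
    using le by (simp add: gm_nat)
qed

text \<open>Positive indices need |x| < 1 and negative ones |q| < |x|; the larger of |x| and |q|/|x|
  bounds both tails.\<close>

lemma abs_summable_annulus:
  fixes c :: "int \<Rightarrow> complex"
  assumes x: "norm q < norm x" "norm x < 1"
    and c: "\<And>n. n > 0 \<Longrightarrow> norm (c (int n)) \<le> C" "\<And>n. n > 0 \<Longrightarrow> norm (c (- int n)) \<le> C * norm q ^ n"
  shows "(\<lambda>a. of_int a ^ k * x powi a * c a) abs_summable_on UNIV"
proof (rule abs_summable_int_geometric_bound)
  have x0: "norm x > 0" using x(1) le_less_trans[OF norm_ge_zero] by blast
  define r where "r = max (norm x) (norm q / norm x)"
  show r0: "0 \<le> r" and "r < 1"
    using x x0 by (auto simp: r_def le_max_iff_disj)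
  fix n :: nat assume n: "n > 0"
  have C: "C \<ge> 0" using c(1)[OF n] norm_ge_zero order_trans by blast
  have "norm x ^ n \<le> r ^ n" by (intro power_mono) (auto simp: r_def)
  then have "norm x ^ n * norm (c (int n)) \<le> r ^ n * C"
    using c(1)[OF n] r0 by (intro mult_mono) auto
  then have "real n ^ k * (norm x ^ n * norm (c (int n))) \<le> real n ^ k * (r ^ n * C)"
    by (intro mult_left_mono) auto
  then show "norm (of_int (int n) ^ k * x powi int n * c (int n)) \<le> C * (real n ^ k * r ^ n)"
    by (simp add: norm_mult norm_power mult_ac)
  have "(norm q / norm x) ^ n \<le> r ^ n" using x0 by (intro power_mono) (auto simp: r_def)
  then have "C * (norm q / norm x) ^ n \<le> C * r ^ n"
    using C by (intro mult_left_mono)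
  moreover have "norm (x powi (- int n) * c (- int n)) \<le> C * (norm q / norm x) ^ n"
    using mult_left_mono[OF c(2)[OF n], of "inverse (norm x ^ n)"]
    by (simp add: norm_mult norm_divide norm_power norm_inverse power_int_minus power_divide field_simps)
  ultimately have "real n ^ k * norm (x powi (- int n) * c (- int n)) \<le> real n ^ k * (C * r ^ n)"
    by (intro mult_left_mono) auto
  then show "norm (of_int (- int n) ^ k * x powi (- int n) * c (- int n)) \<le> C * (real n ^ k * r ^ n)"
    by (simp add: norm_mult norm_power mult_ac)
qed

lemma abs_summable_gp: "norm q < norm x \<Longrightarrow> norm x < 1 \<Longrightarrow> (\<lambda>a. of_int a ^ k * x powi a * gp a) abs_summable_on UNIV"
  and abs_summable_gm: "norm q < norm x \<Longrightarrow> norm x < 1 \<Longrightarrow> (\<lambda>a. of_int a ^ k * x powi a * gm a) abs_summable_on UNIV"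
  by (erule (1) abs_summable_annulus, rule norm_gp_diff(3) norm_gm_diff(3), assumption, rule norm_gp_diff(2) norm_gm_diff(2), assumption)+

section \<open>The two Laurent series and their squares\<close>

definition phi_sum :: "complex \<Rightarrow> complex" where
  "phi_sum x = (\<Sum>\<^sub>\<infinity>a. x powi a * gp a)"

text \<open>For k = 1 the Weierstrass function up to normalization; raising k by one applies x
  d/dx.\<close>

definition wp_sum :: "nat \<Rightarrow> complex \<Rightarrow> complex" where
  "wp_sum k x = (\<Sum>\<^sub>\<infinity>a. of_int a ^ k * x powi a * gm a)"

lemma summable_tail:
  "(\<lambda>a. gp a - pos_ind a) summable_on UNIV" "(\<lambda>a. of_int a ^ Suc k * (gm a - pos_ind a)) summable_on UNIV"
proof -
  have "(\<lambda>a. gp a - pos_ind a) abs_summable_on UNIV"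
    by (rule abs_summable_int_geometric_bound[of "norm q" _ "inverse (1 - norm q)" 0])
       (use q1 norm_gp_diff in \<open>auto simp: pos_ind_def\<close>)
  then show "(\<lambda>a. gp a - pos_ind a) summable_on UNIV" by (rule abs_summable_summable)
  have "(\<lambda>a. of_int a ^ Suc k * (gm a - pos_ind a)) abs_summable_on UNIV"
  proof (rule abs_summable_int_geometric_bound[of "norm q" _ "inverse (1 - norm q)" "Suc k"])
    fix n :: nat assume n: "n > 0"
    show "norm (of_int (int n) ^ Suc k * (gm (int n) - pos_ind (int n))) \<le> inverse (1 - norm q) * (real n ^ Suc k * norm q ^ n)"
      using mult_left_mono[OF norm_gm_diff(1)[OF n], of "real n ^ Suc k"] n
      by (simp add: pos_ind_def norm_mult norm_power mult_ac)
    show "norm (of_int (- int n) ^ Suc k * (gm (- int n) - pos_ind (- int n))) \<le> inverse (1 - norm q) * (real n ^ Suc k * norm q ^ n)"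
      using mult_left_mono[OF norm_gm_diff(2)[OF n], of "real n ^ Suc k"] n
      by (simp add: pos_ind_def norm_mult norm_power mult_ac)
  qed (use q1 in auto)
  then show "(\<lambda>a. of_int a ^ Suc k * (gm a - pos_ind a)) summable_on UNIV" by (rule abs_summable_summable)
qed

text \<open>After partial fractions the summand is a difference of two shifts of one function. The
  summable part \<open>gp - pos_ind\<close> cancels against its shift, and the step functions leave
  the signed count m.\<close>

lemma gp_convolution:
  assumes "m \<noteq> 0"
  shows "(\<Sum>\<^sub>\<infinity>a. gp a * gp (m - a)) = of_int m * gm m"
proof -
  obtain s where s: "((\<lambda>a. gp a - pos_ind a) has_sum s) UNIV"
    using summable_tail(1) by (auto simp: summable_on_def)
  have "((\<lambda>a. 1 * (pos_ind a - pos_ind (a - m))) has_sum of_int m) UNIV"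
    by (rule has_sum_pos_ind_diff) auto
  from has_sum_add[OF this has_sum_diff[OF s has_sum_shift_int[of _ m, THEN iffD2, OF s]]]
  have "((\<lambda>a. gp a - gp (a - m)) has_sum of_int m) UNIV"
    by (simp add: algebra_simps)
  from has_sum_cmult_right[OF this, of "gm m"]
  have "((\<lambda>a. gp a * gp (m - a)) has_sum gm m * of_int m) UNIV"
    by (simp add: gp_mult[OF assms])
  then show ?thesis by (simp add: infsumI mult.commute)
qed

definition gm_moment :: complex where
  "gm_moment = (\<Sum>\<^sub>\<infinity>a. of_int a * (gm a - pos_ind a))"

text \<open>The weight a (m - a) is not invariant under the shift: a (m - a) + a (a + m) = 2am, so
  the tails leave 2m times \<open>gm_moment\<close> while their second moments cancel. The step
  functions contribute the sum of a (m - a) over 0 < a <= m, which is (m^3 - m) / 6.\<close>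

lemma gm_convolution:
  assumes m: "m \<noteq> 0"
  shows "(\<Sum>\<^sub>\<infinity>a. (of_int a * gm a) * (of_int (m - a) * gm (m - a)))
    = (of_int m ^ 3 / 6 + (2 * gm_moment - 1 / 6) * of_int m) * gm m"
proof -
  let ?L = "\<lambda>a. gm a - pos_ind a"
  have s1: "((\<lambda>a. of_int a * ?L a) has_sum gm_moment) UNIV"
    using summable_tail(2)[of 0] by (simp add: gm_moment_def)
  obtain s where s2: "((\<lambda>a. of_int a ^ 2 * ?L a) has_sum s) UNIV"
    using summable_tail(2)[of 1] by (auto simp: summable_on_def numeral_2_eq_2)
  have p1: "((\<lambda>a. of_int a * (pos_ind a - pos_ind (a - m))) has_sum (of_int m * (of_int m + 1) / 2)) UNIV"
    by (rule has_sum_pos_ind_diff) (auto simp: field_simps)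
  have p2: "((\<lambda>a. of_int a ^ 2 * (pos_ind a - pos_ind (a - m))) has_sum (of_int m * (of_int m + 1) * (2 * of_int m + 1) / 6)) UNIV"
    by (rule has_sum_pos_ind_diff) (auto simp: field_simps power2_eq_square)
  have A: "((\<lambda>a. of_int a * of_int (m - a) * (pos_ind a - pos_ind (a - m))) has_sum
      (of_int m * (of_int m * (of_int m + 1) / 2) - of_int m * (of_int m + 1) * (2 * of_int m + 1) / 6)) UNIV"
    using has_sum_diff[OF has_sum_cmult_right[OF p1, of "of_int m"] p2]
    by (rule has_sum_cong[THEN iffD1, rotated]) (simp add: algebra_simps power2_eq_square)
  have B: "((\<lambda>a. of_int a * of_int (m - a) * ?L a) has_sum (of_int m * gm_moment - s)) UNIV"
    using has_sum_diff[OF has_sum_cmult_right[OF s1, of "of_int m"] s2]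
    by (rule has_sum_cong[THEN iffD1, rotated]) (simp add: algebra_simps power2_eq_square)
  have C0: "((\<lambda>a. of_int (a + m) * of_int (- a) * ?L a) has_sum (- of_int m * gm_moment - s)) UNIV"
    using has_sum_diff[OF has_sum_cmult_right[OF s1, of "- of_int m"] s2]
    by (rule has_sum_cong[THEN iffD1, rotated]) (simp add: algebra_simps power2_eq_square)
  from has_sum_shift_int[of "\<lambda>a. of_int (a + m) * of_int (- a) * ?L a" m, THEN iffD2, OF C0]
  have C: "((\<lambda>a. of_int a * of_int (m - a) * ?L (a - m)) has_sum (- of_int m * gm_moment - s)) UNIV"
    by simp
  have "((\<lambda>a. of_int a * of_int (m - a) * (gm a - gm (a - m))) has_sum
      ((of_int m * (of_int m * (of_int m + 1) / 2) - of_int m * (of_int m + 1) * (2 * of_int m + 1) / 6)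
        + ((of_int m * gm_moment - s) - (- of_int m * gm_moment - s)))) UNIV"
    using has_sum_add[OF A has_sum_diff[OF B C]]
    by (rule has_sum_cong[THEN iffD1, rotated]) (simp add: algebra_simps)
  moreover have "(of_int m * (of_int m * (of_int m + 1) / 2) - of_int m * (of_int m + 1) * (2 * of_int m + 1) / 6)
        + ((of_int m * gm_moment - s) - (- of_int m * gm_moment - s)) = of_int m ^ 3 / 6 + (2 * gm_moment - 1 / 6) * of_int m"
    by (simp add: field_simps power3_eq_cube)
  ultimately have "((\<lambda>a. of_int a * of_int (m - a) * (gm a - gm (a - m))) has_sum
      (of_int m ^ 3 / 6 + (2 * gm_moment - 1 / 6) * of_int m)) UNIV"
    by (simp only:)
  from has_sum_cmult_right[OF this, of "gm m"]
  have "((\<lambda>a. gm m * (of_int a * of_int (m - a) * (gm a - gm (a - m)))) has_sum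
      (of_int m ^ 3 / 6 + (2 * gm_moment - 1 / 6) * of_int m) * gm m) UNIV"
    by (simp only: mult.commute[of "gm m"])
  moreover have "gm m * (of_int a * of_int (m - a) * (gm a - gm (a - m))) = (of_int a * gm a) * (of_int (m - a) * gm (m - a))" for a
  proof (cases "a = 0 \<or> a = m")
    case False
    then show ?thesis using gm_mult[OF m, of a] by (simp add: mult_ac)
  qed auto
  ultimately have "((\<lambda>a. (of_int a * gm a) * (of_int (m - a) * gm (m - a))) has_sum
      (of_int m ^ 3 / 6 + (2 * gm_moment - 1 / 6) * of_int m) * gm m) UNIV"
    by (simp only:)
  then show ?thesis by (rule infsumI)
qed

lemma has_sum_split_0:
  fixes f :: "int \<Rightarrow> complex"
  assumes "(f has_sum s) UNIV"
  shows "((\<lambda>m. if m = 0 then 0 else f m) has_sum (s - f 0)) UNIV"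
proof -
  have "((\<lambda>m. if m = 0 then f m else 0) has_sum f 0) {0}"
    by (rule has_sum_finiteI) auto
  then have "((\<lambda>m. if m = 0 then f m else 0) has_sum f 0) UNIV"
    by (rule has_sum_cong_neutral[THEN iffD1, rotated -1]) auto
  from has_sum_diff[OF assms this] show ?thesis
    by (rule has_sum_cong[THEN iffD1, rotated]) auto
qed

text \<open>The convolution formula covers every coefficient of the square except that of x^0, which
  is the constant E, the same for all x.\<close>

theorem phi_sum_square:
  "\<exists>E. \<forall>x. norm q < norm x \<longrightarrow> norm x < 1 \<longrightarrow> (phi_sum x)\<^sup>2 = wp_sum 1 x + E"
proof (intro exI allI impI)
  fix x :: complex assume x: "norm q < norm x" "norm x < 1"
  have x0: "x \<noteq> 0" using x(1) by auto
  let ?u = "\<lambda>a. x powi a * gp a"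
  have u: "?u abs_summable_on UNIV" using abs_summable_gp[OF x, of 0] by simp
  have prod_eq: "?u a * ?u (m - a) = x powi m * (gp a * gp (m - a))" for a m
    using x0 power_int_add[of x a "m - a"] by (simp add: mult_ac)
  have h1: "((\<lambda>m. x powi m * (\<Sum>\<^sub>\<infinity>a. gp a * gp (m - a))) has_sum (phi_sum x)\<^sup>2) UNIV"
    using infsum_int_product[OF u u] unfolding prod_eq infsum_cmult_right' by (simp add: phi_sum_def power2_eq_square)
  have h2: "(if m = 0 then 0 else x powi m * (\<Sum>\<^sub>\<infinity>a. gp a * gp (m - a))) = of_int m ^ 1 * x powi m * gm m" for m
    by (auto simp: gp_convolution)
  have "((\<lambda>m. of_int m ^ 1 * x powi m * gm m) has_sum ((phi_sum x)\<^sup>2 - (\<Sum>\<^sub>\<infinity>a. gp a * gp (- a)))) UNIV"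
    using has_sum_split_0[OF h1] unfolding h2 by simp
  then have "wp_sum 1 x = (phi_sum x)\<^sup>2 - (\<Sum>\<^sub>\<infinity>a. gp a * gp (- a))"
    unfolding wp_sum_def by (rule infsumI)
  then show "(phi_sum x)\<^sup>2 = wp_sum 1 x + (\<Sum>\<^sub>\<infinity>a. gp a * gp (- a))" by simp
qed

text \<open>The cubic and the linear part of the convolution become \<open>wp_sum 3\<close> and
  \<open>wp_sum 1\<close>; the coefficient of x^0 is again left over as a constant.\<close>

theorem wp_sum_square:
  "\<exists>\<beta> \<gamma>. \<forall>x. norm q < norm x \<longrightarrow> norm x < 1 \<longrightarrow> (wp_sum 1 x)\<^sup>2 = wp_sum 3 x / 6 + \<beta> * wp_sum 1 x + \<gamma>"
proof (intro exI allI impI)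
  fix x :: complex assume x: "norm q < norm x" "norm x < 1"
  have x0: "x \<noteq> 0" using x(1) by auto
  let ?u = "\<lambda>a. of_int a ^ 1 * x powi a * gm a"
  let ?\<gamma> = "\<Sum>\<^sub>\<infinity>a. (of_int a * gm a) * (of_int (- a) * gm (- a))"
  have u: "?u abs_summable_on UNIV" by (rule abs_summable_gm[OF x])
  have prod_eq: "?u a * ?u (m - a) = x powi m * ((of_int a * gm a) * (of_int (m - a) * gm (m - a)))" for a m
    using x0 power_int_add[of x a "m - a"] by (simp add: mult_ac)
  have h1: "((\<lambda>m. x powi m * (\<Sum>\<^sub>\<infinity>a. (of_int a * gm a) * (of_int (m - a) * gm (m - a)))) has_sum (wp_sum 1 x)\<^sup>2) UNIV"
    using infsum_int_product[OF u u] unfolding prod_eq infsum_cmult_right' by (simp add: wp_sum_def power2_eq_square)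
  have h2: "(if m = 0 then 0 else x powi m * (\<Sum>\<^sub>\<infinity>a. (of_int a * gm a) * (of_int (m - a) * gm (m - a))))
      = (1 / 6) * (of_int m ^ 3 * x powi m * gm m) + (2 * gm_moment - 1 / 6) * (of_int m ^ 1 * x powi m * gm m)" for m
  proof (cases "m = 0")
    case False
    then show ?thesis unfolding gm_convolution[OF False] by (simp add: algebra_simps)
  qed simp
  have "((\<lambda>m. (1 / 6) * (of_int m ^ 3 * x powi m * gm m) + (2 * gm_moment - 1 / 6) * (of_int m ^ 1 * x powi m * gm m))
      has_sum ((wp_sum 1 x)\<^sup>2 - ?\<gamma>)) UNIV"
    using has_sum_split_0[OF h1] unfolding h2 by simp
  moreover have "((\<lambda>m. (1 / 6) * (of_int m ^ 3 * x powi m * gm m) + (2 * gm_moment - 1 / 6) * (of_int m ^ 1 * x powi m * gm m))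
      has_sum ((1 / 6) * wp_sum 3 x + (2 * gm_moment - 1 / 6) * wp_sum 1 x)) UNIV"
    unfolding wp_sum_def
    by (intro has_sum_add has_sum_cmult_right has_sum_infsum abs_summable_summable[OF abs_summable_gm[OF x]])
  ultimately have "(wp_sum 1 x)\<^sup>2 - ?\<gamma> = (1 / 6) * wp_sum 3 x + (2 * gm_moment - 1 / 6) * wp_sum 1 x"
    by (rule has_sum_unique)
  then show "(wp_sum 1 x)\<^sup>2 = wp_sum 3 x / 6 + (2 * gm_moment - 1 / 6) * wp_sum 1 x + ?\<gamma>"
    by (simp add: algebra_simps)
qed

end

section \<open>Analytic continuation in the exponential variable\<close>

lemma fps_conv_radius_geI_bound:
  fixes F :: "complex fps"
  assumes s: "s > 0" and bound: "\<And>n. norm (fps_nth F n) \<le> C * (real n ^ k * s ^ n)"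
  shows "ereal (1 / s) \<le> fps_conv_radius F"
  unfolding fps_conv_radius_def
proof (rule conv_radius_geI_ex')
  fix r :: real assume r: "0 < r" "ereal r < ereal (1 / s)"
  have "summable (\<lambda>n. C * (real n ^ k * (s * r) ^ n))"
    by (intro summable_mult summable_power_times_geometric) (use r s in \<open>auto simp: field_simps\<close>)
  then show "summable (\<lambda>n. fps_nth F n * of_real r ^ n)"
  proof (rule summable_comparison_test'[of _ 0])
    fix n :: nat
    have "norm (fps_nth F n) * r ^ n \<le> C * (real n ^ k * s ^ n) * r ^ n"
      using bound[of n] r by (intro mult_right_mono) auto
    then show "norm (fps_nth F n * of_real r ^ n) \<le> C * (real n ^ k * (s * r) ^ n)"
      using r by (simp add: norm_mult norm_power power_mult_distrib mult_ac)
  qed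
qed

text \<open>\<open>fps_XD\<close> is x d/dx, which the substitution x = exp (c z) turns into
  differentiation in z up to the factor c.\<close>

lemma has_field_derivative_eval_fps_exp:
  fixes F :: "complex fps"
  assumes "ereal (norm (exp (c * z))) < fps_conv_radius F"
  shows "((\<lambda>z. eval_fps F (exp (c * z))) has_field_derivative c * eval_fps (fps_XD F) (exp (c * z))) (at z)"
proof -
  have "eval_fps (fps_XD F) (exp (c * z)) = exp (c * z) * eval_fps (fps_deriv F) (exp (c * z))"
    using assms fps_conv_radius_deriv[of F] unfolding fps_XD_def
    by (simp add: eval_fps_mult less_le_trans)
  moreover have "((\<lambda>z. exp (c * z)) has_field_derivative c * exp (c * z)) (at z)"
    by (auto intro!: derivative_eq_intros)
  from DERIV_chain2[OF has_field_derivative_eval_fps[OF assms] this]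
  have "((\<lambda>z. eval_fps F (exp (c * z))) has_field_derivative eval_fps (fps_deriv F) (exp (c * z)) * (c * exp (c * z))) (at z)" .
  ultimately show ?thesis by (simp add: mult_ac)
qed

lemma has_fps_expansion_eval_fps_exp:
  fixes F :: "complex fps"
  assumes F: "1 < fps_conv_radius F"
  shows "(\<lambda>z. eval_fps F (exp (c * z))) has_fps_expansion Abs_fps (\<lambda>n. c ^ n * eval_fps ((fps_XD ^^ n) F) 1 / fact n)"
proof -
  let ?f = "\<lambda>z. eval_fps F (exp (c * z))"
  define A where "A = (\<lambda>z. exp (c * z)) -` eball 0 (fps_conv_radius F)"
  have "open A"
    unfolding A_def by (intro open_vimage continuous_intros) auto
  have "0 \<in> A" using F by (simp add: A_def in_eball_iff one_ereal_def)
  have rad: "ereal (norm (exp (c * z))) < fps_conv_radius ((fps_XD ^^ n) F)" if "z \<in> A" for z n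
    using that fps_conv_radius_XD_funpow[of F n] by (auto simp: A_def in_eball_iff intro: less_le_trans)
  have der: "(deriv ^^ n) ?f z = c ^ n * eval_fps ((fps_XD ^^ n) F) (exp (c * z))" if "z \<in> A" for z n
    using that
  proof (induction n arbitrary: z)
    case (Suc n)
    have "((\<lambda>z. c ^ n * eval_fps ((fps_XD ^^ n) F) (exp (c * z))) has_field_derivative
        c ^ n * (c * eval_fps (fps_XD ((fps_XD ^^ n) F)) (exp (c * z)))) (at z)"
      by (intro DERIV_cmult has_field_derivative_eval_fps_exp rad Suc.prems)
    then have "((deriv ^^ n) ?f has_field_derivative
        c ^ n * (c * eval_fps (fps_XD ((fps_XD ^^ n) F)) (exp (c * z)))) (at z)"
      by (rule has_field_derivative_transform_within_open[OF _ \<open>open A\<close> Suc.prems]) (simp add: Suc.IH)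
    then show ?case
      by (simp add: DERIV_imp_deriv mult_ac)
  qed simp
  have "(?f has_field_derivative c * eval_fps (fps_XD F) (exp (c * z))) (at z)" if "z \<in> A" for z
    by (rule has_field_derivative_eval_fps_exp) (use rad[OF that, of 0] in \<open>simp only: funpow.simps id_apply\<close>)
  then have "?f holomorphic_on A"
    by (auto simp: holomorphic_on_open[OF \<open>open A\<close>])
  then have "?f has_fps_expansion fps_expansion ?f 0"
    using \<open>open A\<close> \<open>0 \<in> A\<close> by (intro has_fps_expansion_fps_expansion)
  also have "fps_expansion ?f 0 = Abs_fps (\<lambda>n. c ^ n * eval_fps ((fps_XD ^^ n) F) 1 / fact n)"
    by (simp add: fps_expansion_def der[OF \<open>0 \<in> A\<close>])
  finally show ?thesis .
qed

section \<open>The two functions near z = 0\<close>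

context nome
begin

text \<open>At x = - exp z the positive indices of \<wp> give \<open>v_fps\<close> in exp z and the
  negative ones \<open>u_fps\<close> in exp (- z). \<open>u_fps\<close> and \<open>t_fps\<close>
  have radius at least 1/|q|, but \<open>v_fps\<close> is only controlled inside the unit disc, so
  it must be continued.\<close>

definition u_fps :: "complex fps" where
  "u_fps = Abs_fps (\<lambda>m. (-1) ^ m * of_nat m * q ^ m * inverse (1 - q ^ m))"
definition v_fps :: "complex fps" where
  "v_fps = Abs_fps (\<lambda>m. (-1) ^ m * of_nat m * inverse (1 - q ^ m))"
definition t_fps :: "complex fps" where
  "t_fps = Abs_fps (\<lambda>m. if m = 0 then 0 else (-1) ^ m * q ^ m * inverse (1 + q ^ m))"

lemma norm_inverse_le: "n > 0 \<Longrightarrow> norm (inverse (1 - q ^ n)) \<le> inverse (1 - norm q)"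
    "n > 0 \<Longrightarrow> norm (inverse (1 + q ^ n)) \<le> inverse (1 - norm q)"
  using norm_one_minus_power[of n] norm_one_plus_power[of n] q1
  by (auto simp: norm_inverse intro: le_imp_inverse_le)

lemma radius_uvt:
  "ereal (1 / norm q) \<le> fps_conv_radius u_fps" "1 \<le> fps_conv_radius v_fps" "ereal (1 / norm q) \<le> fps_conv_radius t_fps"
proof -
  show "ereal (1 / norm q) \<le> fps_conv_radius u_fps"
  proof (rule fps_conv_radius_geI_bound)
    fix n
    show "norm (fps_nth u_fps n) \<le> inverse (1 - norm q) * (real n ^ 1 * norm q ^ n)"
      using mult_left_mono[OF norm_inverse_le(1)[of n], of "real n * norm q ^ n"]
      by (cases "n = 0") (auto simp: u_fps_def norm_mult norm_power mult_ac)
  qed (use q0 in auto)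
  show "ereal (1 / norm q) \<le> fps_conv_radius t_fps"
  proof (rule fps_conv_radius_geI_bound)
    fix n
    show "norm (fps_nth t_fps n) \<le> inverse (1 - norm q) * (real n ^ 0 * norm q ^ n)"
      using mult_left_mono[OF norm_inverse_le(2)[of n], of "norm q ^ n"] q1
      by (cases "n = 0") (auto simp: t_fps_def norm_mult norm_power mult_ac)
  qed (use q0 in auto)
  have "ereal (1 / 1) \<le> fps_conv_radius v_fps"
  proof (rule fps_conv_radius_geI_bound)
    fix n
    show "norm (fps_nth v_fps n) \<le> inverse (1 - norm q) * (real n ^ 1 * 1 ^ n)"
      using mult_left_mono[OF norm_inverse_le(1)[of n], of "real n"]
      by (cases "n = 0") (auto simp: v_fps_def norm_mult norm_power mult_ac)
  qed auto
  then show "1 \<le> fps_conv_radius v_fps" by (simp add: one_ereal_def)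
qed

text \<open>The bound - ln |q| keeps exp z and exp (- z) inside the disc of radius 1/|q|; the bound
  1 keeps |Im z| below pi/2, so that 1 + exp z has no zero. \<open>neg_dom\<close> is the part where
  |x| < 1 and the bilateral series still converge.\<close>

definition radius :: real where "radius = min 1 (- ln (norm q))"
definition dom :: "complex set" where "dom = ball 0 radius"
definition neg_dom :: "complex set" where "neg_dom = dom \<inter> {z. Re z < 0}"

lemma radius_pos: "radius > 0"
  using q0 q1 by (simp add: radius_def ln_less_zero)

lemma dom_props:
  assumes "z \<in> dom"
  shows "ereal (norm (exp z)) < 1 / norm q" "ereal (norm (exp (- z))) < 1 / norm q" "1 + exp z \<noteq> 0"
    "norm q < norm (exp z)"
proof -
  have z: "norm z < 1" "norm z < - ln (norm q)" using assms by (auto simp: dom_def radius_def)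
  have r: "\<bar>Re z\<bar> < - ln (norm q)" using abs_Re_le_cmod[of z] z by linarith
  have "exp (- ln (norm q)) = 1 / norm q" using q0 by (simp add: exp_minus inverse_eq_divide)
  moreover have "exp (Re z) < exp (- ln (norm q))" "exp (- Re z) < exp (- ln (norm q))" using r by auto
  ultimately show "ereal (norm (exp z)) < 1 / norm q" "ereal (norm (exp (- z))) < 1 / norm q" by auto
  have "exp (ln (norm q)) < exp (Re z)" using r by simp
  then show "norm q < norm (exp z)" using q0 by simp
  have "\<bar>Im z\<bar> < pi / 2" using abs_Im_le_cmod[of z] z pi_gt3 by linarith
  then have "0 < cos (Im z)" by (intro cos_gt_zero_pi) auto
  then have "0 < Re (1 + exp z)" by (auto simp: Re_exp intro!: add_pos_pos mult_pos_pos)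
  then show "1 + exp z \<noteq> 0" by (metis less_irrefl zero_complex.simps(1))
qed

lemma dom_topology: "open dom" "connected dom" "0 \<in> dom" "open neg_dom" "neg_dom \<noteq> {}" "neg_dom \<subseteq> dom"
proof -
  show "open dom" "connected dom" "0 \<in> dom" using radius_pos by (auto simp: dom_def)
  then show "open neg_dom" unfolding neg_dom_def by (intro open_Int open_halfspace_Re_lt)
  have "of_real (- radius / 2) \<in> neg_dom" using radius_pos by (simp add: neg_dom_def dom_def)
  then show "neg_dom \<noteq> {}" by blast
qed (auto simp: neg_dom_def)

lemma neg_dom_props:
  assumes "z \<in> neg_dom"
  shows "norm q < norm (- exp z)" "norm (- exp z) < 1" "norm (exp z) < 1"
  using assms dom_props[of z] by (auto simp: neg_dom_def)

lemma radius_dom: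
  assumes "z \<in> dom"
  shows "ereal (norm (exp z)) < fps_conv_radius ((fps_XD ^^ k) u_fps)" "ereal (norm (exp (- z))) < fps_conv_radius ((fps_XD ^^ k) u_fps)"
    "ereal (norm (exp z)) < fps_conv_radius ((fps_XD ^^ k) t_fps)" "ereal (norm (exp (- z))) < fps_conv_radius ((fps_XD ^^ k) t_fps)"
  using dom_props(1,2)[OF assms] radius_uvt(1,3) fps_conv_radius_XD_funpow[of u_fps k] fps_conv_radius_XD_funpow[of t_fps k]
  by (meson less_le_trans)+

lemma radius_neg_dom:
  assumes "z \<in> neg_dom"
  shows "ereal (norm (exp z)) < fps_conv_radius ((fps_XD ^^ k) v_fps)"
proof -
  have "ereal (norm (exp z)) < 1" using neg_dom_props(3)[OF assms] by (simp add: one_ereal_def)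
  then show ?thesis
    using radius_uvt(2) fps_conv_radius_XD_funpow[of v_fps k] by (meson less_le_trans)
qed

lemma power_minus_exp: "(- exp z) powi int n = (-1) ^ n * exp z ^ n" "(- exp z) powi (- int n) = (-1) ^ n * exp (- z) ^ n"
  for z :: complex
proof -
  show "(- exp z) powi int n = (-1) ^ n * exp z ^ n"
    by (simp flip: power_mult_distrib)
  have "inverse ((- exp z) ^ n) = (inverse (- exp z)) ^ n" by (simp only: power_inverse)
  also have "inverse (- exp z) = - exp (- z)" by (simp add: exp_minus)
  also have "(- exp (- z)) ^ n = (-1) ^ n * exp (- z) ^ n" by (simp flip: power_mult_distrib)
  finally show "(- exp z) powi (- int n) = (-1) ^ n * exp (- z) ^ n" by (simp add: power_int_minus)
qed

text \<open>For odd k the signs of (-n)^k and of \<open>gm (- int n)\<close> cancel.\<close>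

lemma wp_sum_exp:
  assumes z: "z \<in> neg_dom" and k: "odd k"
  shows "wp_sum k (- exp z) = eval_fps ((fps_XD ^^ (k - 1)) v_fps) (exp z) + eval_fps ((fps_XD ^^ (k - 1)) u_fps) (exp (- z))"
proof -
  have k0: "k = Suc (k - 1)" using k by (cases k) auto
  have pos: "(if n = 0 then 0 else of_int (int n) ^ k * (- exp z) powi int n * gm (int n))
      = fps_nth ((fps_XD ^^ (k - 1)) v_fps) n * exp z ^ n" for n
    unfolding power_minus_exp gm_nat fps_mult_fps_XD_shift
    by (subst k0) (simp add: v_fps_def mult_ac)
  have neg: "(if n = 0 then 0 else of_int (- int n) ^ k * (- exp z) powi (- int n) * gm (- int n))
      = fps_nth ((fps_XD ^^ (k - 1)) u_fps) n * exp (- z) ^ n" for n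
  proof -
    have "(of_int (- int n) :: complex) ^ k = - (of_nat n * of_nat n ^ (k - 1))"
      using k k0 by (metis of_int_minus of_int_of_nat_eq power_Suc power_minus_odd)
    then show ?thesis
      unfolding power_minus_exp gm_nat fps_mult_fps_XD_shift by (simp add: u_fps_def mult_ac)
  qed
  have "k \<noteq> 0" using k by (cases k) auto
  then show ?thesis
    using infsum_int_split[OF abs_summable_gm[OF neg_dom_props(1,2)[OF z], of k]]
    unfolding pos neg by (simp add: wp_sum_def eval_fps_def)
qed

text \<open>The summand 1 in 1/(1 - q^n) = 1 + q^n/(1 - q^n) sums to a rational function, whose
  closed form continues the series across |y| = 1.\<close>

lemma eval_v_fps:
  assumes "norm y < 1"
  shows "eval_fps v_fps y = - y / (1 + y)\<^sup>2 + eval_fps u_fps y"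
proof -
  have "(\<lambda>n. of_nat (Suc n) * (- y) ^ n) sums (1 / (1 - (- y))\<^sup>2)"
    by (rule geometric_deriv_sums) (use assms in simp)
  then have "(\<lambda>n. (- y) * (of_nat (Suc n) * (- y) ^ n)) sums (- y * (1 / (1 - (- y))\<^sup>2))"
    by (rule sums_mult)
  then have "(\<lambda>n. of_nat (Suc n) * (- y) ^ Suc n) sums (- y * (1 / (1 + y)\<^sup>2) - of_nat 0 * (- y) ^ 0)"
    by (simp add: mult_ac)
  then have "(\<lambda>n. of_nat n * (- y) ^ n) sums (- y * (1 / (1 + y)\<^sup>2))"
    by (subst (asm) sums_Suc_iff) simp
  moreover have "ereal (norm y) < fps_conv_radius u_fps"
  proof -
    have "ereal (norm y) < 1" using assms by (simp add: one_ereal_def)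
    moreover have "1 \<le> ereal (1 / norm q)" using q0 q1 by (simp add: one_ereal_def field_simps)
    ultimately show ?thesis using radius_uvt(1) by order
  qed
  ultimately have "(\<lambda>n. of_nat n * (- y) ^ n + fps_nth u_fps n * y ^ n) sums (- y * (1 / (1 + y)\<^sup>2) + eval_fps u_fps y)"
    unfolding eval_fps_def by (intro sums_add summable_sums summable_fps)
  moreover have "of_nat n * (- y) ^ n + fps_nth u_fps n * y ^ n = fps_nth v_fps n * y ^ n" for n
  proof (cases "n = 0")
    case False
    then have "1 - q ^ n \<noteq> 0" using power_ne by simp
    then have "1 + q ^ n * inverse (1 - q ^ n) = inverse (1 - q ^ n)" by (simp add: field_simps)
    then have "fps_nth v_fps n * y ^ n = (-1) ^ n * of_nat n * (1 + q ^ n * inverse (1 - q ^ n)) * y ^ n"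
      by (simp only: v_fps_def fps_nth_Abs_fps)
    also have "\<dots> = of_nat n * ((-1) ^ n * y ^ n) + fps_nth u_fps n * y ^ n"
      by (simp add: u_fps_def algebra_simps del: mult_minus1)
    also have "(-1) ^ n * y ^ n = (- y) ^ n" by (simp flip: power_mult_distrib)
    finally show ?thesis ..
  qed (simp add: u_fps_def v_fps_def)
  ultimately show ?thesis by (simp add: eval_fps_def sums_iff)
qed

text \<open>\<open>wp\<close> and \<open>phi\<close> continue \<open>wp_sum 1\<close> and
  \<open>phi_sum\<close> across Re z = 0. The rational part of \<open>phi\<close> is - tanh(z/2) /
  2, and that of \<open>wp\<close> is its derivative.\<close>

definition wp :: "complex \<Rightarrow> complex" where
  "wp z = - exp z / (1 + exp z)\<^sup>2 + eval_fps u_fps (exp z) + eval_fps u_fps (exp (- z))"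

definition phi :: "complex \<Rightarrow> complex" where
  "phi z = 1 / 2 - exp z / (1 + exp z) + eval_fps t_fps (exp (- z)) - eval_fps t_fps (exp z)"

lemma has_field_derivative_eval_exp:
  assumes "z \<in> dom"
  shows "((\<lambda>z. eval_fps u_fps (exp z)) has_field_derivative eval_fps (fps_XD u_fps) (exp z)) (at z)"
    "((\<lambda>z. eval_fps u_fps (exp (- z))) has_field_derivative - eval_fps (fps_XD u_fps) (exp (- z))) (at z)"
    "((\<lambda>z. eval_fps t_fps (exp z)) has_field_derivative eval_fps (fps_XD t_fps) (exp z)) (at z)"
    "((\<lambda>z. eval_fps t_fps (exp (- z))) has_field_derivative - eval_fps (fps_XD t_fps) (exp (- z))) (at z)"
  using has_field_derivative_eval_fps_exp[of 1 z] has_field_derivative_eval_fps_exp[of "-1" z] radius_dom[OF assms, of 0]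
  by auto

lemma wp_holomorphic: "wp holomorphic_on dom" and phi_holomorphic: "phi holomorphic_on dom"
proof -
  have "(\<lambda>z. eval_fps u_fps (exp z)) holomorphic_on dom" "(\<lambda>z. eval_fps u_fps (exp (- z))) holomorphic_on dom"
    "(\<lambda>z. eval_fps t_fps (exp z)) holomorphic_on dom" "(\<lambda>z. eval_fps t_fps (exp (- z))) holomorphic_on dom"
    unfolding holomorphic_on_open[OF dom_topology(1)] using has_field_derivative_eval_exp by blast+
  then show "wp holomorphic_on dom" "phi holomorphic_on dom"
    unfolding wp_def phi_def using dom_props(3) by (auto intro!: holomorphic_intros)
qed

lemma wp_eq_wp_sum:
  assumes "z \<in> neg_dom"
  shows "wp z = wp_sum 1 (- exp z)" "deriv (deriv wp) z = wp_sum 3 (- exp z)"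
proof -
  have eq: "wp z = eval_fps v_fps (exp z) + eval_fps u_fps (exp (- z))" if "z \<in> neg_dom" for z
    using neg_dom_props(3)[OF that] by (simp add: wp_def eval_v_fps)
  then show "wp z = wp_sum 1 (- exp z)" using wp_sum_exp[OF assms, of 1] assms by simp
  \<comment> \<open>The factor c records the sign from differentiating exp (- z): it goes from 1 to
    -1 and back.\<close>
  have d: "((\<lambda>z. eval_fps ((fps_XD ^^ k) v_fps) (exp z) + c * eval_fps ((fps_XD ^^ k) u_fps) (exp (- z))) has_field_derivative
      eval_fps ((fps_XD ^^ Suc k) v_fps) (exp z) + (- c) * eval_fps ((fps_XD ^^ Suc k) u_fps) (exp (- z))) (at z)"
    if "z \<in> neg_dom" for z k c
  proof -
    have "z \<in> dom" using that by (simp add: neg_dom_def)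
    have 1: "((\<lambda>z. eval_fps ((fps_XD ^^ k) v_fps) (exp z)) has_field_derivative eval_fps ((fps_XD ^^ Suc k) v_fps) (exp z)) (at z)"
      using has_field_derivative_eval_fps_exp[of 1 z "(fps_XD ^^ k) v_fps"] radius_neg_dom[OF that, of k] by simp
    have 2: "((\<lambda>z. eval_fps ((fps_XD ^^ k) u_fps) (exp (- z))) has_field_derivative - eval_fps ((fps_XD ^^ Suc k) u_fps) (exp (- z))) (at z)"
      using has_field_derivative_eval_fps_exp[of "-1" z "(fps_XD ^^ k) u_fps"] radius_dom(2)[OF \<open>z \<in> dom\<close>, of k] by simp
    show ?thesis using DERIV_add[OF 1 DERIV_cmult[OF 2, of c]] by simp
  qed
  have d1: "deriv wp z = eval_fps ((fps_XD ^^ 1) v_fps) (exp z) + (-1) * eval_fps ((fps_XD ^^ 1) u_fps) (exp (- z))"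
    if "z \<in> neg_dom" for z
  proof (rule DERIV_imp_deriv, rule has_field_derivative_transform_within_open[OF _ dom_topology(4) that])
    show "((\<lambda>z. eval_fps v_fps (exp z) + eval_fps u_fps (exp (- z))) has_field_derivative
      eval_fps ((fps_XD ^^ 1) v_fps) (exp z) + (-1) * eval_fps ((fps_XD ^^ 1) u_fps) (exp (- z))) (at z)"
      using d[OF that, of 0 1] by simp
  qed (simp add: eq)
  have "deriv (deriv wp) z = eval_fps ((fps_XD ^^ 2) v_fps) (exp z) + (- (-1)) * eval_fps ((fps_XD ^^ 2) u_fps) (exp (- z))"
  proof (rule DERIV_imp_deriv, rule has_field_derivative_transform_within_open[OF _ dom_topology(4) assms])
    show "((\<lambda>z. eval_fps ((fps_XD ^^ 1) v_fps) (exp z) + (-1) * eval_fps ((fps_XD ^^ 1) u_fps) (exp (- z))) has_field_derivative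
      eval_fps ((fps_XD ^^ 2) v_fps) (exp z) + (- (-1)) * eval_fps ((fps_XD ^^ 2) u_fps) (exp (- z))) (at z)"
      using d[OF assms, of 1 "-1"] by (simp only: numeral_2_eq_2 One_nat_def)
  qed (simp only: d1)
  then show "deriv (deriv wp) z = wp_sum 3 (- exp z)"
    using wp_sum_exp[OF assms, of 3] by simp
qed

lemma phi_eq_phi_sum:
  assumes "z \<in> neg_dom"
  shows "phi z = phi_sum (- exp z)"
proof -
  have z: "z \<in> dom" using assms by (simp add: neg_dom_def)
  define y where "y = exp z"
  have y: "norm y < 1" using neg_dom_props(3)[OF assms] by (simp add: y_def)
  have split: "phi_sum (- exp z) = gp 0 + (\<Sum>n. if n = 0 then 0 else (- exp z) powi int n * gp (int n))
      + (\<Sum>n. if n = 0 then 0 else (- exp z) powi (- int n) * gp (- int n))"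
  proof -
    have "(\<lambda>a. (- exp z) powi a * gp a) abs_summable_on UNIV"
      using abs_summable_gp[OF neg_dom_props(1,2)[OF assms], of 0] by simp
    from infsum_int_split[OF this] show ?thesis by (simp add: phi_sum_def)
  qed
  have neg: "(if n = 0 then 0 else (- exp z) powi (- int n) * gp (- int n)) = fps_nth t_fps n * exp (- z) ^ n" for n
    unfolding power_minus_exp gp_nat by (simp add: t_fps_def mult_ac)
  have "(\<lambda>n. (- y) ^ n) sums (1 / (1 - (- y)))"
    by (rule geometric_sums) (use y in simp)
  moreover have "(\<lambda>n. fps_nth t_fps n * y ^ n) sums eval_fps t_fps y"
    unfolding eval_fps_def
    by (intro summable_sums summable_fps) (use radius_dom(3)[OF z, of 0] in \<open>simp only: funpow.simps id_apply y_def\<close>)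
  \<comment> \<open>The geometric series includes n = 0, while the index 0 of \<open>phi_sum\<close>
    is already counted with its value \<open>gp 0\<close> = 1/2; hence the subtracted 1.\<close>
  ultimately have "(\<lambda>n. (- y) ^ n - fps_nth t_fps n * y ^ n - (if n = 0 then 1 else 0)) sums (1 / (1 + y) - eval_fps t_fps y - 1)"
    using sums_single[of 0 "\<lambda>_. 1 :: complex"] by (intro sums_diff) (auto simp: if_distrib cong: if_cong)
  moreover have "(- y) ^ n - fps_nth t_fps n * y ^ n - (if n = 0 then 1 else 0)
      = (if n = 0 then 0 else (- exp z) powi int n * gp (int n))" for n
  proof (cases "n = 0")
    case False
    then have "1 + q ^ n \<noteq> 0" using power_ne by simp
    then have "1 - q ^ n * inverse (1 + q ^ n) = inverse (1 + q ^ n)" by (simp add: field_simps)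
    moreover have "(- y) ^ n = (-1) ^ n * y ^ n" by (simp flip: power_mult_distrib)
    moreover have "(-1) ^ n * y ^ n - (-1) ^ n * q ^ n * inverse (1 + q ^ n) * y ^ n
        = (-1) ^ n * y ^ n * (1 - q ^ n * inverse (1 + q ^ n))" by (simp add: algebra_simps)
    ultimately show ?thesis
      using False unfolding power_minus_exp gp_nat y_def[symmetric] by (simp add: t_fps_def)
  qed (simp add: t_fps_def)
  ultimately have pos: "(\<Sum>n. if n = 0 then 0 else (- exp z) powi int n * gp (int n)) = 1 / (1 + y) - eval_fps t_fps y - 1"
    by (simp add: sums_iff)
  have "1 + y \<noteq> 0" using dom_props(3)[OF z] by (simp add: y_def)
  then have "1 / (1 + y) - 1 = - (y / (1 + y))" by (simp add: field_simps)
  moreover have "(\<Sum>n. if n = 0 then 0 else (- exp z) powi (- int n) * gp (- int n)) = eval_fps t_fps (exp (- z))"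
    unfolding neg eval_fps_def ..
  moreover have "gp 0 = 1 / 2" by (simp add: gp_def)
  ultimately have "phi_sum (- exp z) = 1 / 2 + (- (y / (1 + y)) - eval_fps t_fps y) + eval_fps t_fps (exp (- z))"
    unfolding split pos by (simp add: algebra_simps)
  then show ?thesis by (simp add: phi_def y_def)
qed

lemma wp_ode: "\<exists>\<beta> \<gamma>. \<forall>z\<in>dom. (wp z)\<^sup>2 = deriv (deriv wp) z / 6 + \<beta> * wp z + \<gamma>"
proof -
  obtain \<beta> \<gamma> where sq: "\<And>x. norm q < norm x \<Longrightarrow> norm x < 1 \<Longrightarrow> (wp_sum 1 x)\<^sup>2 = wp_sum 3 x / 6 + \<beta> * wp_sum 1 x + \<gamma>"
    using wp_sum_square by blast
  have "(wp z)\<^sup>2 = deriv (deriv wp) z / 6 + \<beta> * wp z + \<gamma>" if "z \<in> dom" for z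
  proof (rule analytic_continuation_open[OF dom_topology(4,1,5,2,6) _ _ _ that])
    show "(\<lambda>z. (wp z)\<^sup>2) holomorphic_on dom"
      "(\<lambda>z. deriv (deriv wp) z / 6 + \<beta> * wp z + \<gamma>) holomorphic_on dom"
      using wp_holomorphic dom_topology(1) by (auto intro!: holomorphic_intros)
    show "(wp z)\<^sup>2 = deriv (deriv wp) z / 6 + \<beta> * wp z + \<gamma>" if "z \<in> neg_dom" for z
      unfolding wp_eq_wp_sum[OF that] by (rule sq) (rule neg_dom_props[OF that])+
  qed
  then show ?thesis by blast
qed

lemma phi_0: "phi 0 = 0"
  by (simp add: phi_def)

lemma wp_0: "wp 0 = - 1 / 4 + 2 * eval_fps u_fps 1"
  by (simp add: wp_def power2_eq_square)

text \<open>The unknown constant is found at z = 0, where \<open>phi\<close> vanishes, a point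
  outside the annulus. The second form carries this value back to the annulus; the four squares
  theorem uses it for the nome q^2.\<close>

lemma phi_square:
  shows "z \<in> dom \<Longrightarrow> (phi z)\<^sup>2 = wp z - wp 0"
    and "norm q < norm x \<Longrightarrow> norm x < 1 \<Longrightarrow> (phi_sum x)\<^sup>2 = wp_sum 1 x - wp 0"
proof -
  obtain E where E: "\<And>x. norm q < norm x \<Longrightarrow> norm x < 1 \<Longrightarrow> (phi_sum x)\<^sup>2 = wp_sum 1 x + E"
    using phi_sum_square by blast
  have sq: "(phi z)\<^sup>2 = wp z + E" if "z \<in> dom" for z
  proof (rule analytic_continuation_open[OF dom_topology(4,1,5,2,6) _ _ _ that])
    show "(\<lambda>z. (phi z)\<^sup>2) holomorphic_on dom" "(\<lambda>z. wp z + E) holomorphic_on dom"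
      using wp_holomorphic phi_holomorphic by (auto intro!: holomorphic_intros)
    show "(phi z)\<^sup>2 = wp z + E" if "z \<in> neg_dom" for z
      unfolding wp_eq_wp_sum[OF that] phi_eq_phi_sum[OF that] by (rule E) (rule neg_dom_props[OF that])+
  qed
  have "E = - wp 0" using sq[OF dom_topology(3)] phi_0 by (simp add: eq_neg_iff_add_eq_0 add.commute)
  then show "z \<in> dom \<Longrightarrow> (phi z)\<^sup>2 = wp z - wp 0"
    and "norm q < norm x \<Longrightarrow> norm x < 1 \<Longrightarrow> (phi_sum x)\<^sup>2 = wp_sum 1 x - wp 0"
    using sq E by auto
qed

lemma deriv_phi_0: "deriv phi 0 = - 1 / 4 - 2 * eval_fps (fps_XD t_fps) 1"
proof -
  have "((\<lambda>z::complex. 1 / 2 - exp z / (1 + exp z)) has_field_derivative - 1 / 4) (at 0)"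
    by (auto intro!: derivative_eq_intros simp: power2_eq_square)
  from DERIV_diff[OF DERIV_add[OF this has_field_derivative_eval_exp(4)[OF dom_topology(3)]]
      has_field_derivative_eval_exp(3)[OF dom_topology(3)]]
  have "(phi has_field_derivative - 1 / 4 - 2 * eval_fps (fps_XD t_fps) 1) (at 0)"
    unfolding phi_def[abs_def] by (rule DERIV_cong) simp
  then show ?thesis by (rule DERIV_imp_deriv)
qed

section \<open>Taylor expansions at 0 and the Hankel determinant\<close>

lemma fermi_has_fps_expansion:
  "(\<lambda>z::complex. inverse (1 + exp z)) has_fps_expansion Abs_fps (\<lambda>n. of_real (fps_nth fermi_fps n))"
proof -
  define H where "H = Abs_fps (\<lambda>n. of_real (fps_nth fermi_fps n) :: complex)"
  have "H * (1 + fps_exp 1) = 1"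
  proof (rule fps_ext)
    fix n
    have "fps_nth (1 + fps_exp 1 :: complex fps) k = of_real (fps_nth (1 + fps_exp 1) k)" for k
      by (simp add: fps_one_nth)
    then have "fps_nth (H * (1 + fps_exp 1)) n = of_real (fps_nth (fermi_fps * (1 + fps_exp 1)) n)"
      by (simp only: fps_mult_nth H_def fps_nth_Abs_fps of_real_sum of_real_mult)
    then show "fps_nth (H * (1 + fps_exp 1)) n = fps_nth 1 n"
      by (simp add: fermi_fps_mult)
  qed
  then have "inverse (1 + fps_exp 1) = H"
    by (metis fps_inverse_unique mult.commute)
  moreover have "(\<lambda>z::complex. inverse (1 + exp z)) has_fps_expansion inverse (1 + fps_exp 1)"
    by (intro fps_expansion_intros) auto
  ultimately show ?thesis by (simp add: H_def)
qed

definition wp_fps :: "complex fps" where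
  "wp_fps = fps_deriv (Abs_fps (\<lambda>n. of_real (fps_nth fermi_fps n)))
    + Abs_fps (\<lambda>n. 1 ^ n * eval_fps ((fps_XD ^^ n) u_fps) 1 / fact n)
    + Abs_fps (\<lambda>n. (-1) ^ n * eval_fps ((fps_XD ^^ n) u_fps) 1 / fact n)"

lemma wp_has_fps_expansion: "wp has_fps_expansion wp_fps"
proof -
  have gt1: "1 < fps_conv_radius u_fps"
  proof -
    have "1 < ereal (1 / norm q)" using q0 q1 by (simp add: one_ereal_def field_simps)
    then show ?thesis using radius_uvt(1) by order
  qed
  have "deriv (\<lambda>z::complex. inverse (1 + exp z)) has_fps_expansion fps_deriv (Abs_fps (\<lambda>n. of_real (fps_nth fermi_fps n)))"
    by (rule has_fps_expansion_deriv[OF fermi_has_fps_expansion])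
  also have "?this \<longleftrightarrow> (\<lambda>z::complex. - exp z / (1 + exp z)\<^sup>2) has_fps_expansion fps_deriv (Abs_fps (\<lambda>n. of_real (fps_nth fermi_fps n)))"
  proof (rule has_fps_expansion_cong)
    have "deriv (\<lambda>z::complex. inverse (1 + exp z)) z = - exp z / (1 + exp z)\<^sup>2" if "z \<in> dom" for z
      using dom_props(3)[OF that]
      by (intro DERIV_imp_deriv) (auto intro!: derivative_eq_intros simp: power2_eq_square field_simps)
    then show "\<forall>\<^sub>F z in nhds 0. deriv (\<lambda>z::complex. inverse (1 + exp z)) z = - exp z / (1 + exp z)\<^sup>2"
      using eventually_nhds_in_open[OF dom_topology(1,3)] by (auto elim: eventually_mono)
  qed simp
  finally have "(\<lambda>z. - exp z / (1 + exp z)\<^sup>2 + eval_fps u_fps (exp (1 * z)) + eval_fps u_fps (exp (-1 * z))) has_fps_expansion wp_fps"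
    unfolding wp_fps_def by (intro has_fps_expansion_add has_fps_expansion_eval_fps_exp gt1)
  then show ?thesis by (simp add: wp_def[abs_def])
qed

definition phi_fps :: "complex fps" where "phi_fps = fps_expansion phi 0"

lemma phi_has_fps_expansion: "phi has_fps_expansion phi_fps"
  unfolding phi_fps_def using dom_topology(1,3) phi_holomorphic by (rule has_fps_expansion_fps_expansion)

lemma phi_fps_nth: "fps_nth phi_fps 0 = 0" "fps_nth phi_fps 1 = deriv phi 0"
  by (simp_all add: phi_fps_def fps_expansion_def phi_0)

lemma phi_fps_square: "phi_fps\<^sup>2 = wp_fps - fps_const (wp 0)"
proof (rule fps_expansion_unique_complex)
  have "(\<lambda>z. wp z - wp 0) has_fps_expansion wp_fps - fps_const (wp 0)"
    by (intro fps_expansion_intros wp_has_fps_expansion)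
  also have "?this \<longleftrightarrow> (\<lambda>z. (phi z)\<^sup>2) has_fps_expansion wp_fps - fps_const (wp 0)"
    by (rule has_fps_expansion_cong)
       (use eventually_nhds_in_open[OF dom_topology(1,3)] phi_square(1) in \<open>auto elim: eventually_mono\<close>)
  finally show "(\<lambda>z. (phi z)\<^sup>2) has_fps_expansion wp_fps - fps_const (wp 0)" .
  show "(\<lambda>z. (phi z)\<^sup>2) has_fps_expansion phi_fps\<^sup>2"
    by (intro fps_expansion_intros phi_has_fps_expansion)
qed

text \<open>Subtracting the constant \<open>wp 0\<close> changes only the linear and constant
  coefficients of the equation. Their existence suffices, since the value of the Hankel determinant
  is free of A and C.\<close>

lemma phi_fps_square_ode:
  "\<exists>A C. fps_deriv (fps_deriv (phi_fps\<^sup>2)) = 6 * (phi_fps\<^sup>2)\<^sup>2 + fps_const A * phi_fps\<^sup>2 + fps_const C"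
proof -
  obtain \<beta> \<gamma> where ode: "\<And>z. z \<in> dom \<Longrightarrow> (wp z)\<^sup>2 = deriv (deriv wp) z / 6 + \<beta> * wp z + \<gamma>"
    using wp_ode by blast
  have "(\<lambda>z. (1 / 6) * deriv (deriv wp) z + \<beta> * wp z + \<gamma>) has_fps_expansion
      fps_const (1 / 6) * fps_deriv (fps_deriv wp_fps) + fps_const \<beta> * wp_fps + fps_const \<gamma>"
    by (intro has_fps_expansion_add has_fps_expansion_cmult_left has_fps_expansion_deriv wp_has_fps_expansion has_fps_expansion_const)
  also have "?this \<longleftrightarrow> (\<lambda>z. (wp z)\<^sup>2) has_fps_expansion
      fps_const (1 / 6) * fps_deriv (fps_deriv wp_fps) + fps_const \<beta> * wp_fps + fps_const \<gamma>"
    by (rule has_fps_expansion_cong)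
       (use eventually_nhds_in_open[OF dom_topology(1,3)] ode in \<open>auto elim!: eventually_mono\<close>)
  finally have "wp_fps\<^sup>2 = fps_const (1 / 6) * fps_deriv (fps_deriv wp_fps) + fps_const \<beta> * wp_fps + fps_const \<gamma>"
    by (rule fps_expansion_unique_complex[rotated]) (intro fps_expansion_intros wp_has_fps_expansion)
  then have "6 * wp_fps\<^sup>2 = 6 * fps_const (1 / 6) * fps_deriv (fps_deriv wp_fps) + 6 * (fps_const \<beta> * wp_fps + fps_const \<gamma>)"
    by (simp add: algebra_simps)
  moreover have "6 * fps_const (1 / 6) = (1 :: complex fps)"
    by (simp add: numeral_fps_const)
  ultimately have ode': "fps_deriv (fps_deriv wp_fps) = 6 * wp_fps\<^sup>2 - 6 * (fps_const \<beta> * wp_fps + fps_const \<gamma>)"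
    by simp
  define f where "f = phi_fps\<^sup>2"
  define w where "w = wp 0"
  have W: "wp_fps = f + fps_const w"
    using phi_fps_square by (simp add: f_def w_def)
  have "fps_deriv (fps_deriv f) = 6 * (f + fps_const w)\<^sup>2 - 6 * (fps_const \<beta> * (f + fps_const w) + fps_const \<gamma>)"
    using ode' unfolding W by simp
  also have "\<dots> = 6 * f\<^sup>2 + (12 * fps_const w - 6 * fps_const \<beta>) * f
      + (6 * fps_const w * fps_const w - 6 * (fps_const \<beta> * fps_const w) - 6 * fps_const \<gamma>)"
    by (simp add: power2_eq_square algebra_simps del: fps_const_mult)
  also have "12 * fps_const w - 6 * fps_const \<beta> = fps_const (12 * w - 6 * \<beta>)"
    by (simp add: numeral_fps_const)
  also have "6 * fps_const w * fps_const w - 6 * (fps_const \<beta> * fps_const w) - 6 * fps_const \<gamma>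
      = fps_const (6 * w * w - 6 * (\<beta> * w) - 6 * \<gamma>)"
    by (simp add: numeral_fps_const)
  finally show ?thesis unfolding f_def by blast
qed

lemma lambert_term_abs_summable: "lambert_term q k abs_summable_on {1..} \<times> {1..}"
  and lambert_sum_eq: "lambert_sum q k = eval_fps ((fps_XD ^^ (2 * k)) u_fps) 1"
proof -
  define g where "g m = (-1) ^ m * of_nat m ^ (2 * k + 1) * (q ^ m * inverse (1 - q ^ m))" for m :: nat
  \<comment> \<open>The pair is swapped so that y is the inner variable and the inner sum is
    geometric.\<close>
  define f where "f = (\<lambda>(m, y). lambert_term q k (y, m))"
  have nq: "norm (q ^ m) < 1" if "m \<ge> 1" for m
    using q1 that by (simp add: norm_power power_less_one_iff)
  have geo: "((\<lambda>y. c * x ^ y) has_sum c * (x * inverse (1 - x))) {1..}" if "norm x < 1" for c x :: complex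
    using has_sum_cmult_right[OF has_sum_geometric_from_1[OF that], of c] by (simp add: divide_inverse)
  have geo': "((\<lambda>y. c * x ^ y) has_sum c * (x * inverse (1 - x))) {1..}" if "norm x < 1" for c x :: real
    using has_sum_cmult_right[OF has_sum_geometric_from_1[OF that], of c] by (simp add: divide_inverse)
  have f: "f (m, y) = (-1) ^ m * of_nat m ^ (2 * k + 1) * (q ^ m) ^ y" for m y
  proof -
    have "f (m, y) = (-1) ^ m * (q ^ m) ^ y * of_nat m ^ (2 * k + 1)"
      by (simp add: f_def lambert_term_def power_mult)
    then show ?thesis by (simp only: mult_ac)
  qed
  have inner: "((\<lambda>y. f (m, y)) has_sum g m) {1..}" if "m \<in> {1..}" for m
    unfolding f g_def by (rule geo) (use nq that in auto)
  have inner': "((\<lambda>y. norm (f (m, y))) has_sum real m ^ (2 * k + 1) * (norm q ^ m * inverse (1 - norm q ^ m))) {1..}"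
    if "m \<in> {1..}" for m
  proof -
    have "norm (f (m, y)) = real m ^ (2 * k + 1) * (norm q ^ m) ^ y" for y
      unfolding f by (simp add: norm_mult norm_power)
    then show ?thesis using geo'[of "norm q ^ m" "real m ^ (2 * k + 1)"] nq[of m] that by (simp add: norm_power)
  qed
  have sm: "summable (\<lambda>m. inverse (1 - norm q) * (real m ^ (2 * k + 1) * norm q ^ m))"
    by (intro summable_mult summable_power_times_geometric) (use q1 in auto)
  have outer: "(\<lambda>m. real m ^ (2 * k + 1) * (norm q ^ m * inverse (1 - norm q ^ m))) summable_on {1..}"
  proof -
    have "(\<lambda>m. inverse (1 - norm q) * (real m ^ (2 * k + 1) * norm q ^ m)) summable_on UNIV"
      using sm q1 by (intro norm_summable_imp_summable_on) simp
    then have "(\<lambda>m. inverse (1 - norm q) * (real m ^ (2 * k + 1) * norm q ^ m)) summable_on {1..}"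
      by (rule summable_on_subset_banach) auto
    then have "(\<lambda>m. norm (real m ^ (2 * k + 1) * (norm q ^ m * inverse (1 - norm q ^ m)))) summable_on {1..}"
    proof (rule Infinite_Sum.abs_summable_on_comparison_test')
      fix m :: nat assume m: "m \<in> {1..}"
      have "norm q ^ m \<le> norm q" using q1 m power_decreasing[of 1 m "norm q"] by simp
      then have "inverse (1 - norm q ^ m) \<le> inverse (1 - norm q)" and nonneg: "0 \<le> inverse (1 - norm q ^ m)"
        using q1 by (auto intro: le_imp_inverse_le)
      then have "real m ^ (2 * k + 1) * norm q ^ m * inverse (1 - norm q ^ m) \<le> real m ^ (2 * k + 1) * norm q ^ m * inverse (1 - norm q)"
        by (intro mult_left_mono) auto
      then show "norm (real m ^ (2 * k + 1) * (norm q ^ m * inverse (1 - norm q ^ m)))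
          \<le> inverse (1 - norm q) * (real m ^ (2 * k + 1) * norm q ^ m)"
        using nonneg by (simp only: real_norm_def abs_mult abs_power2 abs_of_nonneg power_abs abs_norm_cancel of_nat_0_le_iff mult_ac)
    qed
    then show ?thesis by (rule abs_summable_summable)
  qed
  have abs: "f abs_summable_on {1..} \<times> {1..}"
    by (rule summable_on_SigmaI[OF inner' outer]) auto
  then show "lambert_term q k abs_summable_on {1..} \<times> {1..}"
    using summable_on_swap[of "\<lambda>z. norm (lambert_term q k z)" "{1..}" "{1..}"] by (simp add: f_def case_prod_unfold)
  have "lambert_sum q k = infsum f ({1..} \<times> {1..})"
    unfolding lambert_sum_def f_def
    by (rule infsum_reindex_bij_witness[of _ "\<lambda>(a, b). (b, a)" "\<lambda>(a, b). (b, a)"]) auto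
  also have "\<dots> = infsum g {1..}"
  proof -
    have "(g has_sum infsum f ({1..} \<times> {1..})) {1..}"
      using has_sum_SigmaD[OF has_sum_infsum[OF abs_summable_summable[OF abs]] inner] .
    then show ?thesis by (simp add: infsumI)
  qed
  also have "\<dots> = infsum g UNIV"
  proof (rule infsum_cong_neutral)
    fix m :: nat assume "m \<in> UNIV - {1..}"
    then have "m = 0" by auto
    then show "g m = 0" by (simp add: g_def)
  qed auto
  also have "\<dots> = (\<Sum>m. g m)"
  proof -
    have "summable (\<lambda>m. norm (g m))"
    proof (rule summable_comparison_test'[OF sm, of 1])
      fix m :: nat assume "m \<ge> 1"
      then show "norm (norm (g m)) \<le> inverse (1 - norm q) * (real m ^ (2 * k + 1) * norm q ^ m)"
        using mult_left_mono[OF norm_inverse_le(1)[of m], of "real m ^ (2 * k + 1) * norm q ^ m"]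
        by (simp add: g_def norm_mult norm_power mult_ac)
    qed
    then have "g abs_summable_on UNIV" by (simp add: abs_summable_on_nat_iff)
    then have "g sums infsum g UNIV"
      by (intro has_sum_imp_sums has_sum_infsum) (rule abs_summable_summable)
    then show ?thesis by (simp add: sums_iff)
  qed
  finally show "lambert_sum q k = eval_fps ((fps_XD ^^ (2 * k)) u_fps) 1"
    unfolding eval_fps_def fps_mult_fps_XD_shift by (simp add: g_def u_fps_def mult_ac)
qed

text \<open>The coefficient of z^(2k) in \<open>phi_fps\<close> squared collects one Lambert sum
  each from exp z and exp (- z), and -2 a_k from the rational part. The constant \<open>wp 0\<close>
  affects k = 0 only, below the range of the matrix.\<close>

theorem det_lambert_eq:
  "2 ^ n * det (mat n n (\<lambda>(i, j). lambert_sum q (i + j + 1) - of_real (a_coeff (i + j + 1))))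
    = (\<Prod>r=1..2*n. fact r) * ((deriv phi 0)\<^sup>2) ^ (\<Sum>k<n. Suc k)"
proof -
  let ?f = "phi_fps\<^sup>2"
  obtain A C where ode: "fps_deriv (fps_deriv ?f) = 6 * ?f\<^sup>2 + fps_const A * ?f + fps_const C"
    using phi_fps_square_ode by blast
  have nth: "fps_nth ?f 0 = 0" "fps_nth ?f 1 = 0" "fps_nth ?f 2 = (deriv phi 0)\<^sup>2"
    using phi_fps_nth by (simp_all add: power2_eq_square fps_mult_nth numeral_2_eq_2)
  have coeff: "fact (2 * k) * fps_nth ?f (2 * k) = 2 * (lambert_sum q k - of_real (a_coeff k))" if "k \<ge> 1" for k
  proof -
    have "fps_nth (fps_deriv (Abs_fps (\<lambda>n. of_real (fps_nth fermi_fps n) :: complex))) (2 * k)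
        = of_real (fps_nth (fps_deriv half_tanh_fps) (2 * k))"
      by (simp add: half_tanh_fps_def)
    then have "fps_nth ?f (2 * k) = of_real (fps_nth (fps_deriv half_tanh_fps) (2 * k)) + 2 * (lambert_sum q k / fact (2 * k))"
      using that unfolding phi_fps_square wp_fps_def by (simp add: lambert_sum_eq)
    then have "fact (2 * k) * fps_nth ?f (2 * k) = of_real (fact (2 * k) * fps_nth (fps_deriv half_tanh_fps) (2 * k)) + 2 * lambert_sum q k"
      by (simp add: algebra_simps del: fps_deriv_nth)
    also have "fact (2 * k) * fps_nth (fps_deriv half_tanh_fps) (2 * k) = -2 * a_coeff k"
      by (simp add: a_coeff_eq_half_tanh del: fps_deriv_nth)
    finally show ?thesis by simp
  qed
  have "fact (2 * (i + j + 1)) * fps_nth ?f (2 * (i + j + 1)) = 2 * (lambert_sum q (i + j + 1) - of_real (a_coeff (i + j + 1)))" for i j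
    by (rule coeff) simp
  then have "mat n n (\<lambda>(i, j). fact (2 * (i + j + 1)) * fps_nth ?f (2 * (i + j + 1)))
      = mat n n (\<lambda>(i, j). 2 * (lambert_sum q (i + j + 1) - of_real (a_coeff (i + j + 1))))"
    by (simp only:)
  moreover have "det (mat n n (\<lambda>(i, j). 2 * (lambert_sum q (i + j + 1) - of_real (a_coeff (i + j + 1)))))
      = 2 ^ n * det (mat n n (\<lambda>(i, j). lambert_sum q (i + j + 1) - of_real (a_coeff (i + j + 1))))"
    using det_row_scale[of n "\<lambda>_. 2" "\<lambda>i j. lambert_sum q (i + j + 1) - of_real (a_coeff (i + j + 1))"] by simp
  ultimately show ?thesis
    using hankel_det_quadratic_ode[OF nth(1,2) ode, of n] unfolding nth(3) by simp
qed

end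

section \<open>The theorems on two and four squares\<close>

lemma abs_summable_quadratic:
  fixes q :: complex and c :: "int \<Rightarrow> complex"
  assumes "norm q < 1" and "\<And>n. n > 0 \<Longrightarrow> norm (c (int n)) \<le> C * norm q ^ n"
    "\<And>n. n > 0 \<Longrightarrow> norm (c (- int n)) \<le> C * norm q ^ n"
  shows "c abs_summable_on UNIV"
  by (rule abs_summable_int_geometric_bound[of "norm q" _ C 0]) (use assms in auto)

text \<open>The constant left undetermined by the recursion for \<open>coeff_sum\<close>.\<close>

definition theta_coprod :: "complex \<Rightarrow> complex" where
  "theta_coprod q = (\<Sum>\<^sub>\<infinity>n. (-1) powi n * q powi (n\<^sup>2 + n) * inverse (1 + q powi (2 * n)))"

text \<open>The Lambert series 1 + 4 (q/(1 + q^2) + q^2/(1 + q^4) + ...) in bilateral form.\<close>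

definition two_squares_series :: "complex \<Rightarrow> complex" where
  "two_squares_series q = 2 * (\<Sum>\<^sub>\<infinity>m. q powi m * inverse (1 + q powi (2 * m)))"

lemma even_powi_minus: "even a \<Longrightarrow> (- q) powi a = q powi (a :: int)" for q :: complex
  by (simp add: power_int_minus_left)

lemma powi_minus_left: "(- q) powi a = (-1) powi a * q powi (a :: int)" for q :: complex
  by (simp flip: power_int_mult_distrib)

section \<open>The product of the two squares series and theta\<close>

context nome
begin

lemma nome_minus: "nome (- q)" using q0 q1 by unfold_locales auto

lemma nome_square: "nome (q\<^sup>2)"
  using q0 q1 by unfold_locales (auto simp: norm_power power_less_one_iff)

lemma power_square_le: "norm q ^ (n * n) \<le> norm q ^ n" "norm q ^ (n * n + n) \<le> norm q ^ n"
  using q1 by (auto intro!: power_decreasing)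

lemma powi_square_nat: "q powi ((int n)\<^sup>2) = q ^ (n * n)" "q powi ((- int n)\<^sup>2) = q ^ (n * n)"
  by (simp_all add: power2_eq_square flip: of_nat_mult)

lemma abs_summable_theta: "(\<lambda>n. q powi (n\<^sup>2)) abs_summable_on UNIV"
  by (rule abs_summable_quadratic[of q _ 1])
     (use q1 power_square_le in \<open>auto simp: powi_square_nat[simplified] powi_square_nat norm_power\<close>)

lemma powi_2: "q powi (2 * a) = q\<^sup>2 powi a"
  by (simp add: power_int_mult)

lemma norm_inverse_powi_2: "norm (inverse (1 + q powi (2 * n))) \<le> inverse (1 - norm q)" if "n > 0"
  for n :: int
proof -
  have "q powi (2 * n) = q ^ (2 * nat n)" using that by (simp add: power_int_def nat_mult_distrib)
  moreover have "norm (inverse (1 + q ^ (2 * nat n))) \<le> inverse (1 - norm q)"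
    by (rule norm_inverse_le(2)) (use that in simp)
  ultimately show ?thesis by simp
qed

lemma inverse_one_plus_powi_minus: "inverse (1 + q powi (2 * (- n))) = q powi (2 * n) * inverse (1 + q powi (2 * n))"
proof -
  define X where "X = q powi (2 * n)"
  have X: "X \<noteq> 0" "1 + X \<noteq> 0" using q0 powi_ne(1)[of "2 * n"] by (auto simp: X_def)
  have "q powi (2 * (- n)) = inverse X" by (simp add: X_def power_int_minus)
  moreover have "inverse (1 + inverse X) = X * inverse (1 + X)" using X by (simp add: field_simps)
  ultimately show ?thesis by (simp only: X_def)
qed

lemma norm_inverse_powi_2_le: "norm (inverse (1 + q powi (2 * n))) \<le> inverse (1 - norm q)"
proof (cases n "0 :: int" rule: linorder_cases)
  case less
  have "inverse (1 + q powi (2 * n)) = q powi (2 * - n) * inverse (1 + q powi (2 * - n))"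
    using inverse_one_plus_powi_minus[of "- n"] by simp
  moreover have le1: "norm (q powi (2 * - n)) \<le> 1"
    using less q1 by (simp add: power_int_def norm_power power_le_one)
  moreover have "norm (inverse (1 + q powi (2 * - n))) \<le> inverse (1 - norm q)"
    using less by (intro norm_inverse_powi_2) simp
  then have "norm (q powi (2 * - n)) * norm (inverse (1 + q powi (2 * - n))) \<le> 1 * inverse (1 - norm q)"
    by (intro mult_mono le1) auto
  ultimately show ?thesis
    by (simp only: norm_mult mult_1)
next
  case equal
  have "1 \<le> inverse (1 - norm q)" using q1 by (simp add: one_le_inverse)
  then show ?thesis using equal by (simp add: norm_inverse)
next
  case greater
  then show ?thesis by (rule norm_inverse_powi_2)
qed

lemma two_squares_term_bound:
  assumes "n > 0"
  shows "norm (q powi (int n) * inverse (1 + q powi (2 * int n))) \<le> inverse (1 - norm q) * norm q ^ n"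
    "q powi (- int n) * inverse (1 + q powi (2 * (- int n))) = q powi (int n) * inverse (1 + q powi (2 * int n))"
proof -
  show "norm (q powi (int n) * inverse (1 + q powi (2 * int n))) \<le> inverse (1 - norm q) * norm q ^ n"
    using mult_left_mono[OF norm_inverse_powi_2[of "int n"], of "norm q ^ n"] assms
    by (simp add: norm_mult norm_power mult.commute)
  have "q powi (- int n) * q powi (2 * int n) = q powi (int n)"
    using q0 by (simp flip: power_int_add)
  then show "q powi (- int n) * inverse (1 + q powi (2 * (- int n))) = q powi (int n) * inverse (1 + q powi (2 * int n))"
    unfolding inverse_one_plus_powi_minus by (simp only: mult.assoc[symmetric])
qed

lemma abs_summable_two_squares: "(\<lambda>m. q powi m * inverse (1 + q powi (2 * m))) abs_summable_on UNIV"
proof (rule abs_summable_quadratic[of q])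
  fix n :: nat assume n: "n > 0"
  show "norm (q powi (int n) * inverse (1 + q powi (2 * int n))) \<le> inverse (1 - norm q) * norm q ^ n"
    by (rule two_squares_term_bound(1)[OF n])
  then show "norm (q powi (- int n) * inverse (1 + q powi (2 * (- int n)))) \<le> inverse (1 - norm q) * norm q ^ n"
    by (simp only: two_squares_term_bound(2)[OF n])
qed (rule q1)

text \<open>The N-th convolution coefficient of the series for \<theta>(q) and for the two squares
  at -q, with the factor (-q)^N taken out.\<close>

definition coeff_sum :: "int \<Rightarrow> complex" where
  "coeff_sum N = (\<Sum>\<^sub>\<infinity>n. (-1) powi n * q powi (n\<^sup>2 - n) * inverse (1 + q powi (2 * (N - n))))"

lemma norm_signed_power: "norm ((-1) powi a * q powi int k) = norm q ^ k"
  by (simp add: norm_mult norm_power norm_power_int)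

lemma sum_antisymmetric: "((\<lambda>n. (-1) powi n * q powi (n\<^sup>2 + n)) has_sum 0) UNIV"
proof -
  let ?f = "\<lambda>n::int. (-1) powi n * q powi (n\<^sup>2 + n)"
  have "?f abs_summable_on UNIV"
  \<comment> \<open>At -n the exponent is (n-1)^2 + (n-1), which bounds n - 1 but not always n; the
    constant 1/|q| makes up for the missing power.\<close>
  proof (rule abs_summable_int_geometric_bound[of "norm q" _ "inverse (norm q)" 0])
    fix n :: nat assume n: "n > 0"
    have iq: "1 \<le> inverse (norm q)" using q0 q1 by (simp add: one_le_inverse)
    have e: "(int n)\<^sup>2 + int n = int (n * n + n)" by (simp add: power2_eq_square)
    have "norm (?f (int n)) = norm q ^ (n * n + n)"
      unfolding e by (rule norm_signed_power)
    also have "\<dots> \<le> inverse (norm q) * norm q ^ n"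
      using power_square_le(2)[of n] mult_right_mono[OF iq, of "norm q ^ n"] by simp
    finally show "norm (?f (int n)) \<le> inverse (norm q) * (real n ^ 0 * norm q ^ n)" by simp
    obtain k where k: "n = Suc k" using n by (cases n) auto
    have e': "(- int n)\<^sup>2 + (- int n) = int (k * k + k)" by (simp add: power2_eq_square k algebra_simps)
    have "norm (?f (- int n)) = norm q ^ (k * k + k)"
      unfolding e' by (rule norm_signed_power)
    also have "\<dots> \<le> norm q ^ k" by (rule power_square_le)
    also have "\<dots> = inverse (norm q) * norm q ^ n" using q0 by (simp add: k)
    finally show "norm (?f (- int n)) \<le> inverse (norm q) * (real n ^ 0 * norm q ^ n)" by simp
  qed (use q1 in auto)
  from abs_summable_summable[OF this] obtain s where s: "(?f has_sum s) UNIV"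
    by (auto simp: summable_on_def)
  also have "?this \<longleftrightarrow> ((\<lambda>n. - ?f n) has_sum s) UNIV"
  proof (rule has_sum_reindex_bij_witness[of _ "\<lambda>n. - 1 - n" "\<lambda>n. - 1 - n"])
    fix n :: int
    have "(- 1 - n)\<^sup>2 + (- 1 - n) = n\<^sup>2 + n" by (simp add: power2_eq_square algebra_simps)
    moreover have "(-1 :: complex) powi (- 1 - n) = - ((-1) powi n)"
      by (simp add: power_int_minus_left)
    ultimately show "- ?f (- 1 - n) = ?f n" by (simp only: mult_minus_left minus_minus)
  qed auto
  finally have "s = - s" by (rule has_sum_unique[OF _ has_sum_uminusI[OF s]])
  then show ?thesis using s by simp
qed

lemma abs_summable_coeff: "(\<lambda>n. (-1) powi n * q powi (n\<^sup>2 - n) * inverse (1 + q powi (2 * (N - n)))) abs_summable_on UNIV"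
proof (rule abs_summable_int_geometric_bound[of "norm q" _ "inverse (1 - norm q) * inverse (norm q)" 0])
  let ?f = "\<lambda>n. (-1) powi n * q powi (n\<^sup>2 - n) * inverse (1 + q powi (2 * (N - n)))"
  have bound: "norm (?f n) \<le> inverse (1 - norm q) * norm q ^ k" if "n\<^sup>2 - n = int k" for n k
  proof -
    have "norm (?f n) = norm q ^ k * norm (inverse (1 + q powi (2 * (N - n))))"
      unfolding that by (simp only: norm_mult[of _ "inverse _"] norm_signed_power)
    also have "\<dots> \<le> norm q ^ k * inverse (1 - norm q)"
      by (intro mult_left_mono norm_inverse_powi_2_le) auto
    finally show ?thesis by (simp add: mult.commute)
  qed
  have pos: "0 \<le> inverse (1 - norm q)" using q1 by simp
  have iq: "1 \<le> inverse (norm q)" using q0 q1 by (simp add: one_le_inverse)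
  fix n :: nat assume n: "n > 0"
  obtain k where k: "n = Suc k" using n by (cases n) auto
  have "(int n)\<^sup>2 - int n = int (k * k + k)" by (simp add: power2_eq_square k algebra_simps)
  then have "norm (?f (int n)) \<le> inverse (1 - norm q) * norm q ^ (k * k + k)" by (rule bound)
  also have "\<dots> \<le> inverse (1 - norm q) * norm q ^ k"
    by (intro mult_left_mono power_square_le pos)
  also have "norm q ^ k = inverse (norm q) * norm q ^ n" using q0 by (simp add: k)
  finally show "norm (?f (int n)) \<le> inverse (1 - norm q) * inverse (norm q) * (real n ^ 0 * norm q ^ n)"
    by (simp only: mult.assoc power_0 mult_1)
  have "(- int n)\<^sup>2 - (- int n) = int (n * n + n)" by (simp add: power2_eq_square)
  then have "norm (?f (- int n)) \<le> inverse (1 - norm q) * norm q ^ (n * n + n)" by (rule bound)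
  also have "\<dots> \<le> inverse (1 - norm q) * norm q ^ n"
    by (intro mult_left_mono power_square_le pos)
  also have "\<dots> \<le> inverse (1 - norm q) * (inverse (norm q) * norm q ^ n)"
    using mult_right_mono[OF iq, of "norm q ^ n"] by (intro mult_left_mono pos) simp
  finally show "norm (?f (- int n)) \<le> inverse (1 - norm q) * inverse (norm q) * (real n ^ 0 * norm q ^ n)"
    by (simp only: mult.assoc power_0 mult_1)
qed (use q1 in auto)

text \<open>Multiplying the two squares series by \<open>\<theta>\<close> gives a Laurent series in the nome whose coefficients satisfy
  this first-order recursion; the inhomogeneous term vanishes by \<open>n \<mapsto> -1 - n\<close>.\<close>

lemma coeff_sum_Suc: "coeff_sum (N + 1) = q powi (2 * N) * coeff_sum N"
proof -
  let ?g = "\<lambda>n. (-1) powi n * q powi (n\<^sup>2 - n) * inverse (1 + q powi (2 * (N - n)))"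
  have "((\<lambda>n. (-1) powi n * q powi (n\<^sup>2 - n) * inverse (1 + q powi (2 * (N + 1 - n)))) has_sum coeff_sum (N + 1)) UNIV"
    unfolding coeff_sum_def by (intro has_sum_infsum abs_summable_summable[OF abs_summable_coeff])
  also have "?this \<longleftrightarrow> ((\<lambda>n. q powi (2 * N) * ?g n - (-1) powi n * q powi (n\<^sup>2 + n)) has_sum coeff_sum (N + 1)) UNIV"
  proof (rule has_sum_reindex_bij_witness[of _ "\<lambda>n. n + 1" "\<lambda>n. n - 1"])
    fix a :: int
    define n where "n = a - 1"
    define Y where "Y = 1 + q powi (2 * (N - n))"
    have Y: "Y \<noteq> 0" unfolding Y_def by (rule powi_ne)
    have a: "a = n + 1" by (simp add: n_def)
    have e: "(n + 1)\<^sup>2 - (n + 1) = n\<^sup>2 + n" by (simp add: power2_eq_square algebra_simps)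
    have e': "q powi (n\<^sup>2 + n) = q powi (n\<^sup>2 - n) * q powi (2 * n)"
      using q0 by (simp add: add.commute flip: power_int_add)
    have sgn: "(-1 :: complex) powi (n + 1) = - ((-1) powi n)" by (simp add: power_int_minus_left)
    have Y': "1 + q powi (2 * (N + 1 - (n + 1))) = Y" by (simp add: Y_def)
    \<comment> \<open>With Y = 1 + q^(2(N-n)), dividing by Y turns q^(2n)/Y into q^(2n) - q^(2N)/Y:
      a term free of N and the summand for N.\<close>
    have "q powi (2 * n) * Y = q powi (2 * n) + q powi (2 * N)"
      using q0 by (simp add: Y_def distrib_left flip: power_int_add)
    then have "q powi (2 * N) * inverse Y - q powi (2 * n) = - (q powi (2 * n) * inverse Y) - q powi (2 * n) + (q powi (2 * n) + q powi (2 * N)) * inverse Y"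
      by (simp add: algebra_simps)
    also have "\<dots> = - (q powi (2 * n) * inverse Y)"
      using Y by (simp add: \<open>q powi (2 * n) * Y = _\<close>[symmetric])
    finally have *: "q powi (2 * N) * inverse Y - q powi (2 * n) = - (q powi (2 * n) * inverse Y)" .
    have "(-1) powi a * q powi (a\<^sup>2 - a) * inverse (1 + q powi (2 * (N + 1 - a)))
        = - ((-1) powi n * q powi (n\<^sup>2 - n) * (q powi (2 * n) * inverse Y))"
      unfolding a e e' sgn Y' by (simp only: mult_ac mult_minus_left mult_minus_right)
    also have "\<dots> = (-1) powi n * q powi (n\<^sup>2 - n) * (q powi (2 * N) * inverse Y - q powi (2 * n))"
      unfolding * by simp
    also have "\<dots> = q powi (2 * N) * ?g n - (-1) powi n * q powi (n\<^sup>2 + n)"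
      unfolding e' Y_def[symmetric] by (simp only: right_diff_distrib mult_ac)
    finally show "q powi (2 * N) * ?g (a - 1) - (-1) powi (a - 1) * q powi ((a - 1)\<^sup>2 + (a - 1))
      = (-1) powi a * q powi (a\<^sup>2 - a) * inverse (1 + q powi (2 * (N + 1 - a)))"
      by (simp only: n_def)
  qed auto
  finally have 1: "((\<lambda>n. q powi (2 * N) * ?g n - (-1) powi n * q powi (n\<^sup>2 + n)) has_sum coeff_sum (N + 1)) UNIV" .
  have "(?g has_sum coeff_sum N) UNIV"
    unfolding coeff_sum_def by (intro has_sum_infsum abs_summable_summable[OF abs_summable_coeff])
  from has_sum_unique[OF 1 has_sum_diff[OF has_sum_cmult_right[OF this] sum_antisymmetric]]
  show ?thesis by simp
qed

lemma coeff_sum_eq: "coeff_sum N = q powi (N\<^sup>2 - N) * coeff_sum 0"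
proof (induction N rule: int_induct[where k = 0])
  case (step1 i)
  have eq: "(i + 1)\<^sup>2 - (i + 1) = 2 * i + (i\<^sup>2 - i)" by (simp add: power2_eq_square algebra_simps)
  have "q powi ((i + 1)\<^sup>2 - (i + 1)) = q powi (2 * i) * q powi (i\<^sup>2 - i)"
    unfolding eq by (rule power_int_add) (use q0 in simp)
  then show ?case unfolding coeff_sum_Suc step1(2) by (simp only: mult.assoc)
next
  case (step2 i)
  have "q powi (2 * (i - 1)) * coeff_sum (i - 1) = q powi (i\<^sup>2 - i) * coeff_sum 0"
    using coeff_sum_Suc[of "i - 1"] step2(2) by simp
  moreover have eq: "i\<^sup>2 - i = 2 * (i - 1) + ((i - 1)\<^sup>2 - (i - 1))" by (simp add: power2_eq_square algebra_simps)
  have "q powi (i\<^sup>2 - i) = q powi (2 * (i - 1)) * q powi ((i - 1)\<^sup>2 - (i - 1))"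
    by (subst eq, rule power_int_add) (use q0 in simp)
  ultimately have "q powi (2 * (i - 1)) * coeff_sum (i - 1) = q powi (2 * (i - 1)) * (q powi ((i - 1)\<^sup>2 - (i - 1)) * coeff_sum 0)"
    by (simp only: mult.assoc)
  then show ?case using q0 by simp
qed simp

lemma coeff_sum_0: "coeff_sum 0 = theta_coprod q"
  unfolding coeff_sum_def theta_coprod_def
proof (rule infsum_cong)
  fix n :: int
  have eq: "n\<^sup>2 + n = (n\<^sup>2 - n) + 2 * n" by simp
  have "q powi (n\<^sup>2 + n) = q powi (n\<^sup>2 - n) * q powi (2 * n)"
    unfolding eq by (rule power_int_add) (use q0 in simp)
  moreover have "inverse (1 + q powi (2 * (0 - n))) = q powi (2 * n) * inverse (1 + q powi (2 * n))"
    using inverse_one_plus_powi_minus[of n] by simp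
  ultimately show "(-1) powi n * q powi (n\<^sup>2 - n) * inverse (1 + q powi (2 * (0 - n))) = (-1) powi n * q powi (n\<^sup>2 + n) * inverse (1 + q powi (2 * n))"
    by (simp only: mult.assoc)
qed

text \<open>The recursion makes the N-th convolution coefficient a multiple of (-q)^(N^2). Taking
  the two squares series at -q produces the sign (-1)^n that makes the inhomogeneous term of the
  recursion antisymmetric.\<close>

lemma two_squares_mult_theta: "two_squares_series (- q) * theta3_0 q = 2 * theta_coprod q * theta3_0 (- q)"
proof -
  interpret m: nome "- q" by (rule nome_minus)
  let ?u = "\<lambda>n. q powi (n\<^sup>2)"
  let ?v = "\<lambda>m. (- q) powi m * inverse (1 + (- q) powi (2 * m))"
  have "((\<lambda>N. \<Sum>\<^sub>\<infinity>n. ?u n * ?v (N - n)) has_sum infsum ?u UNIV * infsum ?v UNIV) UNIV"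
    by (rule infsum_int_product[OF abs_summable_theta m.abs_summable_two_squares])
  moreover have "(\<Sum>\<^sub>\<infinity>n. ?u n * ?v (N - n)) = (- q) powi (N\<^sup>2) * theta_coprod q" for N
  proof -
    have "?u n * ?v (N - n) = (- q) powi N * ((-1) powi n * q powi (n\<^sup>2 - n) * inverse (1 + q powi (2 * (N - n))))" for n
    proof -
      have "(- q) powi (2 * (N - n)) = q powi (2 * (N - n))" by (rule even_powi_minus) simp
      moreover have "(- q) powi (N - n) = (- q) powi N * ((-1) powi n * q powi (- n))"
        using q0 powi_minus_left[of q "- n"] by (simp add: power_int_diff power_int_minus field_simps)
      moreover have "q powi (n\<^sup>2) * q powi (- n) = q powi (n\<^sup>2 - n)"
        using q0 by (simp flip: power_int_add)
      ultimately show ?thesis by (simp add: mult_ac)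
    qed
    then have "(\<Sum>\<^sub>\<infinity>n. ?u n * ?v (N - n)) = (- q) powi N * coeff_sum N"
      by (simp only: infsum_cmult_right' coeff_sum_def)
    also have "\<dots> = (- q) powi N * (- q) powi (N\<^sup>2 - N) * theta_coprod q"
      unfolding coeff_sum_eq[of N] coeff_sum_0
      using even_powi_minus[of "N\<^sup>2 - N" q] by (simp add: power2_eq_square)
    also have "(- q) powi N * (- q) powi (N\<^sup>2 - N) = (- q) powi (N\<^sup>2)"
    proof -
      have "- q \<noteq> 0" using q0 by simp
      from power_int_add[OF disjI1[OF this], of "N\<^sup>2 - N" N, unfolded diff_add_cancel]
      show ?thesis by (simp only: mult.commute)
    qed
    finally show ?thesis .
  qed
  ultimately have 1: "((\<lambda>N. (- q) powi (N\<^sup>2) * theta_coprod q) has_sum infsum ?u UNIV * infsum ?v UNIV) UNIV"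
    by simp
  have "((\<lambda>N. (- q) powi (N\<^sup>2) * theta_coprod q) has_sum infsum (\<lambda>N. (- q) powi (N\<^sup>2)) UNIV * theta_coprod q) UNIV"
    by (intro has_sum_cmult_left has_sum_infsum abs_summable_summable[OF m.abs_summable_theta])
  from has_sum_unique[OF 1 this] show ?thesis
    by (simp add: two_squares_series_def theta3_0_def mult_ac)
qed

lemma theta_coprod_minus: "theta_coprod (- q) = theta_coprod q"
  unfolding theta_coprod_def
  by (intro infsum_cong) (simp add: even_powi_minus power2_eq_square)

text \<open>Here it matters that \<open>theta_coprod\<close> is even in \<open>q\<close>, which replaces the evaluation of that constant by a product formula.\<close>

lemma two_squares_swap: "two_squares_series q * (theta3_0 (- q))\<^sup>2 = two_squares_series (- q) * (theta3_0 q)\<^sup>2"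
proof -
  interpret m: nome "- q" by (rule nome_minus)
  have 1: "two_squares_series q * theta3_0 (- q) = 2 * theta_coprod q * theta3_0 q"
    using m.two_squares_mult_theta by (simp add: theta_coprod_minus)
  have "two_squares_series q * (theta3_0 (- q))\<^sup>2 = (two_squares_series q * theta3_0 (- q)) * theta3_0 (- q)"
    by (simp add: power2_eq_square)
  also have "\<dots> = (two_squares_series (- q) * theta3_0 q) * theta3_0 q"
    unfolding 1 two_squares_mult_theta by simp
  finally show ?thesis by (simp add: power2_eq_square)
qed

text \<open>Terms of odd index cancel, and a term of even index 2m is the term of index m for
  q^2.\<close>

lemma two_squares_add: "two_squares_series q + two_squares_series (- q) = 2 * two_squares_series (q\<^sup>2)"
proof -
  interpret m: nome "- q" by (rule nome_minus)
  let ?f = "\<lambda>m. q powi m * inverse (1 + q powi (2 * m))"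
  have "(\<lambda>m. ?f m + (- q) powi m * inverse (1 + (- q) powi (2 * m))) = (\<lambda>m. if even m then 2 * ?f m else 0)"
    by (auto simp: fun_eq_iff even_powi_minus power_int_minus_left)
  moreover have "infsum (\<lambda>m. ?f m + (- q) powi m * inverse (1 + (- q) powi (2 * m))) UNIV
      = infsum ?f UNIV + (\<Sum>\<^sub>\<infinity>m. (- q) powi m * inverse (1 + (- q) powi (2 * m)))"
    by (intro infsum_add abs_summable_summable[OF abs_summable_two_squares] abs_summable_summable[OF m.abs_summable_two_squares])
  ultimately have "two_squares_series q + two_squares_series (- q) = 2 * (\<Sum>\<^sub>\<infinity>m. if even m then 2 * ?f m else 0)"
    by (simp add: two_squares_series_def)
  also have "(\<Sum>\<^sub>\<infinity>m. if even m then 2 * ?f m else 0) = (\<Sum>\<^sub>\<infinity>m\<in>{m. even m}. 2 * ?f m)"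
    by (rule infsum_cong_neutral) auto
  also have "\<dots> = (\<Sum>\<^sub>\<infinity>m. 2 * (q\<^sup>2 powi m * inverse (1 + q\<^sup>2 powi (2 * m))))"
    by (rule infsum_reindex_bij_witness[of _ "\<lambda>m. 2 * m" "\<lambda>m. m div 2"]) (auto simp: powi_2)
  also have "\<dots> = two_squares_series (q\<^sup>2)"
    by (simp add: infsum_cmult_right' two_squares_series_def)
  finally show ?thesis .
qed

text \<open>Pairs (a, b) with a + b odd cancel; the others are (u + v, u - v), and (u + v)^2 + (u -
  v)^2 = 2 u^2 + 2 v^2.\<close>

lemma theta_square_add: "(theta3_0 q)\<^sup>2 + (theta3_0 (- q))\<^sup>2 = 2 * (theta3_0 (q\<^sup>2))\<^sup>2"
proof -
  interpret m: nome "- q" by (rule nome_minus)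
  interpret s: nome "q\<^sup>2" by (rule nome_square)
  have prod: "((\<lambda>(a, b). r powi (a\<^sup>2) * r powi (b\<^sup>2)) has_sum (theta3_0 r)\<^sup>2) UNIV" if "nome r" for r
  proof -
    interpret r: nome r by fact
    let ?f = "\<lambda>(a, b). r powi (a\<^sup>2) * r powi (b\<^sup>2)"
    have sm: "?f summable_on UNIV \<times> UNIV"
      using abs_summable_summable[OF abs_summable_Times[OF r.abs_summable_theta r.abs_summable_theta]] by simp
    have "infsum ?f (UNIV \<times> UNIV) = (theta3_0 r)\<^sup>2"
      using infsum_Sigma'_banach[OF sm] by (simp add: infsum_cmult_left' infsum_cmult_right' theta3_0_def power2_eq_square)
    then show ?thesis using has_sum_infsum[OF sm] by simp
  qed
  let ?g = "\<lambda>(a, b). q powi (a\<^sup>2) * q powi (b\<^sup>2)"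
  have "((\<lambda>z. ?g z + (case z of (a, b) \<Rightarrow> (- q) powi (a\<^sup>2) * (- q) powi (b\<^sup>2))) has_sum ((theta3_0 q)\<^sup>2 + (theta3_0 (- q))\<^sup>2)) UNIV"
    by (rule has_sum_add[OF prod[OF nome_axioms] prod[OF nome_minus]])
  also have "?this \<longleftrightarrow> ((\<lambda>(a, b). 2 * (q powi (a\<^sup>2) * q powi (b\<^sup>2))) has_sum ((theta3_0 q)\<^sup>2 + (theta3_0 (- q))\<^sup>2)) {(a, b). even (a + b)}"
    by (rule has_sum_cong_neutral) (auto simp: power_int_minus_left split: if_splits)
  also have "\<dots> \<longleftrightarrow> ((\<lambda>(u, v). 2 * (q\<^sup>2 powi (u\<^sup>2) * q\<^sup>2 powi (v\<^sup>2))) has_sum ((theta3_0 q)\<^sup>2 + (theta3_0 (- q))\<^sup>2)) UNIV"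
  proof (rule has_sum_reindex_bij_witness[of _ "\<lambda>(u, v). (u + v, u - v)" "\<lambda>(a, b). ((a + b) div 2, (a - b) div 2)"])
    fix z :: "int \<times> int" assume "z \<in> {(a, b). even (a + b)}"
    then obtain u v where z: "z = (u + v, u - v)"
    proof -
      obtain a b where ab: "z = (a, b)" "even (a + b)" using \<open>z \<in> _\<close> by (cases z) auto
      then have "(a + b) div 2 + (a - b) div 2 = a" "(a + b) div 2 - (a - b) div 2 = b" by presburger+
      then show thesis using that[of "(a + b) div 2" "(a - b) div 2"] ab by simp
    qed
    have "(u + v)\<^sup>2 + (u - v)\<^sup>2 = 2 * u\<^sup>2 + 2 * v\<^sup>2" by (simp add: power2_eq_square algebra_simps)
    then have "q powi ((u + v)\<^sup>2) * q powi ((u - v)\<^sup>2) = q\<^sup>2 powi (u\<^sup>2) * q\<^sup>2 powi (v\<^sup>2)"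
      using q0 by (simp flip: power_int_add powi_2)
    then show "(case (case z of (a, b) \<Rightarrow> ((a + b) div 2, (a - b) div 2)) of (u, v) \<Rightarrow> 2 * (q\<^sup>2 powi (u\<^sup>2) * q\<^sup>2 powi (v\<^sup>2)))
        = (case z of (a, b) \<Rightarrow> 2 * (q powi (a\<^sup>2) * q powi (b\<^sup>2)))"
      by (simp add: z)
    show "(case (case z of (a, b) \<Rightarrow> ((a + b) div 2, (a - b) div 2)) of (u, v) \<Rightarrow> (u + v, u - v)) = z"
      by (simp add: z)
  qed auto
  finally have 1: "((\<lambda>(u, v). 2 * (q\<^sup>2 powi (u\<^sup>2) * q\<^sup>2 powi (v\<^sup>2))) has_sum ((theta3_0 q)\<^sup>2 + (theta3_0 (- q))\<^sup>2)) UNIV" .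
  have "((\<lambda>(u, v). 2 * (q\<^sup>2 powi (u\<^sup>2) * q\<^sup>2 powi (v\<^sup>2))) has_sum (2 * (theta3_0 (q\<^sup>2))\<^sup>2)) UNIV"
    using has_sum_cmult_right[OF prod[OF nome_square], of 2] by (simp add: case_prod_unfold)
  from has_sum_unique[OF 1 this] show ?thesis .
qed

text \<open>With B for the two squares series: multiply \<open>theta_square_add\<close> by B(q),
  trade B(q) \<theta>(-q)^2 for B(-q) \<theta>(q)^2, and B(q) + B(-q) appears.\<close>

lemma two_squares_doubling: "two_squares_series q * (theta3_0 (q\<^sup>2))\<^sup>2 = two_squares_series (q\<^sup>2) * (theta3_0 q)\<^sup>2"
proof -
  have "2 * (two_squares_series q * (theta3_0 (q\<^sup>2))\<^sup>2) = two_squares_series q * ((theta3_0 q)\<^sup>2 + (theta3_0 (- q))\<^sup>2)"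
    by (simp add: theta_square_add)
  also have "\<dots> = (two_squares_series q + two_squares_series (- q)) * (theta3_0 q)\<^sup>2"
    by (simp add: distrib_left distrib_right two_squares_swap)
  also have "\<dots> = 2 * (two_squares_series (q\<^sup>2) * (theta3_0 q)\<^sup>2)"
    by (simp add: two_squares_add)
  finally show ?thesis by simp
qed

text \<open>The one-sided form serves the holomorphy argument on the whole unit disc, where q = 0 is
  included.\<close>

lemma theta3_0_eq_suminf: "theta3_0 q = 1 + 2 * (\<Sum>n. if n = 0 then 0 else q ^ (n * n))"
  unfolding theta3_0_def infsum_int_split[OF abs_summable_theta] powi_square_nat by simp

lemma two_squares_series_eq_suminf:
  "two_squares_series q = 1 + 4 * (\<Sum>n. if n = 0 then 0 else q ^ n * inverse (1 + q ^ (2 * n)))"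
proof -
  have p: "q powi (2 * int n) = q ^ (2 * n)" for n
    using power_int_of_nat[of q "2 * n"] by (simp only: of_nat_mult of_nat_numeral)
  have pos: "(if n = 0 then 0 else q powi (int n) * inverse (1 + q powi (2 * int n)))
      = (if n = 0 then 0 else q ^ n * inverse (1 + q ^ (2 * n)))" for n
    by (simp only: p power_int_of_nat)
  have neg: "(if n = 0 then 0 else q powi (- int n) * inverse (1 + q powi (2 * (- int n))))
      = (if n = 0 then 0 else q ^ n * inverse (1 + q ^ (2 * n)))" for n
    using two_squares_term_bound(2)[of n] pos[of n] by (cases "n = 0") simp_all
  show ?thesis
    unfolding two_squares_series_def infsum_int_split[OF abs_summable_two_squares] pos neg by simp
qed

end

lemma holomorphic_suminf_unit_ball:
  fixes f :: "nat \<Rightarrow> complex \<Rightarrow> complex"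
  assumes f: "\<And>n. f n holomorphic_on ball 0 1"
    and bound: "\<And>r. 0 < r \<Longrightarrow> r < 1 \<Longrightarrow> \<exists>M. summable M \<and> (\<forall>n z. norm z \<le> r \<longrightarrow> norm (f n z) \<le> M n)"
  shows "(\<lambda>z. \<Sum>n. f n z) holomorphic_on ball 0 1"
proof (rule holomorphic_uniform_sequence)
  show "(\<lambda>z. \<Sum>i<n. f i z) holomorphic_on ball 0 1" for n
    by (intro holomorphic_intros f)
  fix x :: complex assume x: "x \<in> ball 0 1"
  define r where "r = (1 + norm x) / 2"
  have r: "0 < r" "r < 1" using x by (auto simp: r_def add_pos_nonneg)
  have d: "norm z \<le> r" if "z \<in> cball x ((1 - norm x) / 2)" for z
    using that norm_triangle_ineq2[of z x] by (auto simp: r_def dist_norm norm_minus_commute)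
  obtain M where M: "summable M" "\<And>n z. norm z \<le> r \<Longrightarrow> norm (f n z) \<le> M n"
    using bound[OF r] by blast
  have "uniform_limit (cball x ((1 - norm x) / 2)) (\<lambda>n z. \<Sum>i<n. f i z) (\<lambda>z. \<Sum>n. f n z) sequentially"
    by (rule Weierstrass_m_test[OF _ M(1)]) (use M(2) d in blast)
  moreover have "cball x ((1 - norm x) / 2) \<subseteq> ball 0 1"
    using d r by fastforce
  ultimately show "\<exists>d>0. cball x d \<subseteq> ball 0 1 \<and> uniform_limit (cball x d) (\<lambda>n z. \<Sum>i<n. f i z) (\<lambda>z. \<Sum>n. f n z) sequentially"
    using x by (intro exI[of _ "(1 - norm x) / 2"]) auto
qed simp

text \<open>Invariance under z -> z^2 holds for the quotient B / T^2, which is defined only where T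
  has no zero. It is therefore used near 0, where repeated squaring and continuity give the value 1;
  the identity B = T^2, free of division, then extends to the disc.\<close>

theorem two_squares:
  assumes "nome q"
  shows "two_squares_series q = (theta3_0 q)\<^sup>2"
proof -
  define B where "B q = 1 + 4 * (\<Sum>n. if n = 0 then 0 else q ^ n * inverse (1 + q ^ (2 * n)))" for q :: complex
  define T where "T q = 1 + 2 * (\<Sum>n. if n = 0 then 0 else q ^ (n * n))" for q :: complex
  have B: "B q = two_squares_series q" and T: "T q = theta3_0 q" if "nome q" for q
    using nome.two_squares_series_eq_suminf[OF that] nome.theta3_0_eq_suminf[OF that] by (simp_all add: B_def T_def)
  have nome: "nome z" if "z \<noteq> 0" "norm z < 1" for z
    using that by (simp add: nome_def)
  have ne: "1 + z ^ (2 * n) \<noteq> 0" if "norm z < 1" "n > 0" for z :: complex and n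
  proof (cases "z = 0")
    case False
    then show ?thesis using nome.power_ne(1)[OF nome, of z "2 * n"] that by simp
  qed (use that in \<open>simp add: power_0_left\<close>)
  have Bh: "B holomorphic_on ball 0 1"
    unfolding B_def
  proof (intro holomorphic_intros holomorphic_suminf_unit_ball)
    show "(\<lambda>z. if n = 0 then 0 else z ^ n * inverse (1 + z ^ (2 * n))) holomorphic_on ball 0 1" for n
      using ne by (cases "n = 0") (auto intro!: holomorphic_intros)
    fix r :: real assume r: "0 < r" "r < 1"
    have "norm (if n = 0 then 0 else z ^ n * inverse (1 + z ^ (2 * n))) \<le> inverse (1 - r) * r ^ n"
      if z: "norm z \<le> r" for n and z :: complex
    proof (cases "n = 0 \<or> z = 0")
      case False
      interpret z: nome z using False z r by (intro nome) auto
      have "norm (inverse (1 + z ^ (2 * n))) \<le> inverse (1 - norm z)"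
        using False by (intro z.norm_inverse_le) simp
      also have "\<dots> \<le> inverse (1 - r)" using z r by (intro le_imp_inverse_le) auto
      finally have "norm z ^ n * norm (inverse (1 + z ^ (2 * n))) \<le> r ^ n * inverse (1 - r)"
        using z r by (intro mult_mono power_mono) auto
      then show ?thesis using False by (simp add: norm_mult norm_power mult.commute)
    qed (use r in \<open>auto simp: power_0_left\<close>)
    moreover have "summable (\<lambda>n. inverse (1 - r) * r ^ n)"
      using r by (intro summable_mult summable_geometric) auto
    ultimately show "\<exists>M. summable M \<and> (\<forall>n z. norm (z::complex) \<le> r \<longrightarrow> norm (if n = 0 then 0 else z ^ n * inverse (1 + z ^ (2 * n))) \<le> M n)"
      by blast
  qed
  have Th: "T holomorphic_on ball 0 1"
    unfolding T_def
  proof (intro holomorphic_intros holomorphic_suminf_unit_ball)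
    show "(\<lambda>z::complex. if n = 0 then 0 else z ^ (n * n)) holomorphic_on ball 0 1" for n
      by (cases "n = 0") (auto intro!: holomorphic_intros)
    fix r :: real assume r: "0 < r" "r < 1"
    have "norm (if n = 0 then 0 else z ^ (n * n)) \<le> r ^ n" if z: "norm z \<le> r" for n and z :: complex
    proof (cases "n = 0")
      case False
      have "norm z ^ (n * n) \<le> norm z ^ n" using False z r by (intro power_decreasing) auto
      also have "\<dots> \<le> r ^ n" using z by (intro power_mono) auto
      finally show ?thesis using False by (simp add: norm_power)
    qed (use r in auto)
    moreover have "summable (\<lambda>n. r ^ n)" using r by (intro summable_geometric) auto
    ultimately show "\<exists>M. summable M \<and> (\<forall>n z. norm (z::complex) \<le> r \<longrightarrow> norm (if n = 0 then 0 else z ^ (n * n)) \<le> M n)"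
      by blast
  qed
  have suminf0: "(\<Sum>n. if n = 0 then 0 else f n) = 0" if "\<And>n. n > 0 \<Longrightarrow> f n = 0" for f :: "nat \<Rightarrow> complex"
  proof -
    have "(\<lambda>n. if n = 0 then 0 else f n) = (\<lambda>_. 0)" using that by auto
    then show ?thesis by simp
  qed
  have T0: "T 0 = 1" and B0: "B 0 = 1"
    unfolding T_def B_def by (simp_all add: suminf0)
  have contT: "isCont T 0" and contB: "isCont B 0"
    using holomorphic_on_imp_continuous_on[OF Th] holomorphic_on_imp_continuous_on[OF Bh]
    by (simp_all add: continuous_on_eq_continuous_at)
  have "\<forall>\<^sub>F z in nhds 0. T z \<noteq> 0"
    using contT T0 by (intro tendsto_imp_eventually_ne[of _ 1]) (simp_all add: isCont_def tendsto_nhds_iff)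
  then obtain d' where d': "d' > 0" "\<And>z. dist z 0 < d' \<Longrightarrow> T z \<noteq> 0"
    by (auto simp: eventually_nhds_metric)
  \<comment> \<open>The bound 1 ensures that squaring stays inside the disc where T is
    nonzero.\<close>
  define d where "d = min d' 1"
  have d: "d > 0" "d \<le> 1" "\<And>z. norm z < d \<Longrightarrow> T z \<noteq> 0"
    using d' by (auto simp: d_def)
  define R where "R z = B z / (T z)\<^sup>2" for z
  have sq: "norm (z\<^sup>2) < d" if "norm z < d" for z :: complex
  proof -
    have "norm z * norm z \<le> norm z * 1" using that d(2) by (intro mult_left_mono) auto
    then show ?thesis using that by (simp add: norm_mult power2_eq_square)
  qed
  have R2: "R z = R (z\<^sup>2)" if z: "norm z < d" for z
  proof (cases "z = 0")
    case False
    interpret z: nome z using False z d(2) by (intro nome) auto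
    have "B z * (T (z\<^sup>2))\<^sup>2 = B (z\<^sup>2) * (T z)\<^sup>2"
      using z.two_squares_doubling by (simp only: B[OF z.nome_axioms] T[OF z.nome_axioms] B[OF z.nome_square] T[OF z.nome_square])
    then show ?thesis
      using d(3)[OF z] d(3)[OF sq[OF z]] by (simp add: R_def frac_eq_eq)
  qed simp
  have "R z = 1" if z: "norm z < d" for z
  proof -
    have pow: "R z = R (z ^ (2 ^ k)) \<and> norm (z ^ (2 ^ k)) < d" for k
    proof (induction k)
      case (Suc k)
      have "z ^ (2 ^ Suc k) = (z ^ (2 ^ k))\<^sup>2" by (simp add: mult.commute flip: power_mult)
      then show ?case using Suc R2[of "z ^ (2 ^ k)"] sq[of "z ^ (2 ^ k)"] by metis
    qed (use z in simp)
    have "isCont R 0"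
      unfolding R_def using contT contB T0 by (intro continuous_intros) auto
    moreover have "(\<lambda>k. z ^ (2 ^ k)) \<longlonglongrightarrow> 0"
    proof -
      have "(\<lambda>n. z ^ n) \<longlonglongrightarrow> 0" using z d(2) by (intro LIMSEQ_power_zero) auto
      moreover have "filterlim (\<lambda>k::nat. 2 ^ k :: nat) at_top sequentially"
        by (rule filterlim_subseq) (simp add: strict_mono_def)
      ultimately show ?thesis by (rule filterlim_compose)
    qed
    ultimately have "(\<lambda>k. R (z ^ (2 ^ k))) \<longlonglongrightarrow> R 0"
      by (rule isCont_tendsto_compose)
    then have "(\<lambda>k. R z) \<longlonglongrightarrow> R 0" using pow by simp
    then have "R z = R 0" by (simp add: LIMSEQ_const_iff)
    then show ?thesis by (simp add: R_def T0 B0)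
  qed
  then have eq: "B z = (T z)\<^sup>2" if "z \<in> ball 0 d" for z
    using that d(3)[of z] by (simp add: R_def)
  have "B q = (T q)\<^sup>2"
  proof (rule analytic_continuation_open[of "ball 0 d" "ball 0 1" B "\<lambda>z. (T z)\<^sup>2"])
    show "(\<lambda>z. (T z)\<^sup>2) holomorphic_on ball 0 1" using Th by (intro holomorphic_intros)
    show "q \<in> ball 0 1" using assms by (simp add: nome_def)
    show "(ball 0 d :: complex set) \<subseteq> ball 0 1" using d(2) by (intro subset_ball)
  qed (use Bh eq d(1) in auto)
  then show ?thesis by (simp add: B T assms)
qed

section \<open>The four squares theorem and the comparison of determinants\<close>

context nome
begin

text \<open>Two nomes meet here: the square of \<open>phi_sum\<close> for q^2 at x = -q is a
  difference of two Lambert series in q^2, which combine termwise to the series for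
  \<open>phi'(0)\<close> of the nome q.\<close>

theorem theta_fourth_power: "(theta3_0 (- q)) ^ 4 = - 4 * deriv phi 0"
proof -
  interpret Q: nome "q\<^sup>2" by (rule nome_square)
  \<comment> \<open>-q lies in the annulus of convergence for the nome q^2.\<close>
  have x: "norm (q\<^sup>2) < norm (- q)" "norm (- q) < 1"
    using q0 q1 mult_strict_left_mono[of "norm q" 1 "norm q"] by (simp_all add: norm_mult power2_eq_square)
  have "two_squares_series (- q) = 2 * Q.phi_sum (- q)"
    unfolding two_squares_series_def Q.phi_sum_def Q.gp_def powi_2[symmetric] by (simp add: even_powi_minus)
  moreover have "two_squares_series (- q) = (theta3_0 (- q))\<^sup>2"
    by (rule two_squares[OF nome_minus])
  ultimately have "(theta3_0 (- q)) ^ 4 = (2 * Q.phi_sum (- q))\<^sup>2"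
    by (simp add: power2_eq_square power4_eq_xxxx)
  also have "\<dots> = 4 * (Q.wp_sum 1 (- q) - Q.wp 0)"
    unfolding power_mult_distrib Q.phi_square(2)[OF x] by simp
  also have "Q.wp_sum 1 (- q) = 2 * (\<Sum>n. of_nat n * (- q) ^ n * inverse (1 - q ^ (2 * n)))"
  proof -
    have abs: "(\<lambda>a. of_int a ^ 1 * (- q) powi a * Q.gm a) abs_summable_on UNIV"
      by (rule Q.abs_summable_gm[OF x])
    have pos: "(if n = 0 then 0 else of_int (int n) ^ 1 * (- q) powi (int n) * Q.gm (int n))
        = of_nat n * (- q) ^ n * inverse (1 - q ^ (2 * n))" for n
      unfolding Q.gm_nat by (simp add: power_mult)
    have neg: "(if n = 0 then 0 else of_int (- int n) ^ 1 * (- q) powi (- int n) * Q.gm (- int n))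
        = of_nat n * (- q) ^ n * inverse (1 - q ^ (2 * n))" for n
    proof -
      have "(q\<^sup>2) ^ n = (- q) ^ n * (- q) ^ n" by (simp add: power2_eq_square flip: power_mult_distrib)
      then have P: "(- q) powi (- int n) * (q\<^sup>2) ^ n = (- q) ^ n"
        using q0 by (simp add: power_int_minus)
      have gen: "of_int (- int n) ^ 1 * X * - (A * B) = of_nat n * (X * A) * B" for X A B :: complex
        by (simp add: mult_ac)
      show ?thesis
      proof (cases "n = 0")
        case False
        then show ?thesis by (simp only: if_False Q.gm_nat gen P power_mult)
      qed simp
    qed
    show ?thesis
      unfolding Q.wp_sum_def infsum_int_split[OF abs] pos neg by simp
  qed
  also have "Q.wp 0 = - 1 / 4 + 2 * (\<Sum>n. (-1) ^ n * of_nat n * q ^ (2 * n) * inverse (1 - q ^ (2 * n)))"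
    unfolding Q.wp_0 eval_fps_def Q.u_fps_def by (simp add: power_mult)
  finally have 1: "(theta3_0 (- q)) ^ 4 = 1 + 8 * ((\<Sum>n. of_nat n * (- q) ^ n * inverse (1 - q ^ (2 * n)))
      - (\<Sum>n. (-1) ^ n * of_nat n * q ^ (2 * n) * inverse (1 - q ^ (2 * n))))"
    by (simp add: algebra_simps)
  have ne: "1 - q ^ n \<noteq> 0" "1 + q ^ n \<noteq> 0" if "n > 0" for n using power_ne that by auto
  have s1: "summable (\<lambda>n. of_nat n * (- q) ^ n * inverse (1 - q ^ (2 * n)))"
  proof -
    have "summable (\<lambda>n. norm (of_int (int n) ^ 1 * (- q) powi (int n) * Q.gm (int n)))"
      using Q.abs_summable_gm[OF x, of 1] by (simp only: abs_summable_on_int_iff)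
    then have "summable (\<lambda>n. of_int (int n) ^ 1 * (- q) powi (int n) * Q.gm (int n))"
      by (rule summable_norm_cancel)
    then show ?thesis unfolding Q.gm_nat by (simp add: power_mult)
  qed
  have s2: "summable (\<lambda>n. (-1) ^ n * of_nat n * q ^ (2 * n) * inverse (1 - q ^ (2 * n)))"
  proof -
    have "ereal (norm (1::complex)) < fps_conv_radius Q.u_fps"
      using Q.radius_dom(1)[OF Q.dom_topology(3), of 0] by simp
    from summable_fps[OF this] show ?thesis by (simp add: Q.u_fps_def power_mult)
  qed
  have "of_nat n * (- q) ^ n * inverse (1 - q ^ (2 * n)) - (-1) ^ n * of_nat n * q ^ (2 * n) * inverse (1 - q ^ (2 * n))
      = fps_nth (fps_XD t_fps) n" for n
  proof (cases "n = 0")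
    case False
    then have n: "1 - q ^ n \<noteq> 0" "1 + q ^ n \<noteq> 0" using ne by auto
    have fact: "q ^ (2 * n) = q ^ n * q ^ n" by (simp add: mult_2 power_add)
    \<comment> \<open>The factor 1 - q^n cancels, leaving (q^n - q^(2n)) / (1 - q^(2n)) = q^n / (1 +
      q^n).\<close>
    have "1 - q ^ n * q ^ n = (1 - q ^ n) * (1 + q ^ n)" "q ^ n - q ^ n * q ^ n = q ^ n * (1 - q ^ n)"
      by (simp_all add: algebra_simps)
    then have "(q ^ n - q ^ (2 * n)) * inverse (1 - q ^ (2 * n))
        = q ^ n * inverse (1 + q ^ n) * ((1 - q ^ n) * inverse (1 - q ^ n))"
      unfolding fact by (simp only: inverse_mult_distrib mult_ac)
    then have key: "(q ^ n - q ^ (2 * n)) * inverse (1 - q ^ (2 * n)) = q ^ n * inverse (1 + q ^ n)"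
      unfolding right_inverse[OF n(1)] by simp
    have pow: "(- q) ^ n = (-1) ^ n * q ^ n" by (simp flip: power_mult_distrib)
    have "of_nat n * (- q) ^ n * inverse (1 - q ^ (2 * n)) - (-1) ^ n * of_nat n * q ^ (2 * n) * inverse (1 - q ^ (2 * n))
        = (-1) ^ n * of_nat n * ((q ^ n - q ^ (2 * n)) * inverse (1 - q ^ (2 * n)))"
      unfolding pow by (simp only: left_diff_distrib right_diff_distrib mult_ac)
    then show ?thesis
      unfolding key using False by (simp add: t_fps_def mult_ac)
  qed (simp add: t_fps_def)
  then have "(\<Sum>n. of_nat n * (- q) ^ n * inverse (1 - q ^ (2 * n)))
      - (\<Sum>n. (-1) ^ n * of_nat n * q ^ (2 * n) * inverse (1 - q ^ (2 * n))) = eval_fps (fps_XD t_fps) 1"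
    using suminf_diff[OF s1 s2] by (simp add: eval_fps_def)
  then show ?thesis unfolding 1 deriv_phi_0 by (simp add: algebra_simps)
qed

theorem theta_power_expansion:
  "theta3_0 (- q) ^ (4 * n * (n + 1)) =
      1 + (\<Sum>p=1..n. (-1) ^ (n - p) * 2 ^ (2 * n\<^sup>2 + 3 * n) * (\<Prod>r=1..2*n. inverse (fact r)) *
             (\<Sum>\<^sub>\<infinity>(y, m)\<in>index_set p. series_term n p q y m))"
proof -
  define \<theta> where "\<theta> = theta3_0 (- q)"
  define s where "s = (\<Sum>k<n. Suc k)"
  define F where "F = (\<Prod>r=1..2*n. fact r :: complex)"
  define X where "X = (\<Sum>p=1..n. (-1) ^ (n - p) * (\<Sum>\<^sub>\<infinity>(y, m)\<in>index_set p. series_term n p q y m))"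
  have s: "2 * s = n * (n + 1)"
    unfolding s_def by (induction n) (auto simp: algebra_simps)
  have F: "F \<noteq> 0" by (simp add: F_def)
  have sq: "(deriv phi 0)\<^sup>2 = \<theta> ^ 8 / 16"
  proof -
    have "\<theta> ^ 8 = (\<theta> ^ 4)\<^sup>2" by (simp flip: power_mult)
    then show ?thesis by (simp add: \<theta>_def theta_fourth_power power_mult_distrib)
  qed
  have lhs: "2 ^ n * det (mat n n (\<lambda>(i, j). lambert_sum q (i + j + 1) - of_real (a_coeff (i + j + 1))))
      = F * (\<theta> ^ (8 * s) / 16 ^ s)"
    using det_lambert_eq[of n] unfolding sq F_def s_def by (simp only: power_divide power_mult)
  have a: "(-2) ^ n * (of_real (det (mat n n (\<lambda>(i, j). a_coeff (i + j + 1)))) :: complex) = F * (1 / 16 ^ s)"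
    using arg_cong[OF det_a_coeff[of n], of "of_real :: real \<Rightarrow> complex"]
    by (simp add: F_def s_def power_divide)
  \<comment> \<open>The sign (-1)^n of the term p = 0 turns 2^n into (-2)^n, precisely the factor in
    \<open>det_a_coeff\<close>; after division by F / 16^s this term becomes the summand 1.\<close>
  have "2 ^ n * det (mat n n (\<lambda>(i, j). lambert_sum q (i + j + 1) - of_real (a_coeff (i + j + 1))))
      = (-2) ^ n * of_real (det (mat n n (\<lambda>(i, j). a_coeff (i + j + 1)))) + 2 ^ n * X"
    unfolding det_lambert_minus_tangent[OF lambert_term_abs_summable] X_def
    by (simp add: distrib_left mult.assoc[symmetric] flip: power_mult_distrib)
  then have "F * (\<theta> ^ (8 * s) / 16 ^ s) = F * (1 / 16 ^ s) + 2 ^ n * X"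
    unfolding lhs a .
  then have "\<theta> ^ (8 * s) = 1 + 2 ^ n * 16 ^ s * inverse F * X"
    using F by (simp add: field_simps)
  moreover have "8 * s = 4 * n * (n + 1)" using s by simp
  moreover have "(2 :: complex) ^ n * 16 ^ s = 2 ^ (2 * n\<^sup>2 + 3 * n)"
  proof -
    have "(16 :: complex) ^ s = 2 ^ (4 * s)" by (simp add: power_mult)
    moreover have "n + 4 * s = 2 * n\<^sup>2 + 3 * n" using s by (simp add: power2_eq_square algebra_simps)
    ultimately show ?thesis by (simp add: add.commute flip: power_add)
  qed
  moreover have "inverse F = (\<Prod>r=1..2*n. inverse (fact r))"
    unfolding F_def by (rule prod_inversef[symmetric, unfolded comp_def])
  ultimately have "\<theta> ^ (4 * n * (n + 1)) = 1 + 2 ^ (2 * n\<^sup>2 + 3 * n) * (\<Prod>r=1..2*n. inverse (fact r)) * X"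
    by simp
  then show ?thesis
    unfolding \<theta>_def X_def by (simp add: sum_distrib_left mult_ac)
qed

end

theorem theorem7p2:
  fixes q :: complex and n :: nat
  assumes "0 < norm q" and "norm q < 1" and "n \<ge> 1"
  shows "(\<forall>p\<in>{1..n}. (\<lambda>(y, m). series_term n p q y m) abs_summable_on index_set p) \<and>
    theta3_0 (- q) ^ (4 * n * (n + 1)) =
      1 + (\<Sum>p=1..n. (-1) ^ (n - p) * 2 ^ (2 * n\<^sup>2 + 3 * n) * (\<Prod>r=1..2*n. inverse (fact r)) *
             (\<Sum>\<^sub>\<infinity>(y, m)\<in>index_set p. series_term n p q y m))"
proof -
  interpret nome q using assms by unfold_locales auto
  show ?thesis
    using series_term_summation(1)[OF lambert_term_abs_summable] theta_power_expansion by auto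
qed

end
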